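(* Let $\Bbbk$ be a field of characteristic $0$ and let $\mathcal{H}_{HO}$ be the Grossman-Larson Hopf algebra of heap-ordered trees over $\Bbbk$. Then $\mathcal{H}_{HO}$ is isomorphic to the tensor Hopf algebra on a graded space $W=\bigoplus_{n\ge0}W_n$ with $\dim W_n$ equal to the number of $\backslash$-irreducible heap-ordered trees on $n+1$ nodes (or, equally, the number of $\backslash$-irreducible permutations of $[n]=\{1,\dots,n\}$).
   Context: **Heap-ordered trees and $\mathcal{H}_{HO}$.** An ordered tree is a finite rooted tree with a left-to-right linear order on the children of each node; it is planted if its root has exactly one child. The planted components $x_1,\dots,x_k$ of $x$, listed from left to right, are the branches at the root of $x$ (each including the root). A heap-ordered tree is an ordered tree $x$ with a bijective labeling of its set of nodes $\mathrm{Nod}(x)$ by $\{0,1,\dots,n\}$ such that the root has label $0$, labels increase from a node to any of its children, and labels decrease from left to right among the children of each node. For heap-ordered trees $x,y$, $x$ with $k$ planted components, and $f:[k]=\{1,\dots,k\}\to\mathrm{Nod}(y)$, $x\,\#_f\,y$ is obtained by identifying the root of each $x_i$ with the node $f(i)$ of $y$ (keeping the order of components attached to the same node and placing them to the left of the children of that node in $y$), keeping the labels of $y$ and incrementing the (non-root) labels of $x$ by the highest label of $y$. For $S\subseteq[k]$, $x_S$ is the tree obtained by erasing the branches at the root of $x$ not indexed by $S$ and standardizing the labels (the root keeps label $0$, the $i$-th smallest remaining non-root label is replaced by $i$); $S^c=[k]\setminus S$. $\mathcal{H}_{HO}$ is the vector space with basis the heap-ordered trees, with $$x\cdot y=\sum_{f:[k]\to\mathrm{Nod}(y)}x\,\#_f\,y,\qquad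 \Delta(x)=\sum_{S\subseteq[k]}x_S\otimes x_{S^c}.$$ It is a graded connected cocommutative Hopf algebra, the degree being one less than the number of nodes; the unit is the one-node tree. **The operation $\backslash$ and irreducibility.** For heap-ordered trees $x,y$, $x\backslash y$ is obtained by identifying the roots, placing the branches of $x$ to the left of those of $y$, keeping the labels of $y$ and incrementing the non-root labels of $x$ by the maximum label of $y$. A heap-ordered tree with more than one node is $\backslash$-irreducible if it is not of the form $x\backslash y$ with $x$ and $y$ both different from the one-node tree (the one-node tree is not irreducible). For permutations (written as words) $u$ of $[p]$ and $v$ of $[q]$, $u\backslash v$ lists the values of $u$ incremented by $q$, followed by the values of $v$; a permutation of $[n]$, $n\ge1$, is $\backslash$-irreducible if it is not $u\backslash v$ with $u,v$ both nonempty (the empty permutation is not irreducible). **Tensor Hopf algebra.** For a vector space $W$, $T(W)=\bigoplus_{k\ge0}W^{\otimes k}$ with the concatenation product (the free algebra on $W$) and the unique Hopf algebra structure for which $\Delta(v)=1\otimes v+v\otimes1$ and $\epsilon(v)=0$ for all $v\in W$. *)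

theory Defs
  imports
    "HOL-Library.Poly_Mapping"
    "HOL-Library.FuncSet"
    "HOL-Combinatorics.Multiset_Permutations"
begin

section \<open>Free vector spaces, their tensor products and gradings\<close>

text \<open>
  The vector space with basis a type \<open>'a\<close> is rendered as \<open>'a \<Rightarrow>\<^sub>0 'k\<close>, the basis vector of \<open>x\<close>
  being \<open>basis_vec x\<close>.  The tensor product of the spaces on \<open>'a\<close> and \<open>'b\<close> is
  the space on \<open>'a \<times> 'b\<close>, with \<open>x \<otimes> y\<close> corresponding to the basis vector of \<open>(x, y)\<close>.
\<close>

abbreviation basis_vec :: "'a \<Rightarrow> ('a \<Rightarrow>\<^sub>0 'k::field)" where
  "basis_vec x \<equiv> Poly_Mapping.single x 1"

definition scale :: "'k::field \<Rightarrow> ('a \<Rightarrow>\<^sub>0 'k) \<Rightarrow> ('a \<Rightarrow>\<^sub>0 'k)" where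
  "scale c p = Poly_Mapping.map ((*) c) p"

lemma lookup_scale [simp]: "Poly_Mapping.lookup (scale c p) x = c * Poly_Mapping.lookup p x"
  by (simp add: scale_def Poly_Mapping.map.rep_eq when_def)

global_interpretation fvs: vector_space "scale :: 'k::field \<Rightarrow> ('a \<Rightarrow>\<^sub>0 'k) \<Rightarrow> ('a \<Rightarrow>\<^sub>0 'k)"
  by unfold_locales (auto intro!: poly_mapping_eqI simp: lookup_add algebra_simps)

definition lin_ext :: "('a \<Rightarrow> ('b \<Rightarrow>\<^sub>0 'k::field)) \<Rightarrow> ('a \<Rightarrow>\<^sub>0 'k) \<Rightarrow> ('b \<Rightarrow>\<^sub>0 'k)" where
  "lin_ext f p = (\<Sum>x\<in>Poly_Mapping.keys p. scale (Poly_Mapping.lookup p x) (f x))"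

definition bilin_ext ::
    "('a \<Rightarrow> 'b \<Rightarrow> ('c \<Rightarrow>\<^sub>0 'k::field)) \<Rightarrow> ('a \<Rightarrow>\<^sub>0 'k) \<Rightarrow> ('b \<Rightarrow>\<^sub>0 'k) \<Rightarrow> ('c \<Rightarrow>\<^sub>0 'k)" where
  "bilin_ext f p q =
     (\<Sum>x\<in>Poly_Mapping.keys p. \<Sum>y\<in>Poly_Mapping.keys q.
        scale (Poly_Mapping.lookup p x * Poly_Mapping.lookup q y) (f x y))"

lemma lin_ext_sum:
  assumes "finite A" "Poly_Mapping.keys p \<subseteq> A"
  shows "lin_ext f p = (\<Sum>x\<in>A. scale (Poly_Mapping.lookup p x) (f x))"
  unfolding lin_ext_def
  by (rule sum.mono_neutral_left) (use assms in \<open>auto simp: in_keys_iff\<close>)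

lemma lin_ext_linear: "Vector_Spaces.linear scale scale (lin_ext f)"
proof -
  have "lin_ext f (p + q) = lin_ext f p + lin_ext f q" for p q
  proof -
    let ?A = "Poly_Mapping.keys p \<union> Poly_Mapping.keys q"
    have "finite ?A" "Poly_Mapping.keys (p + q) \<subseteq> ?A"
      by (auto simp: keys_add)
    then show ?thesis
      by (simp add: lin_ext_sum[of ?A] lookup_add fvs.scale_left_distrib sum.distrib)
  qed
  moreover have "lin_ext f (scale c p) = scale c (lin_ext f p)" for c p
    by (subst lin_ext_sum[of "Poly_Mapping.keys p"])
       (auto simp: lin_ext_def in_keys_iff fvs.scale_sum_right)
  ultimately show ?thesis
    by (simp add: Vector_Spaces.linear_iff fvs.vector_space_axioms)
qed

lemma lin_ext_add: "lin_ext f (p + q) = lin_ext f p + lin_ext f q"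
  using lin_ext_linear[of f] by (simp add: Vector_Spaces.linear_iff)

lemma lin_ext_basis [simp]: "lin_ext f (basis_vec x) = f x"
  by (simp add: lin_ext_def)

lemma bilin_ext_lin_ext: "bilin_ext f p q = lin_ext (\<lambda>x. lin_ext (f x) q) p"
  by (simp add: bilin_ext_def lin_ext_def fvs.scale_sum_right)

lemma bilin_ext_basis [simp]: "bilin_ext f (basis_vec x) (basis_vec y) = f x y"
  by (simp add: bilin_ext_lin_ext)

lemma linear_eqI:
  fixes f g :: "('a \<Rightarrow>\<^sub>0 'k::field) \<Rightarrow> ('b \<Rightarrow>\<^sub>0 'k)"
  assumes "Vector_Spaces.linear scale scale f" "Vector_Spaces.linear scale scale g"
    and "\<And>x. f (basis_vec x) = g (basis_vec x)"
  shows "f p = g p"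
proof -
  interpret f: Vector_Spaces.linear scale scale f by fact
  interpret g: Vector_Spaces.linear scale scale g by fact
  have "p = (\<Sum>x\<in>Poly_Mapping.keys p. scale (Poly_Mapping.lookup p x) (basis_vec x))"
    by (rule poly_mapping_eqI)
       (auto simp: lookup_sum lookup_single when_def in_keys_iff sum.delta if_distrib cong: if_cong)
  then show ?thesis
    by (metis (no_types, lifting) f.sum g.sum f.scale g.scale assms(3) sum.cong)
qed

definition tensor :: "('a \<Rightarrow>\<^sub>0 'k::field) \<Rightarrow> ('b \<Rightarrow>\<^sub>0 'k) \<Rightarrow> ('a \<times> 'b \<Rightarrow>\<^sub>0 'k)" where
  "tensor = bilin_ext (\<lambda>x y. basis_vec (x, y))"

definition tensor_map ::
    "(('a \<Rightarrow>\<^sub>0 'k::field) \<Rightarrow> ('c \<Rightarrow>\<^sub>0 'k)) \<Rightarrow> (('b \<Rightarrow>\<^sub>0 'k) \<Rightarrow> ('d \<Rightarrow>\<^sub>0 'k))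
      \<Rightarrow> ('a \<times> 'b \<Rightarrow>\<^sub>0 'k) \<Rightarrow> ('c \<times> 'd \<Rightarrow>\<^sub>0 'k)" where
  "tensor_map f g =
     lin_ext (\<lambda>(x, y). tensor (f (basis_vec x)) (g (basis_vec y)))"

text \<open>The multiplication \<open>(a \<otimes> b)(c \<otimes> d) = ac \<otimes> bd\<close> on the tensor square of an algebra.\<close>

definition tensor_square_mult ::
    "(('a \<Rightarrow>\<^sub>0 'k) \<Rightarrow> ('a \<Rightarrow>\<^sub>0 'k) \<Rightarrow> ('a \<Rightarrow>\<^sub>0 'k))
      \<Rightarrow> ('a \<times> 'a \<Rightarrow>\<^sub>0 'k::field) \<Rightarrow> ('a \<times> 'a \<Rightarrow>\<^sub>0 'k) \<Rightarrow> ('a \<times> 'a \<Rightarrow>\<^sub>0 'k)" where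
  "tensor_square_mult m = bilin_ext (\<lambda>(a, b) (c, d).
     tensor (m (basis_vec a) (basis_vec c)) (m (basis_vec b) (basis_vec d)))"

definition finite_dimensional :: "('a \<Rightarrow>\<^sub>0 'k::field) set \<Rightarrow> bool" where
  "finite_dimensional V \<longleftrightarrow> (\<exists>B. finite B \<and> V = fvs.span B)"

text \<open>\<open>V\<close> makes the whole space the direct sum of the subspaces \<open>V n\<close>.\<close>

definition is_grading :: "(nat \<Rightarrow> ('a \<Rightarrow>\<^sub>0 'k::field) set) \<Rightarrow> bool" where
  "is_grading V \<longleftrightarrow> (\<forall>n. fvs.subspace (V n)) \<and>
     (\<forall>v. \<exists>!c :: nat \<Rightarrow>\<^sub>0 ('a \<Rightarrow>\<^sub>0 'k).
        (\<forall>n. Poly_Mapping.lookup c n \<in> V n) \<and>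
        v = (\<Sum>n\<in>Poly_Mapping.keys c. Poly_Mapping.lookup c n))"


section \<open>Isomorphisms of Hopf algebras\<close>

record (overloaded) ('a, 'k) hopf_data =
  hmult :: "('a \<Rightarrow>\<^sub>0 'k::field) \<Rightarrow> ('a \<Rightarrow>\<^sub>0 'k) \<Rightarrow> ('a \<Rightarrow>\<^sub>0 'k)"
  hunit :: "'a \<Rightarrow>\<^sub>0 'k"
  hcomult :: "('a \<Rightarrow>\<^sub>0 'k) \<Rightarrow> ('a \<times> 'a \<Rightarrow>\<^sub>0 'k)"
  hcounit :: "('a \<Rightarrow>\<^sub>0 'k) \<Rightarrow> 'k"

text \<open>Antipodes need no mention: a bialgebra morphism of Hopf algebras preserves them.\<close>

definition hopf_iso ::
    "('a, 'k::field) hopf_data \<Rightarrow> ('b, 'k) hopf_data \<Rightarrow> (('a \<Rightarrow>\<^sub>0 'k) \<Rightarrow> ('b \<Rightarrow>\<^sub>0 'k)) \<Rightarrow> bool" where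
  "hopf_iso A B \<phi> \<longleftrightarrow>
     Vector_Spaces.linear scale scale \<phi> \<and> bij \<phi> \<and>
     (\<forall>p q. \<phi> (hmult A p q) = hmult B (\<phi> p) (\<phi> q)) \<and>
     \<phi> (hunit A) = hunit B \<and>
     (\<forall>p. hcomult B (\<phi> p) = tensor_map \<phi> \<phi> (hcomult A p)) \<and>
     (\<forall>p. hcounit B (\<phi> p) = hcounit A p)"


section \<open>The tensor Hopf algebra\<close>

text \<open>
  For a space \<open>W\<close> with basis \<open>'x\<close>, the space \<open>T(W)\<close> has the words in \<open>'x\<close> as a basis, the word
  \<open>[x\<^sub>1, \<dots>, x\<^sub>k]\<close> standing for \<open>x\<^sub>1 \<otimes> \<dots> \<otimes> x\<^sub>k\<close>.
\<close>

definition tensor_incl :: "('x \<Rightarrow>\<^sub>0 'k::field) \<Rightarrow> ('x list \<Rightarrow>\<^sub>0 'k)" where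
  "tensor_incl = lin_ext (\<lambda>x. basis_vec [x])"

definition concat_mult :: "('x list \<Rightarrow>\<^sub>0 'k::field) \<Rightarrow> ('x list \<Rightarrow>\<^sub>0 'k) \<Rightarrow> ('x list \<Rightarrow>\<^sub>0 'k)" where
  "concat_mult = bilin_ext (\<lambda>u v. basis_vec (u @ v))"

text \<open>The multiplicative extension of \<open>x \<mapsto> 1 \<otimes> x + x \<otimes> 1\<close> to words.\<close>

primrec word_comult :: "'x list \<Rightarrow> ('x list \<times> 'x list \<Rightarrow>\<^sub>0 'k::field)" where
  "word_comult [] = basis_vec ([], [])"
| "word_comult (x # w) =
     tensor_square_mult concat_mult
       (basis_vec ([], [x]) + basis_vec ([x], [])) (word_comult w)"

definition tensor_hopf :: "('x list, 'k::field) hopf_data" where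
  "tensor_hopf = \<lparr>
     hmult = concat_mult,
     hunit = basis_vec [],
     hcomult = lin_ext word_comult,
     hcounit = (\<lambda>p. Poly_Mapping.lookup p [])\<rparr>"

text \<open>\<open>tensor_hopf\<close> carries the structure determined by \<open>\<Delta>(v) = 1 \<otimes> v + v \<otimes> 1\<close> and \<open>\<epsilon>(v) = 0\<close>.\<close>

lemma linear_bilin_ext_left: "Vector_Spaces.linear scale scale (\<lambda>p. bilin_ext f p q)"
  unfolding bilin_ext_lin_ext by (rule lin_ext_linear)

lemma bilin_ext_flip: "bilin_ext f p q = bilin_ext (\<lambda>y x. f x y) q p"
  unfolding bilin_ext_def by (subst sum.swap) (simp add: mult.commute)

lemma linear_bilin_ext_right: "Vector_Spaces.linear scale scale (\<lambda>q. bilin_ext f p q)"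
  by (subst bilin_ext_flip) (rule linear_bilin_ext_left)

lemma linear_comp:
  assumes "Vector_Spaces.linear scale scale f" "Vector_Spaces.linear scale scale g"
  shows "Vector_Spaces.linear scale scale (\<lambda>x. f (g x))"
  using Vector_Spaces.linear_compose[OF assms(2,1)] by (simp add: comp_def)

lemmas linear_intros = linear_bilin_ext_left linear_bilin_ext_right lin_ext_linear
  linear_comp[OF linear_bilin_ext_left] linear_comp[OF linear_bilin_ext_right]
  linear_comp[OF lin_ext_linear]

lemmas linear_concat_mult =
  linear_bilin_ext_left[of "\<lambda>u v. basis_vec (u @ v)", folded concat_mult_def]
  linear_bilin_ext_right[of "\<lambda>u v. basis_vec (u @ v)", folded concat_mult_def]

lemma linear_plus:
  assumes "Vector_Spaces.linear scale scale f" "Vector_Spaces.linear scale scale g"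
  shows "Vector_Spaces.linear scale scale (\<lambda>x. f x + g x)"
  using assms by (simp add: Vector_Spaces.linear_iff fvs.scale_right_distrib algebra_simps)

lemma tensor_square_concat_mult:
  "tensor_square_mult concat_mult = bilin_ext (\<lambda>(a, b) (c, d). basis_vec (a @ c, b @ d))"
  by (simp add: tensor_square_mult_def concat_mult_def tensor_def)

lemma tensor_square_concat_mult_assoc:
  fixes p q r :: "'x list \<times> 'x list \<Rightarrow>\<^sub>0 'k::field"
  defines "m \<equiv> tensor_square_mult concat_mult"
  shows "m (m p q) r = m p (m q r)"
proof -
  note lin = linear_intros
  have 1: "m (m (basis_vec a) (basis_vec b)) (basis_vec c) = m (basis_vec a) (m (basis_vec b) (basis_vec c))" for a b c
    unfolding m_def tensor_square_concat_mult by (cases a; cases b; cases c) simp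
  have 2: "m (m (basis_vec a) (basis_vec b)) r = m (basis_vec a) (m (basis_vec b) r)" for a b
    by (rule linear_eqI[of "\<lambda>r. m (m (basis_vec a) (basis_vec b)) r" "\<lambda>r. m (basis_vec a) (m (basis_vec b) r)"])
       (use 1 in \<open>auto simp: m_def tensor_square_concat_mult intro: lin\<close>)
  have 3: "m (m (basis_vec a) q) r = m (basis_vec a) (m q r)" for a
    by (rule linear_eqI[of "\<lambda>q. m (m (basis_vec a) q) r" "\<lambda>q. m (basis_vec a) (m q r)"])
       (use 2 in \<open>auto simp: m_def tensor_square_concat_mult intro: lin\<close>)
  show ?thesis
    by (rule linear_eqI[of "\<lambda>p. m (m p q) r" "\<lambda>p. m p (m q r)"])
       (use 3 in \<open>auto simp: m_def tensor_square_concat_mult intro: lin\<close>)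
qed

lemma word_comult_append:
  "word_comult (u @ v) =
     (tensor_square_mult concat_mult (word_comult u) (word_comult v) :: _ \<Rightarrow>\<^sub>0 'k::field)"
proof (induction u)
  case Nil
  have "p = tensor_square_mult concat_mult (basis_vec ([], [])) p"
    for p :: "'a list \<times> 'a list \<Rightarrow>\<^sub>0 'k"
    by (rule linear_eqI[where f = "\<lambda>p. p"])
       (auto simp: tensor_square_concat_mult fvs.linear_ident intro: linear_intros)
  then show ?case by simp
qed (simp add: tensor_square_concat_mult_assoc)

lemma tensor_hopf_comult_mult:
  "hcomult tensor_hopf (hmult tensor_hopf p q) =
     tensor_square_mult (hmult tensor_hopf) (hcomult tensor_hopf p)
       (hcomult tensor_hopf q :: _ \<Rightarrow>\<^sub>0 'k::field)"
proof -
  let ?D = "lin_ext word_comult" and ?m = concat_mult and ?M = "tensor_square_mult concat_mult"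
  have 1: "?D (?m (basis_vec u) (basis_vec v)) = ?M (?D (basis_vec u)) (?D (basis_vec v))" for u v
    by (simp add: concat_mult_def word_comult_append)
  have 2: "?D (?m (basis_vec u) q) = ?M (?D (basis_vec u)) (?D q)" for u
    by (rule linear_eqI[of "\<lambda>q. ?D (?m (basis_vec u) q)" "\<lambda>q. ?M (?D (basis_vec u)) (?D q)"])
       (use 1 in \<open>auto simp: tensor_square_concat_mult intro: linear_intros linear_concat_mult\<close>)
  have "?D (?m p q) = ?M (?D p) (?D q)"
    by (rule linear_eqI[of "\<lambda>p. ?D (?m p q)" "\<lambda>p. ?M (?D p) (?D q)"])
       (use 2 in \<open>auto simp: tensor_square_concat_mult intro: linear_intros linear_concat_mult\<close>)
  then show ?thesis by (simp add: tensor_hopf_def)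
qed

lemma tensor_hopf_comult_tensor_incl:
  "hcomult tensor_hopf (tensor_incl v) =
     tensor (hunit tensor_hopf) (tensor_incl v) +
     (tensor (tensor_incl v) (hunit tensor_hopf) :: _ \<Rightarrow>\<^sub>0 'k::field)"
  unfolding tensor_hopf_def tensor_incl_def hopf_data.simps
  by (rule linear_eqI[where f = "\<lambda>v. lin_ext word_comult (lin_ext (\<lambda>x. basis_vec [x]) v)"
         and g = "\<lambda>v. tensor (basis_vec []) (lin_ext (\<lambda>x. basis_vec [x]) v) +
                       tensor (lin_ext (\<lambda>x. basis_vec [x]) v) (basis_vec [])"])
     (auto simp: tensor_def tensor_square_concat_mult bilin_ext_lin_ext lin_ext_add
        intro!: linear_plus linear_intros)

lemma tensor_hopf_counit_tensor_incl: "hcounit tensor_hopf (tensor_incl v) = 0"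
  by (simp add: tensor_hopf_def tensor_incl_def lin_ext_def lookup_sum lookup_single)

lemma tensor_hopf_counit_mult:
  "hcounit tensor_hopf (hmult tensor_hopf p q) = hcounit tensor_hopf p * hcounit tensor_hopf q"
proof -
  have "(\<Sum>u\<in>Poly_Mapping.keys p. \<Sum>v\<in>Poly_Mapping.keys q.
           Poly_Mapping.lookup p u * Poly_Mapping.lookup q v * (if u = [] \<and> v = [] then 1 else 0)) =
        (\<Sum>u\<in>Poly_Mapping.keys p. if u = [] then Poly_Mapping.lookup p u * Poly_Mapping.lookup q [] else 0)"
    by (intro sum.cong refl)
       (auto simp: if_distrib sum.delta in_keys_iff cong: if_cong)
  also have "\<dots> = Poly_Mapping.lookup p [] * Poly_Mapping.lookup q []"
    by (auto simp: sum.delta in_keys_iff)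
  finally show ?thesis
    by (simp add: tensor_hopf_def concat_mult_def bilin_ext_def lookup_sum lookup_single when_def)
qed

text \<open>The grading of \<open>T(W)\<close> induced by a grading of \<open>W\<close>.\<close>

definition tensor_grading ::
    "(nat \<Rightarrow> ('x \<Rightarrow>\<^sub>0 'k::field) set) \<Rightarrow> nat \<Rightarrow> ('x list \<Rightarrow>\<^sub>0 'k) set" where
  "tensor_grading W n = fvs.span
     {foldr (\<lambda>w. concat_mult (tensor_incl w)) ws (basis_vec []) | ws ds.
        list_all2 (\<lambda>w d. w \<in> W d) ws ds \<and> sum_list ds = n}"


section \<open>Heap-ordered trees\<close>

datatype 'l ltree = Node (label: 'l) (children: "'l ltree list")

text \<open>The list of all labels, with repetitions; its length is the number of nodes.\<close>

primrec preorder :: "'l ltree \<Rightarrow> 'l list" where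
  "preorder (Node a ts) = a # concat (map preorder ts)"

definition num_nodes :: "'l ltree \<Rightarrow> nat" where
  "num_nodes t = length (preorder t)"

primrec heap_labelled :: "nat ltree \<Rightarrow> bool" where
  "heap_labelled (Node a ts) \<longleftrightarrow>
     (\<forall>t\<in>set ts. a < label t) \<and> sorted_wrt (>) (map label ts) \<and> list_all heap_labelled ts"

definition is_heap_ordered :: "nat ltree \<Rightarrow> bool" where
  "is_heap_ordered t \<longleftrightarrow>
     distinct (preorder t) \<and> set_ltree t = {..<num_nodes t} \<and> label t = 0 \<and> heap_labelled t"

typedef hotree = "{t. is_heap_ordered t}"
  morphisms tree_of Abs_hotree
  by (rule exI[of _ "Node 0 []"]) (simp add: is_heap_ordered_def num_nodes_def lessThan_Suc)

definition one_node :: hotree where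
  "one_node = Abs_hotree (Node 0 [])"

definition nodes :: "hotree \<Rightarrow> nat" where
  "nodes x = num_nodes (tree_of x)"

text \<open>The nodes of a heap-ordered tree are identified with their labels.\<close>

definition Nod :: "hotree \<Rightarrow> nat set" where
  "Nod x = set_ltree (tree_of x)"

text \<open>
  A planted component is represented by its branch without the root of the tree.  The planted
  components of \<open>x\<close> are indexed from \<open>0\<close>: they are \<open>branches x ! i\<close> for \<open>i < length (branches x)\<close>.
\<close>

definition branches :: "hotree \<Rightarrow> nat ltree list" where
  "branches x = children (tree_of x)"

primrec attach :: "(nat \<Rightarrow> nat ltree list) \<Rightarrow> nat ltree \<Rightarrow> nat ltree" where
  "attach g (Node a ts) = Node a (g a @ map (attach g) ts)"

definition shifted_branches :: "hotree \<Rightarrow> hotree \<Rightarrow> nat ltree list" where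
  "shifted_branches y x = map (map_ltree (\<lambda>l. l + Max (Nod y))) (branches x)"

definition graft :: "hotree \<Rightarrow> (nat \<Rightarrow> nat) \<Rightarrow> hotree \<Rightarrow> hotree" where
  "graft x f y =
     Abs_hotree (attach (\<lambda>v. nths (shifted_branches y x) {i. f i = v}) (tree_of y))"

definition standardize :: "nat ltree \<Rightarrow> nat ltree" where
  "standardize t = map_ltree (\<lambda>l. card {m \<in> set_ltree t. m < l}) t"

definition restrict_branches :: "hotree \<Rightarrow> nat set \<Rightarrow> hotree" where
  "restrict_branches x S = Abs_hotree (standardize (Node 0 (nths (branches x) S)))"


section \<open>The Hopf algebra of heap-ordered trees\<close>

definition HHO :: "(hotree, 'k::field) hopf_data" where
  "HHO = \<lparr>
     hmult = bilin_ext (\<lambda>x y.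
       \<Sum>f \<in> {..<length (branches x)} \<rightarrow>\<^sub>E Nod y. basis_vec (graft x f y)),
     hunit = basis_vec one_node,
     hcomult = lin_ext (\<lambda>x.
       \<Sum>S \<in> Pow {..<length (branches x)}.
         basis_vec
           (restrict_branches x S, restrict_branches x ({..<length (branches x)} - S))),
     hcounit = (\<lambda>p. Poly_Mapping.lookup p one_node)\<rparr>"

definition HHO_grading :: "nat \<Rightarrow> (hotree \<Rightarrow>\<^sub>0 'k::field) set" where
  "HHO_grading n = fvs.span {basis_vec x | x. nodes x = n + 1}"


section \<open>The backslash operation and irreducibility\<close>

definition backslash :: "hotree \<Rightarrow> hotree \<Rightarrow> hotree" where
  "backslash x y = Abs_hotree (Node 0 (shifted_branches y x @ branches y))"

definition tree_irreducible :: "hotree \<Rightarrow> bool" where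
  "tree_irreducible z \<longleftrightarrow>
     z \<noteq> one_node \<and> \<not> (\<exists>x y. x \<noteq> one_node \<and> y \<noteq> one_node \<and> z = backslash x y)"

definition perm_backslash :: "nat list \<Rightarrow> nat list \<Rightarrow> nat list" where
  "perm_backslash u v = map (\<lambda>i. i + length v) u @ v"

definition perm_irreducible :: "nat \<Rightarrow> nat list \<Rightarrow> bool" where
  "perm_irreducible n w \<longleftrightarrow> n \<ge> 1 \<and> w \<in> permutations_of_set {1..n} \<and>
     \<not> (\<exists>p q u v. u \<in> permutations_of_set {1..p} \<and> v \<in> permutations_of_set {1..q} \<and>
          u \<noteq> [] \<and> v \<noteq> [] \<and> w = perm_backslash u v)"


section \<open>The tree operations produce heap-ordered trees\<close>

text \<open>
  The operations above are given through \<^term>\<open>Abs_hotree\<close>; the lemmas \<open>tree_of_one_node\<close>,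
  \<open>tree_of_graft\<close>, \<open>tree_of_restrict_branches\<close> and \<open>tree_of_backslash\<close> justify this.
\<close>

lemma set_preorder: "set (preorder t) = set_ltree t"
  by (induction t) auto

lemma preorder_map: "preorder (map_ltree h t) = map h (preorder t)"
  by (induction t) (simp add: map_concat comp_def cong: map_cong)

lemma label_map: "label (map_ltree h t) = h (label t)"
  by (cases t) auto

lemma label_in: "label t \<in> set_ltree t"
  by (cases t) auto

lemma heap_labelled_map:
  assumes "heap_labelled t" "strict_mono_on (set_ltree t) h"
  shows "heap_labelled (map_ltree h t)"
  using assms
proof (induction t)
  case (Node a ts)
  have mono: "\<And>x y. x \<in> set_ltree (Node a ts) \<Longrightarrow> y \<in> set_ltree (Node a ts) \<Longrightarrow> x < y \<Longrightarrow> h x < h y"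
    using Node.prems(2) by (auto simp: strict_mono_on_def)
  have lab: "t \<in> set ts \<Longrightarrow> label t \<in> set_ltree (Node a ts)" for t
    using label_in[of t] by auto
  have "\<forall>t\<in>set ts. a < label t" "sorted_wrt (>) (map label ts)" "\<forall>t\<in>set ts. heap_labelled t"
    using Node.prems(1) by (auto simp: list_all_iff)
  moreover have "heap_labelled (map_ltree h t)" if "t \<in> set ts" for t
  proof (rule Node.IH[OF that])
    show "heap_labelled t" using calculation that by auto
    show "strict_mono_on (set_ltree t) h"
      using that by (intro strict_mono_onI mono) auto
  qed
  moreover have "sorted_wrt (\<lambda>x y. h (label y) < h (label x)) ts"
  proof (rule sorted_wrt_mono_rel)
    show "sorted_wrt (\<lambda>x y. label y < label x) ts"
      using calculation(2) by (simp add: sorted_wrt_map)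
    show "h (label y) < h (label x)" if "x \<in> set ts" "y \<in> set ts" "label y < label x" for x y
      using that lab mono by blast
  qed
  moreover have "h a < h (label t)" if "t \<in> set ts" for t
    using calculation(1) that by (intro mono lab) auto
  ultimately show ?case
    by (simp add: list_all_iff sorted_wrt_map label_map comp_def)
qed

lemma heap_ordered_tree_of: "is_heap_ordered (tree_of x)"
  using tree_of[of x] by simp

lemma mset_preorder_attach:
  "mset (preorder (attach g t)) =
     mset (preorder t) + (\<Sum>a\<in>#mset (preorder t). mset (concat (map preorder (g a))))"
proof (induction t)
  case (Node a ts)
  have "mset (concat (map (preorder \<circ> attach g) ts)) =
     mset (concat (map preorder ts)) +
     (\<Sum>a\<in>#mset (concat (map preorder ts)). mset (concat (map preorder (g a))))"
    using Node by (induction ts) (auto simp: algebra_simps)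
  then show ?case by simp
qed

lemma label_attach [simp]: "label (attach g t) = label t"
  by (cases t) auto

lemma heap_labelled_attach:
  assumes "heap_labelled t"
    and "\<And>v. v \<in> set_ltree t \<Longrightarrow> sorted_wrt (>) (map label (g v)) \<and> list_all heap_labelled (g v)"
    and "\<And>v w s. v \<in> set_ltree t \<Longrightarrow> w \<in> set_ltree t \<Longrightarrow> s \<in> set (g w) \<Longrightarrow> v < label s"
  shows "heap_labelled (attach g t)"
  using assms
proof (induction t)
  case (Node a ts)
  have 1: "heap_labelled (attach g t)" if "t \<in> set ts" for t
  proof (rule Node.IH[OF that])
    show "heap_labelled t" using that Node.prems(1) by (simp add: list_all_iff)
    fix v assume v: "v \<in> set_ltree t"
    show "sorted_wrt (>) (map label (g v)) \<and> list_all heap_labelled (g v)"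
      using that v by (intro Node.prems(2)) auto
    fix w s assume "w \<in> set_ltree t" "s \<in> set (g w)"
    then show "v < label s"
      using that v by (intro Node.prems(3)[of v w]) auto
  qed
  have 2: "label t < label s" if "t \<in> set ts" "s \<in> set (g a)" for s t
    using that label_in[of t] by (intro Node.prems(3)[of _ a]) auto
  have 3: "a < label s" if "s \<in> set (g a)" for s
    using that by (intro Node.prems(3)[of a a]) auto
  have 4: "sorted_wrt (>) (map label (g a))" "list_all heap_labelled (g a)"
    using Node.prems(2)[of a] by auto
  have 5: "\<forall>t\<in>set ts. a < label t" "sorted_wrt (>) (map label ts)"
    using Node.prems(1) by simp_all
  have "sorted_wrt (>) (map label (g a) @ map label ts)"
    unfolding sorted_wrt_append using 2 4(1) 5(2) by simp
  moreover have "list_all heap_labelled (g a @ map (attach g) ts)"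
    using 1 4(2) by (auto simp: list_all_iff)
  moreover have "\<forall>t\<in>set (g a @ map (attach g) ts). a < label t"
    using 3 5(1) by auto
  ultimately show ?case
    by (simp add: comp_def)
qed

lemma nodes_pos: "num_nodes t > 0"
  by (cases t) (simp add: num_nodes_def)

lemma Max_Nod: "Max (Nod y) = nodes y - 1"
proof -
  have "Nod y = {..<nodes y}"
    using heap_ordered_tree_of[of y] unfolding is_heap_ordered_def Nod_def nodes_def by blast
  moreover have "0 < nodes y" by (simp add: nodes_def nodes_pos)
  ultimately have "Nod y = {..nodes y - 1}" by (metis lessThan_Suc_atMost Suc_pred')
  moreover have "Max {..n} = n" for n :: nat by (rule Max_eqI) auto
  ultimately show ?thesis by metis
qed

lemma tree_of_branches: "tree_of x = Node 0 (branches x)"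
  using heap_ordered_tree_of[of x]
  by (cases "tree_of x") (auto simp: is_heap_ordered_def branches_def)

lemma labels_branches:
  "distinct (concat (map preorder (branches x)))"
  "set (concat (map preorder (branches x))) = {0<..<nodes x}"
  "length (concat (map preorder (branches x))) = nodes x - 1"
  "sorted_wrt (>) (map label (branches x))"
  "list_all heap_labelled (branches x)"
proof -
  let ?b = "branches x"
  have "is_heap_ordered (Node 0 ?b)"
    using heap_ordered_tree_of[of x] by (subst (asm) tree_of_branches)
  moreover have n: "nodes x = num_nodes (Node 0 ?b)"
    unfolding nodes_def by (subst tree_of_branches) (rule refl)
  ultimately have d: "distinct (0 # concat (map preorder ?b))"
    and s: "set (0 # concat (map preorder ?b)) = {..<nodes x}"
    and h: "heap_labelled (Node 0 ?b)"
    unfolding is_heap_ordered_def set_preorder[symmetric] by simp_all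
  show "distinct (concat (map preorder ?b))" using d by simp
  have "set (concat (map preorder ?b)) = {..<nodes x} - {0}"
    using d unfolding s[symmetric] by (simp del: set_concat)
  moreover have "{..<n} - {0} = {0<..<n}" for n :: nat
    by auto
  ultimately show "set (concat (map preorder ?b)) = {0<..<nodes x}"
    by (simp only:)
  show "length (concat (map preorder ?b)) = nodes x - 1"
    using n by (simp add: num_nodes_def)
  show "sorted_wrt (>) (map label ?b)" "list_all heap_labelled ?b"
    using h by simp_all
qed

lemma nodes_pos': "nodes x > 0"
  by (simp add: nodes_def nodes_pos)

lemma labels_shifted_branches:
  "distinct (concat (map preorder (shifted_branches y x)))"
  "set (concat (map preorder (shifted_branches y x))) = {nodes y..<nodes y + nodes x - 1}"
  "length (concat (map preorder (shifted_branches y x))) = nodes x - 1"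
  "sorted_wrt (>) (map label (shifted_branches y x))"
  "list_all heap_labelled (shifted_branches y x)"
proof -
  let ?h = "\<lambda>l. l + (nodes y - 1)"
  have eq: "concat (map preorder (shifted_branches y x)) = map ?h (concat (map preorder (branches x)))"
    by (simp add: shifted_branches_def Max_Nod preorder_map map_concat comp_def)
  show "distinct (concat (map preorder (shifted_branches y x)))"
    unfolding eq distinct_map using labels_branches(1)[of x] by (auto simp: inj_on_def)
  have "{nodes y..<nodes y + nodes x - 1} = ?h ` {0<..<nodes x}"
  proof (intro equalityI subsetI)
    fix l assume "l \<in> {nodes y..<nodes y + nodes x - 1}"
    then show "l \<in> ?h ` {0<..<nodes x}"
      using nodes_pos'[of y] by (intro image_eqI[of _ _ "l - (nodes y - 1)"]) auto
  qed (use nodes_pos'[of y] in auto)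
  then show "set (concat (map preorder (shifted_branches y x))) = {nodes y..<nodes y + nodes x - 1}"
    unfolding eq set_map labels_branches(2) by simp
  show "length (concat (map preorder (shifted_branches y x))) = nodes x - 1"
    unfolding eq length_map by (rule labels_branches(3))
  show "sorted_wrt (>) (map label (shifted_branches y x))"
    using labels_branches(4)[of x] by (simp add: shifted_branches_def sorted_wrt_map label_map)
  show "list_all heap_labelled (shifted_branches y x)"
  proof -
    have "strict_mono_on A (\<lambda>l. l + Max (Nod y))" for A :: "nat set"
      by (rule strict_mono_onI) simp
    with labels_branches(5)[of x] show ?thesis
      by (simp add: shifted_branches_def list_all_iff heap_labelled_map)
  qed
qed

lemma sorted_wrt_nths: "sorted_wrt P xs \<Longrightarrow> sorted_wrt P (nths xs S)"
proof (induction xs arbitrary: S)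
  case (Cons x xs)
  have "set (nths xs T) \<subseteq> set xs" for T by (rule set_nths_subset)
  with Cons show ?case by (auto simp: nths_Cons)
qed simp

lemma mset_concat_nths_fibres:
  assumes "finite V" "\<And>i. i < length xs \<Longrightarrow> f i \<in> V"
  shows "(\<Sum>v\<in>V. mset (concat (map h (nths xs {i. f i = v})))) = mset (concat (map h xs))"
  using assms(2)
proof (induction xs rule: rev_induct)
  case (snoc x xs)
  have "mset (concat (map h (nths (xs @ [x]) {i. f i = v}))) =
     mset (concat (map h (nths xs {i. f i = v}))) + (if f (length xs) = v then mset (h x) else {#})" for v
    by (simp only: nths_append nths_singleton map_append concat_append mset_append mem_Collect_eq add_0)
       (simp split: if_split)
  then have "(\<Sum>v\<in>V. mset (concat (map h (nths (xs @ [x]) {i. f i = v})))) =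
     (\<Sum>v\<in>V. mset (concat (map h (nths xs {i. f i = v})))) +
     (\<Sum>v\<in>V. if f (length xs) = v then mset (h x) else {#})"
    by (simp only: sum.distrib)
  also have "(\<Sum>v\<in>V. mset (concat (map h (nths xs {i. f i = v})))) = mset (concat (map h xs))"
    by (rule snoc.IH) (simp add: snoc.prems)
  also have "(\<Sum>v\<in>V. if f (length xs) = v then mset (h x) else {#}) = mset (h x)"
    using assms(1) snoc.prems[of "length xs"] by simp
  finally show ?case by simp
qed simp

lemma tree_of_graft:
  assumes "f \<in> {..<length (branches x)} \<rightarrow>\<^sub>E Nod y"
  shows "tree_of (graft x f y) =
    attach (\<lambda>v. nths (shifted_branches y x) {i. f i = v}) (tree_of y)" (is "_ = ?t")
proof -
  let ?g = "\<lambda>v. nths (shifted_branches y x) {i. f i = v}"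
  let ?c = "concat (map preorder (shifted_branches y x))"
  have y: "distinct (preorder (tree_of y))" "set_ltree (tree_of y) = {..<nodes y}"
     "label (tree_of y) = 0" "heap_labelled (tree_of y)"
    using heap_ordered_tree_of[of y] by (auto simp: is_heap_ordered_def nodes_def)
  have "(\<Sum>a\<in>#mset (preorder (tree_of y)). mset (concat (map preorder (?g a)))) =
        (\<Sum>a\<in>Nod y. mset (concat (map preorder (?g a))))"
    using y(1) by (simp add: sum_unfold_sum_mset mset_set_set[symmetric] Nod_def set_preorder[symmetric])
  also have "\<dots> = mset ?c"
    using assms y(2) by (intro mset_concat_nths_fibres) (auto simp: Nod_def shifted_branches_def)
  finally have m: "mset (preorder ?t) = mset (preorder (tree_of y) @ ?c)"
    by (simp add: mset_preorder_attach)
  have len: "num_nodes ?t = nodes y + (nodes x - 1)"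
    using mset_eq_length[OF m] labels_shifted_branches(3)[of y x] by (simp add: num_nodes_def nodes_def)
  have "distinct (preorder ?t)"
    using mset_eq_imp_distinct_iff[OF m] y labels_shifted_branches(1,2)[of y x]
    by (auto simp: set_preorder simp del: set_concat)
  moreover have "set_ltree ?t = {..<num_nodes ?t}"
  proof -
    have "set_ltree ?t = {..<nodes y} \<union> {nodes y..<nodes y + nodes x - 1}"
      using mset_eq_setD[OF m] y(2) labels_shifted_branches(2)[of y x]
      by (simp add: set_preorder del: set_concat)
    also have "\<dots> = {..<nodes y + (nodes x - 1)}"
      using nodes_pos'[of x] by auto
    finally show ?thesis by (simp add: len)
  qed
  moreover have "heap_labelled ?t"
  proof (rule heap_labelled_attach)
    fix v
    show "sorted_wrt (>) (map label (?g v)) \<and> list_all heap_labelled (?g v)"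
      using labels_shifted_branches(4,5)[of y x]
      by (auto simp: sorted_wrt_map list_all_iff intro: sorted_wrt_nths dest: in_set_nthsD)
    fix w s assume "v \<in> set_ltree (tree_of y)" and s: "s \<in> set (?g w)"
    moreover have "label s \<in> set ?c"
      using s label_in[of s] by (auto simp: set_preorder dest: in_set_nthsD)
    ultimately show "v < label s"
      unfolding labels_shifted_branches(2) y(2) by auto
  qed (fact y(4))
  ultimately have "is_heap_ordered ?t"
    using y(3) by (simp add: is_heap_ordered_def)
  then show ?thesis by (simp add: graft_def Abs_hotree_inverse)
qed

lemma tree_of_backslash: "tree_of (backslash x y) = Node 0 (shifted_branches y x @ branches y)"
proof -
  let ?t = "Node 0 (shifted_branches y x @ branches y)"
  let ?c = "concat (map preorder (shifted_branches y x))"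
  let ?d = "concat (map preorder (branches y))"
  have p: "preorder ?t = 0 # ?c @ ?d" by simp
  have "distinct (preorder ?t)"
    unfolding p using labels_shifted_branches(1,2)[of y x] labels_branches(1,2)[of y] nodes_pos'[of y]
    by (auto simp del: set_concat)
  moreover have len: "num_nodes ?t = nodes y + (nodes x - 1)"
    using labels_shifted_branches(3)[of y x] labels_branches(3)[of y] nodes_pos'[of y]
    by (simp only: num_nodes_def p) (simp del: length_concat)
  moreover have "set_ltree ?t = {0} \<union> {nodes y..<nodes y + nodes x - 1} \<union> {0<..<nodes y}"
    unfolding set_preorder[symmetric] p using labels_shifted_branches(2)[of y x] labels_branches(2)[of y]
    by (auto simp del: set_concat)
  moreover have "\<dots> = {..<nodes y + (nodes x - 1)}"
    using nodes_pos'[of x] nodes_pos'[of y] by auto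
  moreover have lab: "label s \<in> {nodes y..<nodes y + nodes x - 1}" if "s \<in> set (shifted_branches y x)" for s
    unfolding labels_shifted_branches(2)[symmetric] using that label_in[of s] by (auto simp: set_preorder)
  moreover have lab': "label s \<in> {0<..<nodes y}" if "s \<in> set (branches y)" for s
    unfolding labels_branches(2)[symmetric] using that label_in[of s] by (auto simp: set_preorder)
  moreover have "heap_labelled ?t"
    using labels_shifted_branches(4,5)[of y x] labels_branches(4,5)[of y] nodes_pos'[of y]
    by (auto simp: sorted_wrt_append dest!: lab lab')
  ultimately have "is_heap_ordered ?t"
    by (simp add: is_heap_ordered_def)
  then show ?thesis by (simp add: backslash_def Abs_hotree_inverse)
qed

lemma strict_mono_card_less:
  assumes "finite (A :: nat set)"
  shows "strict_mono_on A (\<lambda>l. card {m \<in> A. m < l})"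
  by (rule strict_mono_onI, rule psubset_card_mono) (use assms in auto)

lemma card_less_image:
  assumes "finite (A :: nat set)"
  shows "(\<lambda>l. card {m \<in> A. m < l}) ` A = {..<card A}"
proof (rule card_subset_eq)
  show "(\<lambda>l. card {m \<in> A. m < l}) ` A \<subseteq> {..<card A}"
    using assms by (auto intro!: psubset_card_mono)
  show "card ((\<lambda>l. card {m \<in> A. m < l}) ` A) = card {..<card A}"
    using card_image[OF strict_mono_on_imp_inj_on[OF strict_mono_card_less[OF assms]]] by simp
qed simp

lemma distinct_concat_nths:
  "distinct (concat (map h xs)) \<Longrightarrow> distinct (concat (map h (nths xs S)))"
proof (induction xs arbitrary: S)
  case (Cons x xs)
  have "set (nths xs S) \<subseteq> set xs" for S by (rule set_nths_subset)
  with Cons show ?case by (simp add: nths_Cons) blast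
qed simp

lemma tree_of_restrict_branches:
  "tree_of (restrict_branches x S) = standardize (Node 0 (nths (branches x) S))"
proof -
  let ?r = "Node 0 (nths (branches x) S)"
  let ?h = "\<lambda>l. card {m \<in> set_ltree ?r. m < l}"
  have fin: "finite (set_ltree ?r)" by (simp flip: set_preorder)
  have pos: "0 < l" if "s \<in> set (branches x)" "l \<in> set_ltree s" for s l
  proof -
    have "l \<in> set (concat (map preorder (branches x)))"
      using that by (auto simp: set_preorder)
    then show ?thesis unfolding labels_branches(2) by simp
  qed
  have sub: "set (nths (branches x) S) \<subseteq> set (branches x)" by (rule set_nths_subset)
  have "0 < label s" if "s \<in> set (nths (branches x) S)" for s
    using that sub label_in[of s] by (intro pos) auto
  then have h: "heap_labelled ?r"
    using labels_branches(4,5)[of x] sub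
    by (auto simp: sorted_wrt_map list_all_iff intro: sorted_wrt_nths)
  have d: "distinct (preorder ?r)"
    using distinct_concat_nths[OF labels_branches(1)[of x], of S] pos sub by (auto simp: set_preorder)
  have "inj_on ?h (set_ltree ?r)"
    by (rule strict_mono_on_imp_inj_on[OF strict_mono_card_less[OF fin]])
  then have "distinct (preorder (standardize ?r))"
    using d unfolding standardize_def preorder_map distinct_map set_preorder by blast
  moreover have "set_ltree (standardize ?r) = {..<num_nodes (standardize ?r)}"
    using card_less_image[OF fin] distinct_card[OF d]
    by (simp only: standardize_def ltree.set_map num_nodes_def preorder_map length_map set_preorder)
  moreover have "heap_labelled (standardize ?r)"
    unfolding standardize_def by (rule heap_labelled_map[OF h strict_mono_card_less[OF fin]])
  moreover have "label (standardize ?r) = 0"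
    by (simp add: standardize_def label_map)
  ultimately have "is_heap_ordered (standardize ?r)"
    by (simp only: is_heap_ordered_def simp_thms)
  then show ?thesis by (simp add: restrict_branches_def Abs_hotree_inverse)
qed

lemma tree_of_one_node: "tree_of one_node = Node 0 []"
  unfolding one_node_def
  by (rule Abs_hotree_inverse) (simp add: is_heap_ordered_def num_nodes_def lessThan_Suc)

end

theory Submission
  imports Defs "HOL-Library.Countable_Set"
begin

text \<open>
  Every tree is a unique product \<open>x\<^sub>1 \ \<dots> \ x\<^sub>r\<close> of irreducible ones, and the product of
  \<open>\<H>\<^sub>H\<^sub>O\<close> satisfies \<open>x \<cdot> y = x \ y\<close> up to trees with fewer branches at the root, so the
  irreducible trees generate freely.  They can be replaced by primitive generators: for a tree \<open>x\<close>
  with components indexed by \<open>K\<close> and an additive weight \<open>wt\<close> on the subsets of \<open>K\<close>, the equations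
  \<open>\<Sum>\<^sub>A\<^sub>\<subseteq>\<^sub>S x\<^sub>A \<cdot> D(S - A) = wt(S) x\<^sub>S\<close> define an element \<open>D(K)\<close> that is primitive and, if
  \<open>wt(K) = 1\<close>, equals \<open>x\<close> modulo trees that have fewer branches or as many branches and at least two
  irreducible factors.  Both corrections only decrease the order given by the number of branches and
  then by the reversed number of factors, so the map from the free algebra that sends the letters to the
  elements \<open>D(K)\<close> of the irreducible trees is unitriangular, hence an isomorphism of Hopf algebras.
  The permutation of a tree is its preorder word without the root, which is compatible with \<open>backslash\<close>.
\<close>

section \<open>Parent words\<close>

text \<open>On trees, grafting identifies nodes and interleaves branches; on parent words it becomes
  a free choice of letters. The word of \<open>y\<close> is kept, and behind it comes the word of
  \<open>x\<close>, its nonzero letters shifted by the largest label \<open>q\<close> of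
  \<open>y\<close> and each zero replaced independently by one of the nodes
  \<open>0, ..., q\<close>. Associativity and the compatibility of product and coproduct thereby
  reduce to statements about single letters.

  The equation for \<open>D\<close> makes it the convolution inverse of the family of restrictions,
  convolved with the weighted family; this is the pattern of the Dynkin operator, the antipode
  convolved with a derivation. It is solved over the subsets of one fixed tree and not in the Hopf
  algebra itself: after standardization every nontrivial restricted tree has a node 1, so a weight
  that asks for the original node 1 cannot be read off from the restricted tree.

  The number of factors enters the order in reverse because the corrections in \<open>D(K)\<close>
  are products of two nontrivial trees. If such a product keeps the number of branches, it has at
  least two irreducible factors, where an irreducible tree has one.\<close>

text \<open>
  A heap-ordered tree on the nodes \<open>0, \<dots>, n\<close> is determined by its parent word \<open>w\<close> of length \<open>n\<close>:
  the letter \<open>w ! i\<close> is the parent of the node \<open>i + 1\<close>.  A set of non-root nodes is given by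
  the set of their positions in \<open>w\<close>.
\<close>

definition parent_word :: "nat list \<Rightarrow> bool" where
  "parent_word w \<longleftrightarrow> (\<forall>i<length w. w ! i \<le> i)"

text \<open>The parents that a node with parent \<open>a\<close> can get when its tree is grafted
  onto one with largest label \<open>q\<close>: a child of the root may be attached to any of the
  nodes \<open>0, ..., q\<close>, any other node keeps its parent, now relabelled.\<close>

definition letter_substs :: "nat \<Rightarrow> nat \<Rightarrow> nat set" where
  "letter_substs q a = (if a = 0 then {0..q} else {a + q})"

definition word_substs :: "nat \<Rightarrow> nat list \<Rightarrow> nat list set" where
  "word_substs q w = listset (map (letter_substs q) w)"

text \<open>Holds when \<open>U\<close> contains a non-root node exactly if it contains its parent,
  so that \<open>U\<close> is a union of planted components. The parent \<open>w ! i\<close> of a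
  node sits at position \<open>w ! i - 1\<close>, and a parent 0 imposes nothing.\<close>

definition closed_in :: "nat list \<Rightarrow> nat set \<Rightarrow> bool" where
  "closed_in w U \<longleftrightarrow> U \<subseteq> {..<length w} \<and> (\<forall>i<length w. w ! i \<noteq> 0 \<longrightarrow> (i \<in> U \<longleftrightarrow> w ! i - 1 \<in> U))"

text \<open>Serves two purposes. For a position in \<open>U\<close> it is the new position after
  restriction to \<open>U\<close>. Since position \<open>i\<close> stands for node
  \<open>i + 1\<close>, the same count also sends the label of a node in \<open>U\<close> to its
  standardized label, and 0 to 0.\<close>

definition rank :: "nat set \<Rightarrow> nat \<Rightarrow> nat" where
  "rank U v = card {i \<in> U. i < v}"

definition subword :: "nat list \<Rightarrow> nat set \<Rightarrow> nat list" where
  "subword w U = map (rank U) (nths w U)"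

definition shift_word :: "nat \<Rightarrow> nat list \<Rightarrow> nat list" where
  "shift_word q w = map (\<lambda>a. if a = 0 then 0 else a + q) w"

text \<open>At a cut \<open>q\<close> each node above \<open>q\<close> has the root or another node
  above \<open>q\<close> as parent, so the nodes up to \<open>q\<close> form a right factor for
  \<open>backslash\<close>. The trivial right factor is included, the whole tree is not; hence the
  number of cuts is the number of irreducible factors.\<close>

definition cuts :: "nat list \<Rightarrow> nat set" where
  "cuts w = {q. q < length w \<and> (\<forall>i. q \<le> i \<longrightarrow> i < length w \<longrightarrow> w ! i = 0 \<or> q < w ! i)}"

text \<open>The number of planted components: the children of the root are the nodes with parent
  0.\<close>

definition zeros :: "nat list \<Rightarrow> nat" where
  "zeros w = length (filter ((=) 0) w)"

section \<open>Sums over independent choices of letters\<close>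

lemma in_listset_iff: "w \<in> listset As \<longleftrightarrow> length w = length As \<and> (\<forall>i<length As. w ! i \<in> As ! i)"
proof (induction As arbitrary: w)
  case (Cons A As)
  then show ?case
    by (cases w) (auto simp: set_Cons_def nth_Cons split: nat.splits)
qed auto

lemma in_word_substs_iff:
  "w \<in> word_substs q x \<longleftrightarrow>
     length w = length x \<and> (\<forall>i<length x. if x ! i = 0 then w ! i \<le> q else w ! i = x ! i + q)"
  unfolding word_substs_def in_listset_iff letter_substs_def by (auto split: if_splits)

lemma sum_listset_Cons: "(\<Sum>w\<in>listset (A # As). G w) = (\<Sum>a\<in>A. \<Sum>w\<in>listset As. G (a # w))"
proof -
  have "listset (A # As) = (\<lambda>(a, w). a # w) ` (A \<times> listset As)"
    by (auto simp: set_Cons_def)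
  then show ?thesis
    by (simp add: sum.reindex inj_on_def sum.cartesian_product case_prod_unfold)
qed

lemma sum_listset_append:
  "(\<Sum>w\<in>listset (As @ Bs). G w) = (\<Sum>u\<in>listset As. \<Sum>v\<in>listset Bs. G (u @ v))"
proof (induction As arbitrary: G)
  case (Cons A As)
  then show ?case by (simp only: append_Cons sum_listset_Cons)
qed simp

lemma finite_listset: "(\<And>A. A \<in> set As \<Longrightarrow> finite A) \<Longrightarrow> finite (listset As)"
proof (induction As)
  case (Cons A As)
  moreover have "listset (A # As) = (\<lambda>(a, w). a # w) ` (A \<times> listset As)"
    by (auto simp: set_Cons_def)
  ultimately show ?case by simp
qed simp

lemma finite_word_substs: "finite (word_substs q w)"
  unfolding word_substs_def by (rule finite_listset) (auto simp: letter_substs_def)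

text \<open>The letter form of associativity. If a zero is kept, the second round offers
  \<open>0, ..., r\<close>; if it becomes a letter in \<open>1, ..., q\<close>, the second round
  shifts it to \<open>r + 1, ..., r + q\<close>. Each letter up to \<open>r + q\<close> thus arises
  exactly once.\<close>

lemma sum_letter_substs_trans:
  "(\<Sum>a\<in>letter_substs q c. \<Sum>b\<in>letter_substs r a. h b) = (\<Sum>b\<in>letter_substs (r + q) c. h b)"
proof (cases "c = 0")
  case True
  have "(\<Sum>a\<in>{0..q}. \<Sum>b\<in>letter_substs r a. h b) = (\<Sum>b\<in>{0..r + q}. h b)"
  proof (induction q)
    case (Suc q)
    then show ?case by (simp add: letter_substs_def algebra_simps)
  qed (simp add: letter_substs_def)
  with True show ?thesis by (simp add: letter_substs_def)
qed (simp add: letter_substs_def algebra_simps)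

lemma sum_word_substs_trans:
  "(\<Sum>w\<in>word_substs q x. \<Sum>w'\<in>word_substs r w. G w') = (\<Sum>w'\<in>word_substs (r + q) x. G w')"
proof (induction x arbitrary: G)
  case (Cons c x)
  have "(\<Sum>w\<in>word_substs q (c # x). \<Sum>w'\<in>word_substs r w. G w') =
      (\<Sum>a\<in>letter_substs q c. \<Sum>w\<in>word_substs q x. \<Sum>b\<in>letter_substs r a. \<Sum>w'\<in>word_substs r w. G (b # w'))"
    by (simp only: word_substs_def list.map sum_listset_Cons)
  also have "\<dots> = (\<Sum>a\<in>letter_substs q c. \<Sum>b\<in>letter_substs r a. \<Sum>w\<in>word_substs q x. \<Sum>w'\<in>word_substs r w. G (b # w'))"
    by (rule sum.cong[OF refl], rule sum.swap)
  also have "\<dots> = (\<Sum>b\<in>letter_substs (r + q) c. \<Sum>w'\<in>word_substs (r + q) x. G (b # w'))"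
    by (simp only: Cons.IH sum_letter_substs_trans)
  also have "\<dots> = (\<Sum>w'\<in>word_substs (r + q) (c # x). G w')"
    by (simp only: word_substs_def list.map sum_listset_Cons)
  finally show ?case .
qed (simp add: word_substs_def)

lemma sum_word_substs_append:
  "(\<Sum>w\<in>word_substs q (u @ v). G w) = (\<Sum>u'\<in>word_substs q u. \<Sum>v'\<in>word_substs q v. G (u' @ v'))"
  by (simp add: word_substs_def sum_listset_append)

lemma parent_word_append_substs:
  assumes "parent_word y" "parent_word x" "w \<in> word_substs (length y) x"
  shows "parent_word (y @ w)"
  unfolding parent_word_def
proof (intro allI impI)
  fix i assume i: "i < length (y @ w)"
  show "(y @ w) ! i \<le> i"
  proof (cases "i < length y")
    case True
    then show ?thesis using assms(1) by (simp add: nth_append parent_word_def)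
  next
    case False
    define j where "j = i - length y"
    have "j < length x" "i = j + length y"
      using i False assms(3) by (auto simp: j_def in_word_substs_iff)
    moreover from this have "x ! j \<le> j" using assms(2) by (simp add: parent_word_def)
    ultimately show ?thesis
      using assms(3) by (auto simp: in_word_substs_iff nth_append split: if_splits)
  qed
qed

text \<open>Letters at different positions are independent, so a sum over a product set factors
  along \<open>I\<close> and its complement. The injective relabellings \<open>h\<close> and
  \<open>k\<close> make it usable for words whose two parts are standardized separately.\<close>

lemma sum_listset_split:
  fixes G :: "'b list \<Rightarrow> 'c list \<Rightarrow> 'd::comm_monoid_add"
  assumes "\<And>i. i < length As \<Longrightarrow> i \<in> I \<Longrightarrow> inj_on h (As ! i)"
    and "\<And>i. i < length As \<Longrightarrow> i \<notin> I \<Longrightarrow> inj_on k (As ! i)"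
  shows "(\<Sum>w\<in>listset As. G (map h (nths w I)) (map k (nths w (- I)))) =
    (\<Sum>u\<in>listset (map ((`) h) (nths As I)). \<Sum>v\<in>listset (map ((`) k) (nths As (- I))). G u v)"
  using assms
proof (induction As arbitrary: I G)
  case (Cons A As)
  let ?I = "{j. Suc j \<in> I}"
  let ?J = "{j. Suc j \<notin> I}"
  have c: "- ?I = ?J" by auto
  have IH: "(\<Sum>w\<in>listset As. H (map h (nths w ?I)) (map k (nths w ?J))) =
    (\<Sum>u\<in>listset (map ((`) h) (nths As ?I)). \<Sum>v\<in>listset (map ((`) k) (nths As ?J)). H u v)"
    for H :: "'b list \<Rightarrow> 'c list \<Rightarrow> 'd"
    unfolding c[symmetric]
  proof (rule Cons.IH[where G = H])
    show "inj_on h (As ! i)" if "i < length As" "i \<in> ?I" for i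
      using Cons.prems(1)[of "Suc i"] that by simp
    show "inj_on k (As ! i)" if "i < length As" "i \<notin> ?I" for i
      using Cons.prems(2)[of "Suc i"] that by simp
  qed
  show ?case
  proof (cases "0 \<in> I")
    case True
    then have inj: "inj_on h A" using Cons.prems(1)[of 0] by simp
    have "(\<Sum>w\<in>listset (A # As). G (map h (nths w I)) (map k (nths w (- I)))) =
       (\<Sum>a\<in>A. \<Sum>w\<in>listset As. G (h a # map h (nths w ?I)) (map k (nths w ?J)))"
      using True by (simp add: sum_listset_Cons nths_Cons del: listset.simps)
    also have "\<dots> = (\<Sum>a\<in>A. \<Sum>u\<in>listset (map ((`) h) (nths As ?I)).
        \<Sum>v\<in>listset (map ((`) k) (nths As ?J)). G (h a # u) v)"
      by (rule sum.cong[OF refl], rule IH)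
    finally show ?thesis using True inj
      by (simp add: sum_listset_Cons nths_Cons sum.reindex del: listset.simps)
  next
    case False
    then have inj: "inj_on k A" using Cons.prems(2)[of 0] by simp
    have "(\<Sum>w\<in>listset (A # As). G (map h (nths w I)) (map k (nths w (- I)))) =
       (\<Sum>a\<in>A. \<Sum>w\<in>listset As. G (map h (nths w ?I)) (k a # map k (nths w ?J)))"
      using False by (simp add: sum_listset_Cons nths_Cons del: listset.simps)
    also have "\<dots> = (\<Sum>a\<in>A. \<Sum>u\<in>listset (map ((`) h) (nths As ?I)).
        \<Sum>v\<in>listset (map ((`) k) (nths As ?J)). G u (k a # v))"
      by (rule sum.cong[OF refl], rule IH)
    also have "\<dots> = (\<Sum>u\<in>listset (map ((`) h) (nths As ?I)). \<Sum>a\<in>A.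
        \<Sum>v\<in>listset (map ((`) k) (nths As ?J)). G u (k a # v))"
      by (rule sum.swap)
    finally show ?thesis using False inj
      by (simp add: sum_listset_Cons nths_Cons sum.reindex del: listset.simps)
  qed
qed simp

section \<open>Unions of planted components and their standardization\<close>

lemma finite_closed_in: "finite {U. closed_in w U}"
  by (rule finite_subset[of _ "Pow {..<length w}"]) (auto simp: closed_in_def)

lemma closed_in_Diff: "closed_in w U \<Longrightarrow> closed_in w V \<Longrightarrow> closed_in w (U - V)"
  by (auto simp: closed_in_def)

lemma closed_in_full: "parent_word w \<Longrightarrow> closed_in w {..<length w}"
  by (auto simp: closed_in_def parent_word_def)

lemma closed_in_empty: "closed_in w {}"
  by (auto simp: closed_in_def)

lemma closed_in_Un: "closed_in w U \<Longrightarrow> closed_in w V \<Longrightarrow> closed_in w (U \<union> V)"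
  by (auto simp: closed_in_def)

lemma rank_0 [simp]: "rank U 0 = 0"
  by (simp add: rank_def)

lemma rank_Suc: "finite U \<Longrightarrow> i \<in> U \<Longrightarrow> rank U (Suc i) = Suc (rank U i)"
proof -
  assume a: "finite U" "i \<in> U"
  then have "{j \<in> U. j < Suc i} = insert i {j \<in> U. j < i}" by auto
  then show ?thesis using a by (simp add: rank_def)
qed

lemma rank_less: "finite U \<Longrightarrow> i \<in> U \<Longrightarrow> i < j \<Longrightarrow> rank U i < rank U j"
  unfolding rank_def by (rule psubset_card_mono) auto

lemma inj_on_rank: "finite U \<Longrightarrow> inj_on (rank U) U"
  by (rule inj_onI) (metis rank_less linorder_neqE_nat less_irrefl)

lemma rank_image: "finite U \<Longrightarrow> rank U ` U = {..<card U}"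
  using card_less_image[of U] by (simp add: rank_def[abs_def])

lemma nth_nths_rank:
  assumes "i < length w" "i \<in> U"
  shows "nths w U ! rank U i = w ! i"
proof -
  have "nths w U = nths (take i w @ w ! i # drop (Suc i) w) U"
    using assms(1) by (simp add: id_take_nth_drop[symmetric])
  also have "\<dots> = nths (take i w) U @ w ! i # nths (drop (Suc i) w) {j. Suc j + i \<in> U}"
    using assms by (simp add: nths_append nths_Cons)
  finally have *: "nths w U = \<dots>" .
  have "length (nths (take i w) U) = rank U i"
    using assms(1) by (auto simp: length_nths rank_def intro!: arg_cong[of _ _ card])
  with * show ?thesis by (metis nth_append_length)
qed

lemma length_subword: "U \<subseteq> {..<length w} \<Longrightarrow> length (subword w U) = card U"
  by (auto simp: subword_def length_nths intro!: arg_cong[of _ _ card])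

lemma nth_subword: "i < length w \<Longrightarrow> i \<in> U \<Longrightarrow> U \<subseteq> {..<length w} \<Longrightarrow> subword w U ! rank U i = rank U (w ! i)"
proof -
  assume a: "i < length w" "i \<in> U" "U \<subseteq> {..<length w}"
  then have fin: "finite U" by (auto intro: finite_subset)
  with a have "rank U i < length (nths w U)"
    using rank_image[OF fin] length_subword[OF a(3)] by (auto simp: subword_def)
  then show ?thesis using nth_nths_rank[OF a(1,2)] by (simp add: subword_def)
qed

lemma rank_rank:
  assumes "finite U"
  shows "rank V (rank U v) = rank {i \<in> U. rank U i \<in> V} v"
proof -
  have "bij_betw (rank U) {i \<in> U. rank U i \<in> V \<and> i < v} {j \<in> V. j < rank U v}"
  proof (rule bij_betw_imageI)
    show "inj_on (rank U) {i \<in> U. rank U i \<in> V \<and> i < v}"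
      using inj_on_rank[OF assms] by (rule inj_on_subset) auto
    have "j \<in> rank U ` {i \<in> U. rank U i \<in> V \<and> i < v}" if "j \<in> V" "j < rank U v" for j
    proof -
      have "rank U v \<le> card U" unfolding rank_def by (rule card_mono) (use assms in auto)
      with that obtain i where i: "i \<in> U" "j = rank U i"
        using rank_image[OF assms] by (metis imageE lessThan_iff less_le_trans)
      have "i < v"
      proof (rule ccontr)
        assume "\<not> i < v"
        then have "rank U v \<le> rank U i"
          unfolding rank_def by (intro card_mono) (use assms in auto)
        with that i show False by simp
      qed
      with i that show ?thesis by blast
    qed
    then show "rank U ` {i \<in> U. rank U i \<in> V \<and> i < v} = {j \<in> V. j < rank U v}"
      using assms by (auto intro: rank_less)
  qed
  then show ?thesis unfolding rank_def by (auto dest: bij_betw_same_card simp: conj_ac)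
qed

lemma subword_subword:
  "finite U \<Longrightarrow> subword (subword w U) V = subword w {i \<in> U. rank U i \<in> V}"
proof -
  assume fin: "finite U"
  have "nths (nths w U) V = nths w {i \<in> U. rank U i \<in> V}"
    by (auto simp: nths_nths rank_def intro!: arg_cong[of _ _ "nths w"])
  then show ?thesis by (simp add: subword_def nths_map rank_rank[OF fin, abs_def] comp_def rank_rank[OF fin])
qed

lemma closed_in_subword_iff:
  assumes "closed_in w U" "V \<subseteq> {..<card U}"
  shows "closed_in (subword w U) V \<longleftrightarrow> closed_in w {i \<in> U. rank U i \<in> V}"
proof -
  have U: "U \<subseteq> {..<length w}" and c: "\<And>i. i < length w \<Longrightarrow> w ! i \<noteq> 0 \<Longrightarrow> i \<in> U \<longleftrightarrow> w ! i - 1 \<in> U"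
    using assms by (auto simp: closed_in_def)
  then have fin: "finite U" by (auto intro: finite_subset)
  have r: "rank U (w ! i) = Suc (rank U (w ! i - 1))" if "i \<in> U" "w ! i \<noteq> 0" for i
    using rank_Suc[OF fin, of "w ! i - 1"] c[of i] that U by auto
  have "closed_in (subword w U) V \<longleftrightarrow>
      (\<forall>k\<in>{..<card U}. subword w U ! k \<noteq> 0 \<longrightarrow> (k \<in> V \<longleftrightarrow> subword w U ! k - 1 \<in> V))"
    using assms(2) by (auto simp: closed_in_def length_subword[OF U])
  also have "\<dots> \<longleftrightarrow> (\<forall>i\<in>U. rank U (w ! i) \<noteq> 0 \<longrightarrow> (rank U i \<in> V \<longleftrightarrow> rank U (w ! i) - 1 \<in> V))"
    unfolding rank_image[OF fin, symmetric] using U by (auto simp: nth_subword[OF _ _ U])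
  also have "\<dots> \<longleftrightarrow> (\<forall>i\<in>U. w ! i \<noteq> 0 \<longrightarrow> (rank U i \<in> V \<longleftrightarrow> rank U (w ! i - 1) \<in> V))"
    using r by (metis diff_Suc_1 nat.distinct(1) rank_0)
  also have "\<dots> \<longleftrightarrow> closed_in w {i \<in> U. rank U i \<in> V}"
    unfolding closed_in_def using U c by auto
  finally show ?thesis .
qed

text \<open>Rewrites the coproduct of a restricted tree as a sum over subsets of the positions of
  the original word, so that iterated restrictions need no change of index set. This is the form in
  which the construction of primitive elements takes its coproduct.\<close>

lemma sum_closed_in_subword:
  assumes "closed_in w U"
  shows "(\<Sum>V | closed_in (subword w U) V.
           G (subword (subword w U) V) (subword (subword w U) ({..<card U} - V))) =
         (\<Sum>A | closed_in w A \<and> A \<subseteq> U. G (subword w A) (subword w (U - A)))"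
proof -
  have U: "U \<subseteq> {..<length w}" using assms by (simp add: closed_in_def)
  then have fin: "finite U" by (auto intro: finite_subset)
  note im = rank_image[OF fin]
  have *: "{i \<in> U. rank U i \<in> rank U ` A} = A" if "A \<subseteq> U" for A
    using inj_on_rank[OF fin] that by (auto simp: inj_on_def)
  show ?thesis
  proof (rule sum.reindex_bij_witness[where i = "\<lambda>A. rank U ` A" and j = "\<lambda>V. {i \<in> U. rank U i \<in> V}"])
    fix V assume "V \<in> {V. closed_in (subword w U) V}"
    then have V: "V \<subseteq> {..<card U}" "closed_in (subword w U) V"
      by (auto simp: closed_in_def length_subword[OF U])
    then show "rank U ` {i \<in> U. rank U i \<in> V} = V" using im by auto
    show "{i \<in> U. rank U i \<in> V} \<in> {A. closed_in w A \<and> A \<subseteq> U}"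
      using V closed_in_subword_iff[OF assms V(1)] by auto
    have "{i \<in> U. rank U i \<in> {..<card U} - V} = U - {i \<in> U. rank U i \<in> V}" using im by auto
    then show "G (subword w {i \<in> U. rank U i \<in> V}) (subword w (U - {i \<in> U. rank U i \<in> V})) =
         G (subword (subword w U) V) (subword (subword w U) ({..<card U} - V))"
      by (simp add: subword_subword[OF fin])
  next
    fix A assume "A \<in> {A. closed_in w A \<and> A \<subseteq> U}"
    then have A: "closed_in w A" "A \<subseteq> U" by auto
    then show "{i \<in> U. rank U i \<in> rank U ` A} = A" using * by simp
    have "rank U ` A \<subseteq> {..<card U}" using A im by auto
    then show "rank U ` A \<in> {V. closed_in (subword w U) V}"
      using A closed_in_subword_iff[OF assms] * by simp
  qed
qed

text \<open>
  The positions in a concatenation \<open>y @ w\<close> with \<open>q = length y\<close> that come from \<open>V\<close> in \<open>y\<close>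
  and \<open>U\<close> in \<open>w\<close>.
\<close>

definition juxt :: "nat \<Rightarrow> nat set \<Rightarrow> nat set \<Rightarrow> nat set" where
  "juxt q V U = V \<union> (+) q ` U"

section \<open>Unions of planted components in a grafted tree\<close>

lemma rank_juxt_le:
  assumes "V \<subseteq> {..<q}" "v \<le> q"
  shows "rank (juxt q V U) v = rank V v"
  unfolding rank_def juxt_def using assms by (intro arg_cong[of _ _ card]) auto

lemma rank_juxt_ge:
  assumes "V \<subseteq> {..<q}" "finite U"
  shows "rank (juxt q V U) (v + q) = card V + rank U v"
proof -
  have "{i \<in> juxt q V U. i < v + q} = V \<union> (+) q ` {i \<in> U. i < v}"
    using assms by (auto simp: juxt_def)
  moreover have "V \<inter> (+) q ` {i \<in> U. i < v} = {}" "finite V"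
    using assms by (auto intro: finite_subset)
  ultimately show ?thesis
    using assms(2) by (simp add: rank_def card_Un_disjoint card_image)
qed

lemma juxt_Diff:
  assumes "V \<subseteq> {..<q}"
  shows "{..<q + p} - juxt q V U = juxt q ({..<q} - V) ({..<p} - U)"
proof (intro equalityI subsetI)
  fix i assume "i \<in> {..<q + p} - juxt q V U"
  then show "i \<in> juxt q ({..<q} - V) ({..<p} - U)"
    unfolding juxt_def by (cases "i < q") (auto intro!: image_eqI[of _ _ "i - q"])
qed (use assms in \<open>auto simp: juxt_def\<close>)

lemma juxt_collapse:
  "U \<subseteq> {..<q + p} \<Longrightarrow> juxt q (U \<inter> {..<q}) {i. i < p \<and> q + i \<in> U} = U"
proof (intro equalityI subsetI)
  fix i assume "U \<subseteq> {..<q + p}" "i \<in> U"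
  then show "i \<in> juxt q (U \<inter> {..<q}) {i. i < p \<and> q + i \<in> U}"
    unfolding juxt_def by (cases "i < q") (auto intro!: image_eqI[of _ _ "i - q"])
qed (auto simp: juxt_def)

text \<open>The edges of \<open>y @ w\<close> that avoid the root come from \<open>y\<close>, from
  inside the components of \<open>x\<close>, or from the grafting. The first kind constrains only
  \<open>V\<close>, the second only \<open>U\<close>; the third says that a component of
  \<open>x\<close> lies on the same side as the node of \<open>y\<close> that carries it. A
  component grafted at the root is unconstrained.\<close>

lemma closed_in_juxt_iff:
  assumes "parent_word y" "w \<in> word_substs (length y) x" "V \<subseteq> {..<length y}" "U \<subseteq> {..<length x}"
    and "parent_word x"
  shows "closed_in (y @ w) (juxt (length y) V U) \<longleftrightarrow> closed_in y V \<and> closed_in x U \<and>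
    (\<forall>i<length x. x ! i = 0 \<longrightarrow> w ! i \<noteq> 0 \<longrightarrow> (i \<in> U \<longleftrightarrow> w ! i - 1 \<in> V))"
proof -
  let ?q = "length y"
  have len: "length w = length x" and w: "\<And>i. i < length x \<Longrightarrow> if x ! i = 0 then w ! i \<le> ?q else w ! i = x ! i + ?q"
    using assms(2) by (auto simp: in_word_substs_iff)
  have lo: "i \<in> juxt ?q V U \<longleftrightarrow> i \<in> V" if "i < ?q" for i
    using that by (auto simp: juxt_def)
  have hi: "?q + i \<in> juxt ?q V U \<longleftrightarrow> i \<in> U" for i
    using assms(3) by (auto simp: juxt_def)
  have sub: "juxt ?q V U \<subseteq> {..<?q + length x}" using assms(3,4) by (auto simp: juxt_def)
  have all_add: "(\<forall>i<m + n. P i) \<longleftrightarrow> (\<forall>i<m. P i) \<and> (\<forall>i<n. P (m + i))" for m n :: nat and P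
  proof safe
    fix i assume *: "\<forall>i<m. P i" "\<forall>i<n. P (m + i)" "i < m + n"
    show "P i"
    proof (cases "i < m")
      case False
      then have "i - m < n" "m + (i - m) = i" using *(3) by auto
      then show ?thesis using *(2) by metis
    qed (use * in simp)
  qed auto
  have y: "y ! i - 1 < ?q" if "i < ?q" for i
    using assms(1) that unfolding parent_word_def by (metis diff_le_self le_less_trans)
  have x: "?q + x ! i - 1 = ?q + (x ! i - 1)" if "x ! i \<noteq> 0" for i using that by simp
  have 1: "(w ! i \<noteq> 0 \<longrightarrow> (?q + i \<in> juxt ?q V U) = (w ! i - 1 \<in> juxt ?q V U)) \<longleftrightarrow>
     (x ! i \<noteq> 0 \<longrightarrow> (i \<in> U \<longleftrightarrow> x ! i - 1 \<in> U)) \<and> (x ! i = 0 \<longrightarrow> w ! i \<noteq> 0 \<longrightarrow> (i \<in> U \<longleftrightarrow> w ! i - 1 \<in> V))"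
    if "i < length x" for i
  proof (cases "x ! i = 0")
    case True
    then show ?thesis using w[OF that] lo[of "w ! i - 1"] hi by auto
  next
    case False
    then have "w ! i = x ! i + ?q" using w[OF that] by simp
    then have wi: "w ! i - 1 = ?q + (x ! i - 1)" "w ! i \<noteq> 0" using False by simp_all
    show ?thesis unfolding wi(1) hi using False wi(2) by simp
  qed
  have "closed_in (y @ w) (juxt ?q V U) \<longleftrightarrow>
      (\<forall>i<?q. y ! i \<noteq> 0 \<longrightarrow> (i \<in> V \<longleftrightarrow> y ! i - 1 \<in> V)) \<and>
      (\<forall>i<length x. w ! i \<noteq> 0 \<longrightarrow> (?q + i \<in> juxt ?q V U) = (w ! i - 1 \<in> juxt ?q V U))"
    unfolding closed_in_def length_append len all_add using sub y by (simp add: nth_append lo)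
  also have "(\<forall>i<length x. w ! i \<noteq> 0 \<longrightarrow> (?q + i \<in> juxt ?q V U) = (w ! i - 1 \<in> juxt ?q V U)) \<longleftrightarrow>
      (\<forall>i<length x. (x ! i \<noteq> 0 \<longrightarrow> (i \<in> U \<longleftrightarrow> x ! i - 1 \<in> U)) \<and>
         (x ! i = 0 \<longrightarrow> w ! i \<noteq> 0 \<longrightarrow> (i \<in> U \<longleftrightarrow> w ! i - 1 \<in> V)))"
    by (intro all_cong 1)
  finally show ?thesis
    unfolding closed_in_def using assms(3,4) by blast
qed

text \<open>\<open>A\<close> collects the letters at position \<open>i\<close> that are compatible
  with the choice of \<open>V\<close> and \<open>U\<close>. Ranking turns them into the letters for
  grafting the restriction of \<open>x\<close> onto that of \<open>y\<close>: 0 stays, the nodes of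
  \<open>V\<close> become \<open>1, ..., card V\<close>, and an edge inside \<open>x\<close> is
  shifted by \<open>card V\<close> in place of \<open>q\<close>.\<close>

lemma rank_juxt_image:
  assumes "closed_in x U" "V \<subseteq> {..<q}" "i \<in> U"
  defines "A \<equiv> {j \<in> letter_substs q (x ! i). x ! i = 0 \<longrightarrow> j \<noteq> 0 \<longrightarrow> j - 1 \<in> V}"
  shows "inj_on (rank (juxt q V U)) A \<and> rank (juxt q V U) ` A = letter_substs (card V) (rank U (x ! i))"
proof -
  have U: "U \<subseteq> {..<length x}" using assms by (simp add: closed_in_def)
  have fin: "finite U" "finite V" using U assms(2) by (auto intro: finite_subset)
  show ?thesis
  proof (cases "x ! i = 0")
    case True
    have A: "A = insert 0 (Suc ` V)"
    proof (intro equalityI subsetI)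
      fix j assume "j \<in> A"
      then show "j \<in> insert 0 (Suc ` V)"
        using True by (cases j) (auto simp: A_def)
    qed (use True assms(2) in \<open>auto simp: A_def letter_substs_def\<close>)
    have r: "rank (juxt q V U) (Suc j) = Suc (rank V j)" if "j \<in> V" for j
      using that assms(2) fin by (subst rank_juxt_le) (auto simp: rank_Suc)
    have "inj_on (rank (juxt q V U)) A"
      unfolding A using inj_on_rank[OF fin(2)] by (auto simp: inj_on_def r)
    moreover have "rank (juxt q V U) ` A = insert 0 (Suc ` rank V ` V)"
      unfolding A by (simp add: image_image r)
    moreover have "insert 0 (Suc ` {..<m}) = {0..m}" for m
      by (simp add: lessThan_Suc_eq_insert_0[symmetric] lessThan_Suc_atMost atLeast0AtMost)
    ultimately show ?thesis
      using True by (simp add: rank_image[OF fin(2)] letter_substs_def)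
  next
    case False
    then have "x ! i - 1 \<in> U" using assms(1,3) U by (auto simp: closed_in_def)
    then have "rank U (x ! i) = Suc (rank U (x ! i - 1))"
      using rank_Suc[OF fin(1), of "x ! i - 1"] False by simp
    moreover have "A = {x ! i + q}" using False by (auto simp: A_def letter_substs_def)
    ultimately show ?thesis
      using False rank_juxt_ge[OF assms(2) fin(1), of "x ! i"] by (simp add: letter_substs_def)
  qed
qed

lemma subword_juxt:
  assumes "parent_word y" "V \<subseteq> {..<length y}"
  shows "subword (y @ w) (juxt (length y) V U) = subword y V @ map (rank (juxt (length y) V U)) (nths w U)"
proof -
  have 1: "nths y (juxt (length y) V U) = nths y V"
  proof -
    have "nths y S = nths y (S \<inter> {..<length y})" for S
      using nths_nths[of y "{..<length y}" S] nths_nths[of y "S" "{..<length y}"]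
      by (simp add: nths_def cong: filter_cong) (rule arg_cong[of _ _ "map fst"], rule filter_cong, auto dest: set_zip_rightD)
    from this[of V] this[of "juxt (length y) V U"] show ?thesis
      by (auto simp: juxt_def Int_Un_distrib2 intro!: arg_cong[of _ _ "nths y"])
  qed
  have 2: "{j. j + length y \<in> juxt (length y) V U} = U"
    using assms(2) by (auto simp: juxt_def)
  have "rank (juxt (length y) V U) v = rank V v" if v: "v \<in> set (nths y V)" for v
  proof (rule rank_juxt_le[OF assms(2)])
    obtain i where "i < length y" "v = y ! i" using v by (auto simp: set_nths)
    then show "v \<le> length y" using assms(1) by (force simp: parent_word_def)
  qed
  then show ?thesis by (simp add: subword_def nths_append 1 2)
qed

lemma sum_closed_in_append:
  assumes "parent_word y" "parent_word x" and "w \<in> word_substs (length y) x"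
  shows "(\<Sum>U | closed_in (y @ w) U. H U) =
    (\<Sum>V | closed_in y V. \<Sum>U | closed_in x U.
       if \<forall>i<length x. x ! i = 0 \<longrightarrow> w ! i \<noteq> 0 \<longrightarrow> (i \<in> U \<longleftrightarrow> w ! i - 1 \<in> V) then H (juxt (length y) V U) else 0)"
    (is "_ = (\<Sum>V | _. \<Sum>U | _. if ?C V U then _ else _)")
proof -
  have len: "length w = length x" using assms(3) by (simp add: in_word_substs_iff)
  let ?q = "length y" and ?p = "length x"
  have "(\<Sum>V | closed_in y V. \<Sum>U | closed_in x U. if ?C V U then H (juxt ?q V U) else 0) =
     (\<Sum>(V, U)\<in>{V. closed_in y V} \<times> {U. closed_in x U}. if ?C V U then H (juxt ?q V U) else 0)"
    by (rule sum.cartesian_product)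
  also have "\<dots> = (\<Sum>(V, U)\<in>{(V, U). closed_in y V \<and> closed_in x U \<and> ?C V U}. H (juxt ?q V U))"
    by (rule sum.mono_neutral_cong_right)
       (auto simp: finite_closed_in intro!: finite_cartesian_product split: if_splits)
  also have "\<dots> = (\<Sum>U | closed_in (y @ w) U. H U)"
  proof (rule sum.reindex_bij_witness[where j = "\<lambda>(V, U). juxt ?q V U"
        and i = "\<lambda>U. (U \<inter> {..<?q}, {i. i < ?p \<and> ?q + i \<in> U})"])
    fix a assume "a \<in> {(V, U). closed_in y V \<and> closed_in x U \<and> ?C V U}"
    then obtain V U where a: "a = (V, U)" "closed_in y V" "closed_in x U" "?C V U" by auto
    then have V: "V \<subseteq> {..<?q}" "U \<subseteq> {..<?p}" by (auto simp: closed_in_def)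
    then show "((case a of (V, U) \<Rightarrow> juxt ?q V U) \<inter> {..<?q}, {i. i < ?p \<and> ?q + i \<in> (case a of (V, U) \<Rightarrow> juxt ?q V U)}) = a"
      using a(1) by (auto simp: juxt_def)
    show "(case a of (V, U) \<Rightarrow> juxt ?q V U) \<in> {U. closed_in (y @ w) U}"
      using a closed_in_juxt_iff[OF assms(1,3) V assms(2)] by simp
    show "H (case a of (V, U) \<Rightarrow> juxt ?q V U) = (case a of (V, U) \<Rightarrow> H (juxt ?q V U))"
      using a by simp
  next
    fix U assume "U \<in> {U. closed_in (y @ w) U}"
    then have U: "closed_in (y @ w) U" "U \<subseteq> {..<?q + ?p}" by (auto simp: closed_in_def len)
    note j = juxt_collapse[OF U(2)]
    then show "(case (U \<inter> {..<?q}, {i. i < ?p \<and> ?q + i \<in> U}) of (V, U) \<Rightarrow> juxt ?q V U) = U" by simp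
    have "U \<inter> {..<?q} \<subseteq> {..<?q}" "{i. i < ?p \<and> ?q + i \<in> U} \<subseteq> {..<?p}" by auto
    from closed_in_juxt_iff[OF assms(1,3) this assms(2)] U j
    show "(U \<inter> {..<?q}, {i. i < ?p \<and> ?q + i \<in> U}) \<in> {(V, U). closed_in y V \<and> closed_in x U \<and> ?C V U}"
      by simp
  qed
  finally show ?thesis by simp
qed

text \<open>The bialgebra axiom on parent words: choosing a grafting and then a union of components
  of the result amounts to choosing unions of components in \<open>y\<close> and in \<open>x\<close>
  and then grafting the chosen parts and the remaining parts independently.\<close>

lemma sum_substs_closed_in:
  fixes G :: "nat list \<Rightarrow> nat list \<Rightarrow> 'd::comm_monoid_add"
  assumes y: "parent_word y" and x: "parent_word x"
  shows "(\<Sum>w\<in>word_substs (length y) x. \<Sum>U | closed_in (y @ w) U.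
           G (subword (y @ w) U) (subword (y @ w) ({..<length (y @ w)} - U))) =
         (\<Sum>V | closed_in y V. \<Sum>U | closed_in x U.
           \<Sum>u\<in>word_substs (length (subword y V)) (subword x U).
           \<Sum>v\<in>word_substs (length (subword y ({..<length y} - V))) (subword x ({..<length x} - U)).
             G (subword y V @ u) (subword y ({..<length y} - V) @ v))"
proof -
  let ?q = "length y" and ?p = "length x"
  let ?C = "\<lambda>w V U. \<forall>i<?p. x ! i = 0 \<longrightarrow> w ! i \<noteq> 0 \<longrightarrow> (i \<in> U \<longleftrightarrow> w ! i - 1 \<in> V)"
  let ?G = "\<lambda>w U. G (subword (y @ w) U) (subword (y @ w) ({..<?q + ?p} - U))"
  have len: "length w = ?p" if "w \<in> word_substs ?q x" for w
    using that by (simp add: in_word_substs_iff)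
  have "(\<Sum>w\<in>word_substs ?q x. \<Sum>U | closed_in (y @ w) U.
           G (subword (y @ w) U) (subword (y @ w) ({..<length (y @ w)} - U))) =
     (\<Sum>w\<in>word_substs ?q x. \<Sum>V | closed_in y V. \<Sum>U | closed_in x U.
        if ?C w V U then ?G w (juxt ?q V U) else 0)"
    by (rule sum.cong[OF refl]) (simp add: sum_closed_in_append[OF y x] len)
  also have "\<dots> = (\<Sum>V | closed_in y V. \<Sum>w\<in>word_substs ?q x. \<Sum>U | closed_in x U.
        if ?C w V U then ?G w (juxt ?q V U) else 0)"
    by (rule sum.swap)
  also have "\<dots> = (\<Sum>V | closed_in y V. \<Sum>U | closed_in x U. \<Sum>w\<in>word_substs ?q x.
        if ?C w V U then ?G w (juxt ?q V U) else 0)"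
    by (intro sum.cong refl sum.swap)
  also have "\<dots> = (\<Sum>V | closed_in y V. \<Sum>U | closed_in x U.
           \<Sum>u\<in>word_substs (length (subword y V)) (subword x U).
           \<Sum>v\<in>word_substs (length (subword y ({..<?q} - V))) (subword x ({..<?p} - U)).
             G (subword y V @ u) (subword y ({..<?q} - V) @ v))"
  proof (rule sum.cong[OF refl], rule sum.cong[OF refl])
    fix V U assume "V \<in> {V. closed_in y V}" "U \<in> {U. closed_in x U}"
    then have V: "closed_in y V" "V \<subseteq> {..<?q}" and U: "closed_in x U" "U \<subseteq> {..<?p}"
      by (auto simp: closed_in_def)
    let ?V' = "{..<?q} - V" and ?U' = "{..<?p} - U"
    have V': "closed_in y ?V'" "?V' \<subseteq> {..<?q}" and U': "closed_in x ?U'" "?U' \<subseteq> {..<?p}"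
      using closed_in_Diff[OF closed_in_full[OF y] V(1)] closed_in_Diff[OF closed_in_full[OF x] U(1)] by auto
    let ?h = "rank (juxt ?q V U)" and ?k = "rank (juxt ?q ?V' ?U')"
    \<comment> \<open>With \<open>V\<close> and \<open>U\<close> fixed, compatibility restricts each
      letter of \<open>w\<close> separately. The admissible words therefore form a product set, and
      the sum over it splits into the positions inside and outside \<open>U\<close>.\<close>
    let ?A = "\<lambda>i. {j \<in> letter_substs ?q (x ! i). x ! i = 0 \<longrightarrow> j \<noteq> 0 \<longrightarrow> (i \<in> U \<longleftrightarrow> j - 1 \<in> V)}"
    let ?As = "map ?A [0..<?p]"
    have A: "?A i = {j \<in> letter_substs ?q (x ! i). x ! i = 0 \<longrightarrow> j \<noteq> 0 \<longrightarrow> j - 1 \<in> V}" if "i \<in> U" for i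
      using that by auto
    \<comment> \<open>At a zero of \<open>x\<close> the letter is at most \<open>length y\<close>,
      so a nonzero one names a node of \<open>y\<close>, and not being in \<open>V\<close> means
      being in \<open>?V'\<close>.\<close>
    have A': "?A i = {j \<in> letter_substs ?q (x ! i). x ! i = 0 \<longrightarrow> j \<noteq> 0 \<longrightarrow> j - 1 \<in> ?V'}" if "i \<in> ?U'" for i
      using that by (auto simp: letter_substs_def)
    have set: "{w \<in> word_substs ?q x. ?C w V U} = listset ?As"
      unfolding word_substs_def in_listset_iff set_eq_iff by auto
    have nx: "map (letter_substs c) (subword x S) = map (\<lambda>i. letter_substs c (rank S (x ! i))) (nths [0..<?p] S)" for c S
    proof -
      have "nths x S = map ((!) x) (nths [0..<?p] S)"
        by (metis nths_map map_nth)
      then show ?thesis by (simp add: subword_def)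
    qed
    have "(\<Sum>w\<in>word_substs ?q x. if ?C w V U then ?G w (juxt ?q V U) else 0) = (\<Sum>w\<in>listset ?As. ?G w (juxt ?q V U))"
      unfolding set[symmetric] by (rule sum.mono_neutral_cong_right) (auto simp: finite_word_substs)
    also have "\<dots> = (\<Sum>w\<in>listset ?As. G (subword y V @ map ?h (nths w U)) (subword y ?V' @ map ?k (nths w (- U))))"
    proof (rule sum.cong[OF refl])
      fix w assume "w \<in> listset ?As"
      then have "length w = ?p" by (simp add: in_listset_iff)
      then have "nths w ?U' = nths w (- U)"
        by (auto simp: nths_def intro!: arg_cong[of _ _ "map fst"] filter_cong dest: set_zip_rightD)
      then show "?G w (juxt ?q V U) = G (subword y V @ map ?h (nths w U)) (subword y ?V' @ map ?k (nths w (- U)))"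
        by (simp add: juxt_Diff[OF V(2)] subword_juxt[OF y V(2)] subword_juxt[OF y V'(2)])
    qed
    also have "\<dots> = (\<Sum>u\<in>listset (map ((`) ?h) (nths ?As U)). \<Sum>v\<in>listset (map ((`) ?k) (nths ?As (- U))).
        G (subword y V @ u) (subword y ?V' @ v))"
    proof (rule sum_listset_split[where G = "\<lambda>u v. G (subword y V @ u) (subword y ?V' @ v)"])
      show "inj_on ?h (?As ! i)" if "i < length ?As" "i \<in> U" for i
        using rank_juxt_image[OF U(1) V(2) that(2)] that A[OF that(2)] by simp
      show "inj_on ?k (?As ! i)" if "i < length ?As" "i \<notin> U" for i
        using rank_juxt_image[OF U'(1) V'(2), of i] that A'[of i] by simp
    qed
    also have "map ((`) ?h) (nths ?As U) = map (letter_substs (length (subword y V))) (subword x U)"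
      unfolding nx length_subword[OF V(2)] nths_map map_map
    proof (rule map_cong[OF refl])
      fix i assume "i \<in> set (nths [0..<?p] U)"
      then have i: "i \<in> U" by (auto simp: set_nths)
      show "((`) ?h \<circ> ?A) i = letter_substs (card V) (rank U (x ! i))"
        unfolding comp_def A[OF i] using rank_juxt_image[OF U(1) V(2) i] by (rule conjunct2)
    qed
    also have "nths ?As (- U) = nths ?As ?U'"
      by (auto simp: nths_def intro!: arg_cong[of _ _ "map fst"] filter_cong dest: set_zip_rightD)
    also have "map ((`) ?k) (nths ?As ?U') = map (letter_substs (length (subword y ?V'))) (subword x ?U')"
      unfolding nx length_subword[OF V'(2)] nths_map map_map
    proof (rule map_cong[OF refl])
      fix i assume "i \<in> set (nths [0..<?p] ?U')"
      then have i: "i \<in> ?U'" by (auto simp: set_nths)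
      show "((`) ?k \<circ> ?A) i = letter_substs (card ?V') (rank ?U' (x ! i))"
        unfolding comp_def A'[OF i] using rank_juxt_image[OF U'(1) V'(2) i] by (rule conjunct2)
    qed
    finally show "(\<Sum>w\<in>word_substs ?q x. if ?C w V U then ?G w (juxt ?q V U) else 0) =
        (\<Sum>u\<in>word_substs (length (subword y V)) (subword x U).
         \<Sum>v\<in>word_substs (length (subword y ?V')) (subword x ?U').
           G (subword y V @ u) (subword y ?V' @ v))"
      by (simp add: word_substs_def)
  qed
  finally show ?thesis .
qed

section \<open>Cuts and zeros\<close>

lemma length_shift_word [simp]: "length (shift_word q w) = length w"
  by (simp add: shift_word_def)

lemma zeros_le: "w \<in> word_substs q x \<Longrightarrow> zeros w \<le> zeros x"
proof (induction x arbitrary: w)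
  case (Cons a x)
  then show ?case
    by (cases w) (force simp: word_substs_def set_Cons_def letter_substs_def zeros_def split: if_splits)+
qed (simp add: word_substs_def zeros_def)

text \<open>Each child of the root that is attached to a non-root node costs one zero. Equality
  therefore singles out the grafting of all components at the root, the leading term of the
  product.\<close>

lemma zeros_eq_imp: "w \<in> word_substs q x \<Longrightarrow> zeros w = zeros x \<Longrightarrow> w = shift_word q x"
proof (induction x arbitrary: w)
  case (Cons a x)
  from Cons.prems(1) obtain b v where w: "w = b # v" "b \<in> letter_substs q a" "v \<in> word_substs q x"
    by (auto simp: word_substs_def set_Cons_def)
  have "zeros v \<le> zeros x" by (rule zeros_le[OF w(3)])
  then have "zeros v = zeros x \<and> (a = 0 \<longrightarrow> b = 0)"
    using Cons.prems(2) w by (auto simp: zeros_def letter_substs_def split: if_splits)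
  then show ?case
    using Cons.IH[OF w(3)] w by (auto simp: shift_word_def letter_substs_def split: if_splits)
qed (simp add: word_substs_def shift_word_def)

lemma shift_word_in_substs: "shift_word q x \<in> word_substs q x"
  by (simp add: in_word_substs_iff shift_word_def)

lemma zeros_append: "zeros (u @ v) = zeros u + zeros v"
  by (simp add: zeros_def)

lemma zeros_shift_word: "zeros (shift_word q w) = zeros w"
  by (induction w) (auto simp: zeros_def shift_word_def)

lemma finite_cuts [simp]: "finite (cuts w)"
  by (rule finite_subset[of _ "{..<length w}"]) (auto simp: cuts_def)

text \<open>For \<open>q\<close> below \<open>length y\<close> the shifted letters are 0 or exceed
  \<open>q\<close> anyway, so only \<open>y\<close> matters; from \<open>length y\<close> on only
  the letters of \<open>x\<close> are examined.\<close>

lemma cuts_append_shift: "cuts (y @ shift_word (length y) x) = cuts y \<union> (+) (length y) ` cuts x"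
proof (intro equalityI subsetI)
  fix q assume q: "q \<in> cuts (y @ shift_word (length y) x)"
  then have 1: "\<And>i. q \<le> i \<Longrightarrow> i < length y + length x \<Longrightarrow> (y @ shift_word (length y) x) ! i = 0 \<or> q < (y @ shift_word (length y) x) ! i"
    and 2: "q < length y + length x"
    by (auto simp: cuts_def)
  show "q \<in> cuts y \<union> (+) (length y) ` cuts x"
  proof (cases "q < length y")
    case True
    have "y ! i = 0 \<or> q < y ! i" if "q \<le> i" "i < length y" for i
      using 1[of i] that by (simp add: nth_append)
    with True have "q \<in> cuts y" by (simp add: cuts_def)
    then show ?thesis by simp
  next
    case False
    have "q - length y \<in> cuts x"
      unfolding cuts_def
    proof (intro CollectI conjI allI impI)
      show "q - length y < length x" using 2 False by simp
      fix i assume "q - length y \<le> i" "i < length x"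
      then have "(y @ shift_word (length y) x) ! (length y + i) = 0 \<or> q < (y @ shift_word (length y) x) ! (length y + i)"
        by (intro 1) simp_all
      moreover have "(y @ shift_word (length y) x) ! (length y + i) = (if x ! i = 0 then 0 else x ! i + length y)"
        using \<open>i < length x\<close> by (simp add: shift_word_def)
      ultimately show "x ! i = 0 \<or> q - length y < x ! i"
        using False by (auto split: if_splits)
    qed
    with False show ?thesis by (auto intro!: image_eqI[of _ _ "q - length y"])
  qed
next
  fix q assume "q \<in> cuts y \<union> (+) (length y) ` cuts x"
  then show "q \<in> cuts (y @ shift_word (length y) x)"
  proof
    assume "q \<in> cuts y"
    then show ?thesis by (auto simp: cuts_def nth_append shift_word_def)
  next
    assume "q \<in> (+) (length y) ` cuts x"
    then obtain r where "q = length y + r" "r \<in> cuts x" by auto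
    show ?thesis
      unfolding cuts_def
    proof (intro CollectI conjI allI impI)
      show "q < length (y @ shift_word (length y) x)"
        using \<open>q = length y + r\<close> \<open>r \<in> cuts x\<close> by (simp add: cuts_def)
      fix i assume i: "q \<le> i" "i < length (y @ shift_word (length y) x)"
      then have "r \<le> i - length y" "i - length y < length x"
        using \<open>q = length y + r\<close> by auto
      then have "x ! (i - length y) = 0 \<or> r < x ! (i - length y)"
        using \<open>r \<in> cuts x\<close> by (simp add: cuts_def)
      then show "(y @ shift_word (length y) x) ! i = 0 \<or> q < (y @ shift_word (length y) x) ! i"
        using i \<open>q = length y + r\<close> by (auto simp: nth_append shift_word_def)
    qed
  qed
qed

lemma card_cuts_append_shift: "card (cuts (y @ shift_word (length y) x)) = card (cuts y) + card (cuts x)"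
proof -
  have "cuts y \<inter> (+) (length y) ` cuts x = {}" by (auto simp: cuts_def)
  then show ?thesis by (simp add: cuts_append_shift card_Un_disjoint card_image)
qed

text \<open>At a cut \<open>q\<close> the parent of node \<open>q + 1\<close> is at most
  \<open>q\<close>, so it has to be the root.\<close>

lemma card_cuts_le_zeros: "parent_word w \<Longrightarrow> card (cuts w) \<le> zeros w"
proof -
  assume "parent_word w"
  then have "cuts w \<subseteq> {i. i < length w \<and> 0 = w ! i}"
    by (force simp: cuts_def parent_word_def)
  then show ?thesis
    unfolding zeros_def length_filter_conv_card by (rule card_mono[rotated]) simp
qed

lemma cuts_nonempty: "w \<noteq> [] \<Longrightarrow> 0 \<in> cuts w"
  by (auto simp: cuts_def)

lemma shift_word_inject: "shift_word q u = shift_word q v \<longleftrightarrow> u = v"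
proof
  assume *: "shift_word q u = shift_word q v"
  have "inj (\<lambda>a. if a = 0 then 0 else a + q)" by (auto simp: inj_def)
  with * show "u = v" unfolding shift_word_def by (metis inj_map_eq_map)
qed simp

lemma split_at_cut:
  assumes "q \<in> cuts w"
  shows "\<exists>x. parent_word w \<longrightarrow> parent_word x \<and> w = take q w @ shift_word q x"
proof -
  \<comment> \<open>Truncated subtraction inverts the shift: it fixes 0, and because
    \<open>q\<close> is a cut all other letters from there on exceed \<open>q\<close>.\<close>
  let ?x = "map (\<lambda>a. a - q) (drop q w)"
  have "drop q w = shift_word q ?x"
    unfolding shift_word_def map_map
  proof (rule nth_equalityI)
    fix i assume "i < length (drop q w)"
    then show "drop q w ! i = map ((\<lambda>a. if a = 0 then 0 else a + q) \<circ> (\<lambda>a. a - q)) (drop q w) ! i"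
      using assms[unfolded cuts_def, simplified, THEN conjunct2, rule_format, of "q + i"] by auto
  qed simp
  then have "w = take q w @ shift_word q ?x" by (metis append_take_drop_id)
  moreover have "parent_word ?x" if "parent_word w"
    unfolding parent_word_def
  proof (intro allI impI)
    fix i assume "i < length ?x"
    then have "w ! (q + i) \<le> q + i" using that by (simp add: parent_word_def)
    then show "?x ! i \<le> i" using \<open>i < length ?x\<close> by simp
  qed
  ultimately show ?thesis by blast
qed

section \<open>The edges of a tree\<close>

text \<open>The passage from trees to words goes through edges: grafting and restriction act on edge
  sets by unions and images, without regard to the order of the branches.\<close>

primrec edges :: "'l ltree \<Rightarrow> ('l \<times> 'l) set" where
  "edges (Node a ts) = Pair a ` label ` set ts \<union> \<Union> (set (map edges ts))"

declare edges.simps [simp del]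

lemma edges_Node [simp]: "edges (Node a ts) = (\<Union>t\<in>set ts. insert (a, label t) (edges t))"
  by (auto simp: edges.simps)

lemma edges_map: "edges (map_ltree h t) = map_prod h h ` edges t"
proof (induction t)
  case (Node a ts)
  then show ?case by (auto simp: image_UN label_map image_iff)
qed

lemma edges_subset: "edges t \<subseteq> set_ltree t \<times> set_ltree t"
proof (induction t)
  case (Node a ts)
  then show ?case using label_in by fastforce
qed

lemma set_ltree_edges: "set_ltree t = insert (label t) (snd ` edges t)"
proof (induction t)
  case (Node a ts)
  then show ?case by (auto simp: image_UN)
qed

lemma edges_less: "heap_labelled t \<Longrightarrow> (a, c) \<in> edges t \<Longrightarrow> a < c"
proof (induction t)
  case (Node b ts)
  then show ?case by (auto simp: list_all_iff)
qed

lemma edges_attach: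
  "edges (attach g t) = edges t \<union> (\<Union>v\<in>set_ltree t. \<Union>s\<in>set (g v). insert (v, label s) (edges s))"
proof (induction t)
  case (Node a ts)
  then show ?case by (simp cong: SUP_cong) blast
qed

lemma distinct_concat_disjoint:
  assumes "distinct (concat (map preorder ts))" "s \<in> set ts" "t \<in> set ts" "l \<in> set_ltree s" "l \<in> set_ltree t"
  shows "s = t"
  using assms
proof (induction ts)
  case (Cons u ts)
  then have "set_ltree u \<inter> (\<Union>t\<in>set ts. set_ltree t) = {}"
    by (simp add: set_preorder)
  then show ?case using Cons by auto
qed simp

lemma parent_unique:
  assumes "distinct (preorder t)"
  shows "(a, label t) \<notin> edges t" "(a, c) \<in> edges t \<Longrightarrow> (b, c) \<in> edges t \<Longrightarrow> a = b"
proof -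
  have "(\<forall>a. (a, label t) \<notin> edges t) \<and> (\<forall>a b c. (a, c) \<in> edges t \<longrightarrow> (b, c) \<in> edges t \<longrightarrow> a = b)"
    using assms
  proof (induction t)
    case (Node r ts)
    then have d: "distinct (concat (map preorder ts))" and r: "\<And>s. s \<in> set ts \<Longrightarrow> r \<notin> set_ltree s"
      and ds: "\<And>s. s \<in> set ts \<Longrightarrow> distinct (preorder s)"
      by (auto simp: set_preorder distinct_concat_iff)
    have "a = b" if "s \<in> set ts" "t \<in> set ts" "(a, c) \<in> insert (r, label s) (edges s)"
      "(b, c) \<in> insert (r, label t) (edges t)" for a b c s t
    proof -
      have "c \<in> set_ltree s" "c \<in> set_ltree t"
        using that edges_subset label_in by fastforce+
      then have "s = t" using distinct_concat_disjoint[OF d that(1,2)] by simp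
      then show "a = b" using Node.IH[OF that(1) ds[OF that(1)]] that(3,4) by auto
    qed
    moreover have "(a, r) \<notin> insert (r, label s) (edges s)" if "s \<in> set ts" for a s
      using r[OF that] edges_subset[of s] label_in[of s] by auto
    ultimately show ?case by (auto simp del: insert_iff) blast+
  qed
  then show "(a, label t) \<notin> edges t" "(a, c) \<in> edges t \<Longrightarrow> (b, c) \<in> edges t \<Longrightarrow> a = b" by auto
qed

text \<open>The sorting of children by label makes a tree recoverable from its set of edges.\<close>

primrec follows :: "(nat \<times> nat) set \<Rightarrow> nat ltree \<Rightarrow> bool" where
  "follows E (Node a ts) \<longleftrightarrow>
     label ` set ts = {c. (a, c) \<in> E} \<and> sorted_wrt (>) (map label ts) \<and> list_all (follows E) ts"

lemma sorted_wrt_greater_unique: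
  assumes "sorted_wrt (>) xs" "sorted_wrt (>) ys" "set xs = set (ys :: nat list)"
  shows "xs = ys"
proof -
  have "sorted_wrt (<) (rev xs)" "sorted_wrt (<) (rev ys)"
    using assms(1,2) by (simp_all add: sorted_wrt_rev)
  then have "rev xs = rev ys" using assms(3) by (intro strict_sorted_equal) simp_all
  then show ?thesis by simp
qed

lemma follows_unique: "follows E s \<Longrightarrow> follows E t \<Longrightarrow> label s = label t \<Longrightarrow> s = t"
proof (induction s arbitrary: t)
  case (Node a ss)
  then obtain ts where t: "t = Node a ts" by (cases t) auto
  have m: "map label ss = map label ts"
    using Node.prems by (intro sorted_wrt_greater_unique) (auto simp: t)
  then have len: "length ss = length ts" by (rule map_eq_imp_length_eq)
  have "ss = ts"
  proof (rule nth_equalityI[OF len])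
    fix i assume i: "i < length ss"
    have "label (ss ! i) = label (ts ! i)" using m i len by (metis nth_map)
    then show "ss ! i = ts ! i"
      using Node.prems(1,2) i len by (intro Node.IH) (auto simp: t list_all_length)
  qed
  then show ?case by (simp add: t)
qed

text \<open>\<open>E\<close> is compared with the edges of \<open>t\<close> only at the nodes of
  \<open>t\<close>. The induction can thus keep the edge set of the whole tree while descending into
  subtrees, whose nodes are disjoint.\<close>

lemma follows_edges:
  assumes "heap_labelled t" "distinct (preorder t)"
    and "\<And>a c. a \<in> set_ltree t \<Longrightarrow> (a, c) \<in> E \<longleftrightarrow> (a, c) \<in> edges t"
  shows "follows E t"
  using assms
proof (induction t)
  case (Node r ts)
  from Node.prems(2) have d: "distinct (concat (map preorder ts))" and r: "\<And>s. s \<in> set ts \<Longrightarrow> r \<notin> set_ltree s"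
    and ds: "\<And>s. s \<in> set ts \<Longrightarrow> distinct (preorder s)"
    by (auto simp: set_preorder distinct_concat_iff)
  have "{c. (r, c) \<in> E} = label ` set ts"
    using Node.prems(3)[of r] r edges_subset by fastforce
  moreover have "follows E s" if s: "s \<in> set ts" for s
  proof (rule Node.IH[OF s])
    show "heap_labelled s" using Node.prems(1) s by (simp add: list_all_iff)
    show "distinct (preorder s)" by (rule ds[OF s])
    fix a c assume a: "a \<in> set_ltree s"
    then have "(a, c) \<in> E \<longleftrightarrow> (a, c) \<in> edges (Node r ts)"
      using s by (intro Node.prems(3)) auto
    also have "\<dots> \<longleftrightarrow> (a, c) \<in> edges s"
    proof
      assume "(a, c) \<in> edges (Node r ts)"
      then obtain u where u: "u \<in> set ts" "(a, c) \<in> insert (r, label u) (edges u)" by auto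
      have "a \<noteq> r" using a r[OF s] by auto
      with u have *: "(a, c) \<in> edges u" by auto
      then have "a \<in> set_ltree u" using edges_subset by auto
      from distinct_concat_disjoint[OF d u(1) s this a] * show "(a, c) \<in> edges s" by simp
    qed (use s in auto)
    finally show "(a, c) \<in> E \<longleftrightarrow> (a, c) \<in> edges s" .
  qed
  ultimately show ?case using Node.prems(1) by (simp add: list_all_iff)
qed

lemma hotree_eqI: "edges (tree_of x) = edges (tree_of y) \<Longrightarrow> x = y"
proof -
  assume e: "edges (tree_of x) = edges (tree_of y)"
  have *: "follows (edges (tree_of z)) (tree_of z)" "label (tree_of z) = 0" for z
    using heap_ordered_tree_of[of z] by (auto simp: is_heap_ordered_def intro: follows_edges)
  have "tree_of x = tree_of y"
    by (rule follows_unique[of "edges (tree_of x)"]) (use * e in metis)+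
  then show ?thesis by (simp add: tree_of_inject)
qed

section \<open>The parent word of a heap-ordered tree\<close>

definition word_edges :: "nat list \<Rightarrow> (nat \<times> nat) set" where
  "word_edges w = {(w ! i, Suc i) | i. i < length w}"

lemma word_edges_image: "word_edges w = (\<lambda>i. (w ! i, Suc i)) ` {..<length w}"
  by (auto simp: word_edges_def)

lemma word_edges_append:
  "word_edges (u @ v) = word_edges u \<union> (\<lambda>j. (v ! j, Suc (length u + j))) ` {..<length v}"
proof -
  have "{..<m + n} = {..<m} \<union> (+) m ` {..<n}" for m n :: nat
  proof (intro equalityI subsetI)
    fix i assume "i \<in> {..<m + n}"
    then show "i \<in> {..<m} \<union> (+) m ` {..<n}"
      by (cases "i < m") (auto intro!: image_eqI[of _ _ "i - m"])
  qed auto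
  then show ?thesis
    by (simp add: word_edges_image image_Un image_image nth_append)
qed

definition word_of :: "hotree \<Rightarrow> nat list" where
  "word_of x = map (\<lambda>i. THE a. (a, Suc i) \<in> edges (tree_of x)) [0..<nodes x - 1]"

lemma set_tree_of: "set_ltree (tree_of x) = {..<nodes x}"
  using heap_ordered_tree_of[of x] by (simp add: is_heap_ordered_def nodes_def)

lemma length_word_of [simp]: "length (word_of x) = nodes x - 1"
  by (simp add: word_of_def)

lemma edges_tree_of: "edges (tree_of x) = word_edges (word_of x)"
proof -
  have x: "distinct (preorder (tree_of x))" "label (tree_of x) = 0" "heap_labelled (tree_of x)"
    using heap_ordered_tree_of[of x] by (auto simp: is_heap_ordered_def)
  have p: "(a, Suc i) \<in> edges (tree_of x) \<longleftrightarrow> a = word_of x ! i" if "i < nodes x - 1" for i a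
  proof -
    have "Suc i \<in> set_ltree (tree_of x)" using that by (simp add: set_tree_of)
    then obtain b where "(b, Suc i) \<in> edges (tree_of x)"
      using x(2) by (auto simp: set_ltree_edges)
    moreover from this have "word_of x ! i = b"
      using that parent_unique(2)[OF x(1)] by (auto simp: word_of_def intro!: the_equality)
    ultimately show ?thesis using parent_unique(2)[OF x(1)] by blast
  qed
  have "\<exists>i<nodes x - 1. c = Suc i" if "(a, c) \<in> edges (tree_of x)" for a c
  proof -
    have "c \<in> {..<nodes x}" using that edges_subset by (auto simp: set_tree_of[symmetric])
    moreover have "0 < c" using edges_less[OF x(3) that] by simp
    ultimately show ?thesis by (intro exI[of _ "c - 1"]) auto
  qed
  with p show ?thesis unfolding word_edges_def by (auto simp: word_edges_def) blast+
qed

text \<open>The nodes are the root and the lower ends of the edges, so the edges also determine the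
  number of nodes. To compute a parent word it suffices to find the edges.\<close>

lemma word_of_unique:
  assumes "edges (tree_of x) = word_edges w"
  shows "word_of x = w"
proof -
  have "set_ltree (tree_of x) = insert 0 (Suc ` {..<length w})"
    using heap_ordered_tree_of[of x]
    by (simp add: set_ltree_edges assms is_heap_ordered_def word_edges_image image_image)
  also have "\<dots> = {..<Suc (length w)}" by (rule lessThan_Suc_eq_insert_0[symmetric])
  finally have len: "length (word_of x) = length w" by (simp add: set_tree_of)
  have "word_edges (word_of x) = word_edges w" using assms edges_tree_of by simp
  then show ?thesis
    using len by (intro nth_equalityI) (auto simp: word_edges_def set_eq_iff)
qed

lemma word_of_inject: "word_of x = word_of y \<longleftrightarrow> x = y"
  using hotree_eqI[of x y] edges_tree_of by metis

lemma parent_word_word_of: "parent_word (word_of x)"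
  unfolding parent_word_def
proof (intro allI impI)
  fix i assume "i < length (word_of x)"
  then have "(word_of x ! i, Suc i) \<in> edges (tree_of x)"
    by (auto simp: edges_tree_of word_edges_def)
  then show "word_of x ! i \<le> i"
    using edges_less heap_ordered_tree_of[of x] by (fastforce simp: is_heap_ordered_def)
qed

lemma word_of_one_node: "word_of one_node = []"
  by (rule word_of_unique) (simp add: tree_of_one_node word_edges_def)

lemma nodes_eq_length: "nodes x = Suc (length (word_of x))"
  using nodes_pos'[of x] by simp

lemma edges_branches: "edges (tree_of x) = (\<Union>t\<in>set (branches x). insert (0, label t) (edges t))"
  by (subst tree_of_branches) simp

lemma branch_labels_pos: "t \<in> set (branches x) \<Longrightarrow> l \<in> set_ltree t \<Longrightarrow> 0 < l"
  using labels_branches(2)[of x] by (auto simp: set_preorder set_eq_iff) 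

lemma branches_disjoint: "s \<in> set (branches x) \<Longrightarrow> t \<in> set (branches x) \<Longrightarrow> l \<in> set_ltree s \<Longrightarrow> l \<in> set_ltree t \<Longrightarrow> s = t"
  by (rule distinct_concat_disjoint[OF labels_branches(1)])

lemma branch_nth_eq_iff:
  assumes "i < length (branches x)" "j < length (branches x)"
  shows "label (branches x ! i) = label (branches x ! j) \<longleftrightarrow> i = j"
proof -
  have "sorted_wrt (>) (map label (branches x))" by (rule labels_branches(4))
  then have "distinct (map label (branches x))"
    by (simp add: sorted_wrt_map) (metis labels_branches(4) distinct_rev sorted_wrt_rev strict_sorted_iff rev_map)
  then show ?thesis using assms by (metis length_map nth_eq_iff_index_eq nth_map)
qed

lemma root_edge_iff: "(0, c) \<in> edges (tree_of x) \<longleftrightarrow> c \<in> label ` set (branches x)"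
proof -
  have "(0, c) \<notin> edges t" if "t \<in> set (branches x)" for t
    using branch_labels_pos[OF that, of 0] edges_subset[of t] by auto
  then show ?thesis by (auto simp: edges_branches)
qed

lemma nonroot_edge_iff: "a \<noteq> 0 \<Longrightarrow> (a, c) \<in> edges (tree_of x) \<longleftrightarrow> (\<exists>t\<in>set (branches x). (a, c) \<in> edges t)"
  by (auto simp: edges_branches)

lemma branch_edge_nonroot: "t \<in> set (branches x) \<Longrightarrow> (a, c) \<in> edges t \<Longrightarrow> a \<noteq> 0"
  using branch_labels_pos[of t x a] edges_subset[of t] by auto

lemma word_of_eq_0_iff:
  assumes "j < length (word_of x)"
  shows "word_of x ! j = 0 \<longleftrightarrow> (\<exists>i<length (branches x). label (branches x ! i) = Suc j)"
proof -
  have "word_of x ! j = 0 \<longleftrightarrow> (0, Suc j) \<in> edges (tree_of x)"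
    using assms by (auto simp: edges_tree_of word_edges_def)
  also have "\<dots> \<longleftrightarrow> (\<exists>i<length (branches x). label (branches x ! i) = Suc j)"
    unfolding root_edge_iff by (metis (no_types) imageE imageI in_set_conv_nth)
  finally show ?thesis .
qed

section \<open>Grafting on parent words\<close>

text \<open>The segment that \<open>x\<close> contributes to the word of a grafted tree. A node
  \<open>j + 1\<close> with parent 0 is the root of exactly one branch \<open>i\<close>, and its new
  parent is \<open>f i\<close>.\<close>

definition graft_word :: "hotree \<Rightarrow> (nat \<Rightarrow> nat) \<Rightarrow> nat \<Rightarrow> nat list" where
  "graft_word x f q = map (\<lambda>j. if word_of x ! j = 0
     then f (THE i. i < length (branches x) \<and> label (branches x ! i) = Suc j)
     else word_of x ! j + q) [0..<length (word_of x)]"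

lemma graft_word_root:
  assumes "i < length (branches x)"
  shows "label (branches x ! i) - 1 < length (word_of x)"
    "word_of x ! (label (branches x ! i) - 1) = 0"
    "graft_word x f q ! (label (branches x ! i) - 1) = f i"
proof -
  let ?l = "label (branches x ! i)"
  have mem: "branches x ! i \<in> set (branches x)" using assms by simp
  have pos: "0 < ?l" using branch_labels_pos[OF mem label_in] .
  have "(0, ?l) \<in> edges (tree_of x)" using mem by (simp add: root_edge_iff)
  then obtain j where j: "j < length (word_of x)" "?l = Suc j" "word_of x ! j = 0"
    by (auto simp: edges_tree_of word_edges_def)
  have "(THE i. i < length (branches x) \<and> label (branches x ! i) = Suc j) = i"
    using assms j branch_nth_eq_iff by (intro the_equality) (auto simp flip: j(2))
  with j show "label (branches x ! i) - 1 < length (word_of x)"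
    "word_of x ! (label (branches x ! i) - 1) = 0"
    "graft_word x f q ! (label (branches x ! i) - 1) = f i"
    by (simp_all add: graft_word_def)
qed

lemma UN_nths_fibres:
  assumes "\<And>i. i < length xs \<Longrightarrow> f i \<in> N"
  shows "(\<Union>v\<in>N. \<Union>s\<in>set (nths xs {i. f i = v}). F v s) = (\<Union>i\<in>{..<length xs}. F (f i) (xs ! i))"
  unfolding set_nths using assms by blast

lemma word_of_graft:
  assumes "f \<in> {..<length (branches x)} \<rightarrow>\<^sub>E Nod y"
  shows "word_of (graft x f y) = word_of y @ graft_word x f (length (word_of y))"
proof (rule word_of_unique)
  let ?q = "length (word_of y)" and ?b = "branches x"
  let ?w = "graft_word x f ?q"
  have len: "length ?w = length (word_of x)" by (simp add: graft_word_def)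
  have q: "Max (Nod y) = ?q" by (simp add: Max_Nod)
  have sh: "shifted_branches y x ! i = map_ltree (\<lambda>l. l + ?q) (?b ! i)" if "i < length ?b" for i
    using that by (simp add: shifted_branches_def q)
  have "edges (tree_of (graft x f y)) = edges (tree_of y) \<union>
     (\<Union>v\<in>Nod y. \<Union>s\<in>set (nths (shifted_branches y x) {i. f i = v}). insert (v, label s) (edges s))"
    by (simp add: tree_of_graft[OF assms] edges_attach Nod_def)
  also have "(\<Union>v\<in>Nod y. \<Union>s\<in>set (nths (shifted_branches y x) {i. f i = v}). insert (v, label s) (edges s)) =
     (\<Union>i\<in>{..<length ?b}. insert (f i, label (?b ! i) + ?q) (map_prod (\<lambda>l. l + ?q) (\<lambda>l. l + ?q) ` edges (?b ! i)))"
    (is "?L = ?R")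
  proof -
    have "length (shifted_branches y x) = length ?b" by (simp add: shifted_branches_def)
    then have "?L = (\<Union>i\<in>{..<length ?b}. insert (f i, label (shifted_branches y x ! i)) (edges (shifted_branches y x ! i)))"
      using assms by (subst UN_nths_fibres) auto
    also have "\<dots> = ?R" by (rule SUP_cong) (auto simp: sh label_map edges_map)
    finally show ?thesis .
  qed
  also have "?R = (\<lambda>j. (?w ! j, Suc (?q + j))) ` {..<length ?w}"
  proof (intro equalityI subsetI)
    fix e assume "e \<in> ?R"
    then obtain i where "i \<in> {..<length ?b}"
      and e: "e \<in> insert (f i, label (?b ! i) + ?q) (map_prod (\<lambda>l. l + ?q) (\<lambda>l. l + ?q) ` edges (?b ! i))"
      by (rule UN_E)
    then have i: "i < length ?b" by simp
    from e show "e \<in> (\<lambda>j. (?w ! j, Suc (?q + j))) ` {..<length ?w}"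
    proof (rule insertE)
      assume e: "e = (f i, label (?b ! i) + ?q)"
      have "0 < label (?b ! i)" by (rule branch_labels_pos[OF nth_mem[OF i] label_in])
      then show ?thesis
        using graft_word_root(1)[OF i] graft_word_root(3)[OF i, of f ?q] len
        by (intro image_eqI[of _ _ "label (?b ! i) - 1"]) (simp_all add: e)
    next
      assume "e \<in> map_prod (\<lambda>l. l + ?q) (\<lambda>l. l + ?q) ` edges (?b ! i)"
      then obtain a c where ac: "(a, c) \<in> edges (?b ! i)" and e: "e = (a + ?q, c + ?q)" by auto
      have "a \<noteq> 0" by (rule branch_edge_nonroot[OF nth_mem[OF i] ac])
      moreover have "(a, c) \<in> edges (tree_of x)" using ac i \<open>a \<noteq> 0\<close> by (auto simp: nonroot_edge_iff)
      ultimately obtain j where "j < length (word_of x)" "c = Suc j" "a = word_of x ! j" "word_of x ! j \<noteq> 0"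
        by (auto simp: edges_tree_of word_edges_def)
      then show ?thesis using len
        by (intro image_eqI[of _ _ j]) (simp_all add: e graft_word_def)
    qed
  next
    fix e assume "e \<in> (\<lambda>j. (?w ! j, Suc (?q + j))) ` {..<length ?w}"
    then obtain j where j: "j < length (word_of x)" "e = (?w ! j, Suc (?q + j))" using len by auto
    show "e \<in> ?R"
    proof (cases "word_of x ! j = 0")
      case True
      then obtain i where i: "i < length ?b" "label (?b ! i) = Suc j"
        using word_of_eq_0_iff[OF j(1)] by blast
      have "?w ! j = f i" using graft_word_root(3)[OF i(1), of f ?q] i(2) by simp
      then have e: "e = (f i, label (?b ! i) + ?q)" using i(2) j(2) by simp
      have "i \<in> {..<length ?b}" using i(1) by simp
      then show ?thesis unfolding e by (rule UN_I) (rule insertI1)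
    next
      case False
      moreover have "(word_of x ! j, Suc j) \<in> edges (tree_of x)"
        using j(1) by (auto simp: edges_tree_of word_edges_def)
      ultimately obtain t where "t \<in> set ?b" "(word_of x ! j, Suc j) \<in> edges t"
        by (auto simp: nonroot_edge_iff)
      then obtain i where i: "i < length ?b" "(word_of x ! j, Suc j) \<in> edges (?b ! i)"
        by (auto simp: in_set_conv_nth)
      have "e = map_prod (\<lambda>l. l + ?q) (\<lambda>l. l + ?q) (word_of x ! j, Suc j)"
        using j False by (simp add: graft_word_def)
      then have "e \<in> map_prod (\<lambda>l. l + ?q) (\<lambda>l. l + ?q) ` edges (?b ! i)"
        using i(2) by (rule image_eqI)
      then have e: "e \<in> insert (f i, label (?b ! i) + ?q) (map_prod (\<lambda>l. l + ?q) (\<lambda>l. l + ?q) ` edges (?b ! i))"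
        by (rule insertI2)
      have "i \<in> {..<length ?b}" using i(1) by simp
      then show ?thesis using e by (rule UN_I)
    qed
  qed
  also have "edges (tree_of y) \<union> (\<lambda>j. (?w ! j, Suc (?q + j))) ` {..<length ?w} = word_edges (word_of y @ ?w)"
    by (simp add: edges_tree_of word_edges_append del: length_word_of)
  finally show "edges (tree_of (graft x f y)) = word_edges (word_of y @ ?w)" .
qed

text \<open>The zeros of \<open>word_of x\<close> sit at the roots of the branches of
  \<open>x\<close>. A function on the branches is therefore the same as a choice of a letter at
  every zero, and it is read back from the word at the labels of the branches.\<close>

lemma sum_graft:
  "(\<Sum>f \<in> {..<length (branches x)} \<rightarrow>\<^sub>E Nod y. G (word_of (graft x f y))) =
   (\<Sum>w\<in>word_substs (length (word_of y)) (word_of x). G (word_of y @ w))"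
proof (rule sum.reindex_bij_witness[where j = "\<lambda>f. graft_word x f (length (word_of y))"
      and i = "\<lambda>w. \<lambda>i\<in>{..<length (branches x)}. w ! (label (branches x ! i) - 1)"])
  let ?q = "length (word_of y)" and ?k = "length (branches x)"
  have Nod: "Nod y = {..?q}"
    using nodes_pos'[of y] by (auto simp: Nod_def set_tree_of)
  fix f assume f: "f \<in> {..<?k} \<rightarrow>\<^sub>E Nod y"
  show "(\<lambda>i\<in>{..<?k}. graft_word x f ?q ! (label (branches x ! i) - 1)) = f"
    using f graft_word_root(3) by (intro extensionalityI[of _ "{..<?k}"]) (auto simp: PiE_def)
  show "graft_word x f ?q \<in> word_substs ?q (word_of x)"
    unfolding in_word_substs_iff
  proof (intro conjI allI impI)
    fix j assume j: "j < length (word_of x)"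
    show "if word_of x ! j = 0 then graft_word x f ?q ! j \<le> ?q else graft_word x f ?q ! j = word_of x ! j + ?q"
    proof (cases "word_of x ! j = 0")
      case True
      then obtain i where i: "i < ?k" "label (branches x ! i) = Suc j"
        using word_of_eq_0_iff[OF j] by auto
      then have "graft_word x f ?q ! j = f i" using graft_word_root(3)[OF i(1), of f ?q] by simp
      moreover have "f i \<in> Nod y" using f i by auto
      ultimately show ?thesis using True by (simp add: Nod)
    qed (use j in \<open>simp add: graft_word_def\<close>)
  qed (simp add: graft_word_def)
  show "G (word_of y @ graft_word x f ?q) = G (word_of (graft x f y))"
    by (simp add: word_of_graft[OF f])
next
  let ?q = "length (word_of y)" and ?k = "length (branches x)"
  have Nod: "Nod y = {..?q}"
    using nodes_pos'[of y] by (auto simp: Nod_def set_tree_of)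
  fix w assume w: "w \<in> word_substs ?q (word_of x)"
  let ?f = "\<lambda>i\<in>{..<?k}. w ! (label (branches x ! i) - 1)"
  have *: "w ! (label (branches x ! i) - 1) \<le> ?q" if "i < ?k" for i
    using graft_word_root[OF that] w by (auto simp: in_word_substs_iff)
  then show "?f \<in> {..<?k} \<rightarrow>\<^sub>E Nod y" by (auto simp: Nod)
  show "graft_word x ?f ?q = w"
  proof (rule nth_equalityI)
    show "length (graft_word x ?f ?q) = length w" using w by (simp add: graft_word_def in_word_substs_iff)
    fix j assume "j < length (graft_word x ?f ?q)"
    then have j: "j < length (word_of x)" by (simp add: graft_word_def)
    show "graft_word x ?f ?q ! j = w ! j"
    proof (cases "word_of x ! j = 0")
      case True
      then obtain i where i: "i < ?k" "label (branches x ! i) = Suc j"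
        using word_of_eq_0_iff[OF j] by auto
      then show ?thesis using graft_word_root(3)[OF i(1), of ?f ?q] by simp
    qed (use j w in \<open>simp add: graft_word_def in_word_substs_iff\<close>)
  qed
qed

text \<open>\<open>backslash x y\<close> is the graft along the constant function 0. The word of the
  right factor comes first because its labels are the ones kept.\<close>

lemma word_of_backslash: "word_of (backslash x y) = word_of y @ shift_word (length (word_of y)) (word_of x)"
proof -
  let ?k = "length (branches x)" and ?f = "\<lambda>i\<in>{..<length (branches x)}. 0 :: nat"
  let ?g = "\<lambda>v. nths (shifted_branches y x) {i. ?f i = v}"
  have f: "?f \<in> {..<?k} \<rightarrow>\<^sub>E Nod y"
    using nodes_pos'[of y] by (auto simp: Nod_def set_tree_of)
  have attach_id: "attach g t = t" if "\<And>v. v \<in> set_ltree t \<Longrightarrow> g v = []" for g t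
    using that by (induction t) (auto intro!: map_idI)
  have len: "length (shifted_branches y x) = ?k" by (simp add: shifted_branches_def)
  have 0: "?g 0 = shifted_branches y x" by (rule nths_all) (simp add: len)
  have "?g v = []" if "v \<noteq> 0" for v
  proof -
    have "set (?g v) = {}" using that len by (auto simp: set_nths)
    then show ?thesis by (simp only: set_empty)
  qed
  then have "attach ?g t = t" if "t \<in> set (branches y)" for t
    using branch_labels_pos[OF that] by (intro attach_id) blast
  then have "map (attach ?g) (branches y) = branches y" by (rule map_idI)
  with 0 have "tree_of (graft x ?f y) = tree_of (backslash x y)"
    by (simp only: tree_of_graft[OF f] tree_of_backslash tree_of_branches[of y] attach.simps)
  then have "backslash x y = graft x ?f y" by (simp add: tree_of_inject)
  moreover have "graft_word x ?f q = shift_word q (word_of x)" for q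
  proof (rule nth_equalityI)
    fix j assume "j < length (graft_word x ?f q)"
    then have j: "j < length (word_of x)" by (simp add: graft_word_def)
    show "graft_word x ?f q ! j = shift_word q (word_of x) ! j"
    proof (cases "word_of x ! j = 0")
      case True
      then obtain i where "i < ?k" "label (branches x ! i) = Suc j"
        using word_of_eq_0_iff[OF j] by blast
      then show ?thesis using graft_word_root(3)[of i x ?f q] j True by (simp add: shift_word_def)
    qed (use j in \<open>simp add: graft_word_def shift_word_def\<close>)
  qed (simp add: graft_word_def)
  ultimately show ?thesis by (simp only: word_of_graft[OF f])
qed

text \<open>The node with the largest label is a leaf, so a tree for \<open>w @ [a]\<close> arises
  by grafting the two-node tree at node \<open>a\<close> of a tree for \<open>w\<close>.\<close>

lemma ex_word_of: "parent_word w \<Longrightarrow> \<exists>x. word_of x = w"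
proof (induction w rule: rev_induct)
  case Nil
  show ?case using word_of_one_node by blast
next
  case (snoc a w)
  have "parent_word w" using snoc.prems by (auto simp: parent_word_def nth_append split: if_splits)
  then obtain y where y: "word_of y = w" using snoc.IH by blast
  have a: "a \<le> length w" using snoc.prems by (auto simp: parent_word_def nth_append dest: spec[of _ "length w"])
  define x where "x = Abs_hotree (Node 0 [Node 1 []])"
  have x: "tree_of x = Node 0 [Node 1 []]"
    unfolding x_def by (rule Abs_hotree_inverse) (auto simp: is_heap_ordered_def num_nodes_def)
  have b: "branches x = [Node 1 []]" by (simp add: branches_def x)
  have wx: "word_of x = [0]" by (rule word_of_unique) (auto simp: x word_edges_def)
  let ?f = "\<lambda>i\<in>{..<length (branches x)}. a"
  have "?f \<in> {..<length (branches x)} \<rightarrow>\<^sub>E Nod y"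
    using a nodes_eq_length[of y] y by (auto simp: Nod_def set_tree_of)
  from word_of_graft[OF this] have "word_of (graft x ?f y) = w @ graft_word x ?f (length w)"
    by (simp only: y)
  also have "graft_word x ?f (length w) = [a]"
    using graft_word_root(3)[of 0 x ?f "length w"] by (simp add: b graft_word_def wx)
  finally show ?case by blast
qed

text \<open>Meaningful on parent words only; on other words \<open>inv\<close> gives an arbitrary
  tree.\<close>

definition of_word :: "nat list \<Rightarrow> hotree" where
  "of_word = inv word_of"

lemma word_of_of_word: "parent_word w \<Longrightarrow> word_of (of_word w) = w"
  using ex_word_of[of w] unfolding of_word_def by (auto intro: f_inv_into_f)

lemma of_word_word_of [simp]: "of_word (word_of x) = x"
  unfolding of_word_def by (rule inv_f_f) (auto simp: inj_def word_of_inject)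

section \<open>Restriction on parent words\<close>

definition branch_positions :: "hotree \<Rightarrow> nat set \<Rightarrow> nat set" where
  "branch_positions x S = {j. \<exists>i\<in>S. i < length (branches x) \<and> Suc j \<in> set_ltree (branches x ! i)}"

lemma branch_exists:
  assumes "j < length (word_of x)"
  obtains i where "i < length (branches x)" "Suc j \<in> set_ltree (branches x ! i)"
proof -
  have "Suc j \<in> set (concat (map preorder (branches x)))"
    unfolding labels_branches(2) using assms by simp
  then obtain t where "t \<in> set (branches x)" "Suc j \<in> set_ltree t" by (auto simp: set_preorder)
  with that show thesis by (auto simp: in_set_conv_nth)
qed

lemma branch_label_less: "t \<in> set (branches x) \<Longrightarrow> Suc j \<in> set_ltree t \<Longrightarrow> j < length (word_of x)"
proof -
  assume "t \<in> set (branches x)" "Suc j \<in> set_ltree t"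
  then have "Suc j \<in> set (concat (map preorder (branches x)))" by (auto simp: set_preorder)
  then show ?thesis unfolding labels_branches(2) by simp
qed

lemma branch_index_unique:
  assumes "i < length (branches x)" "i' < length (branches x)"
    and "l \<in> set_ltree (branches x ! i)" "l \<in> set_ltree (branches x ! i')"
  shows "i = i'"
proof -
  have "branches x ! i = branches x ! i'"
    using assms by (intro branches_disjoint[of _ x _ l]) simp_all
  then show ?thesis using branch_nth_eq_iff[OF assms(1,2)] by simp
qed

lemma branch_positions_subset: "branch_positions x S \<subseteq> {..<length (word_of x)}"
proof
  fix j assume "j \<in> branch_positions x S"
  then obtain i where i: "i < length (branches x)" "Suc j \<in> set_ltree (branches x ! i)"
    by (auto simp: branch_positions_def)
  from branch_label_less[OF nth_mem[OF i(1)] i(2)] show "j \<in> {..<length (word_of x)}" by simp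
qed

lemma branch_positions_iff:
  assumes "i < length (branches x)" "Suc j \<in> set_ltree (branches x ! i)"
  shows "j \<in> branch_positions x S \<longleftrightarrow> i \<in> S"
proof
  assume "j \<in> branch_positions x S"
  then obtain i' where i': "i' \<in> S" "i' < length (branches x)" "Suc j \<in> set_ltree (branches x ! i')"
    unfolding branch_positions_def by blast
  have "i' = i" by (rule branch_index_unique[OF i'(2) assms(1) i'(3) assms(2)])
  then show "i \<in> S" using i'(1) by simp
next
  assume "i \<in> S"
  then show "j \<in> branch_positions x S" unfolding branch_positions_def using assms by blast
qed

lemma branch_positions_Diff:
  "branch_positions x ({..<length (branches x)} - S) = {..<length (word_of x)} - branch_positions x S"
proof (rule set_eqI)
  fix j
  show "j \<in> branch_positions x ({..<length (branches x)} - S) \<longleftrightarrow> j \<in> {..<length (word_of x)} - branch_positions x S"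
  proof (cases "j < length (word_of x)")
    case True
    then obtain i where i: "i < length (branches x)" "Suc j \<in> set_ltree (branches x ! i)"
      using branch_exists by blast
    show ?thesis using True i(1) by (simp only: branch_positions_iff[OF i] Diff_iff lessThan_iff simp_thms)
  next
    case False
    then show ?thesis using branch_positions_subset by blast
  qed
qed

lemma edge_branch_iff:
  assumes "t \<in> set (branches x)"
  shows "(a, c) \<in> insert (0, label t) (edges t) \<longleftrightarrow> (a, c) \<in> edges (tree_of x) \<and> c \<in> set_ltree t"
proof
  assume "(a, c) \<in> insert (0, label t) (edges t)"
  then show "(a, c) \<in> edges (tree_of x) \<and> c \<in> set_ltree t"
    using assms edges_subset[of t] label_in[of t] by (auto simp: edges_branches)
next
  assume *: "(a, c) \<in> edges (tree_of x) \<and> c \<in> set_ltree t"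
  then obtain s where s: "s \<in> set (branches x)" "(a, c) \<in> insert (0, label s) (edges s)"
    unfolding edges_branches by blast
  then have "c \<in> set_ltree s" using edges_subset[of s] label_in[of s] by auto
  then have "s = t" using branches_disjoint[OF s(1) assms] * by blast
  then show "(a, c) \<in> insert (0, label t) (edges t)" using s(2) by simp
qed

lemma closed_in_branch_positions: "closed_in (word_of x) (branch_positions x S)"
  unfolding closed_in_def
proof (intro conjI allI impI branch_positions_subset)
  fix j assume j: "j < length (word_of x)" and nz: "word_of x ! j \<noteq> 0"
  from j obtain i where i: "i < length (branches x)" "Suc j \<in> set_ltree (branches x ! i)"
    by (rule branch_exists)
  let ?t = "branches x ! i"
  have t: "?t \<in> set (branches x)" using i by simp
  have "(word_of x ! j, Suc j) \<in> edges (tree_of x)"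
    using j by (auto simp: edges_tree_of word_edges_def)
  then have "(word_of x ! j, Suc j) \<in> edges ?t"
    using edge_branch_iff[OF t, of "word_of x ! j" "Suc j"] i(2) nz by simp
  then have p: "Suc (word_of x ! j - 1) \<in> set_ltree ?t"
    using nz edges_subset[of ?t] by auto
  show "j \<in> branch_positions x S \<longleftrightarrow> word_of x ! j - 1 \<in> branch_positions x S"
    by (simp only: branch_positions_iff[OF i] branch_positions_iff[OF i(1) p])
qed

lemma word_of_restrict_branches:
  "word_of (restrict_branches x S) = subword (word_of x) (branch_positions x S)"
proof (rule word_of_unique)
  let ?T = "Node 0 (nths (branches x) S)" and ?U = "branch_positions x S" and ?w = "word_of x"
  let ?h = "\<lambda>l. card {m \<in> set_ltree ?T. m < l}"
  have U: "?U \<subseteq> {..<length ?w}" by (rule branch_positions_subset)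
  then have fin: "finite ?U" by (rule finite_subset) simp
  have nths: "t \<in> set (nths (branches x) S) \<longleftrightarrow> (\<exists>i\<in>S. i < length (branches x) \<and> t = branches x ! i)" for t
    by (auto simp: set_nths)
  have N: "(\<Union>t\<in>set (nths (branches x) S). set_ltree t) = Suc ` ?U"
  proof (intro equalityI subsetI)
    fix l assume "l \<in> (\<Union>t\<in>set (nths (branches x) S). set_ltree t)"
    then obtain t where "t \<in> set (nths (branches x) S)" "l \<in> set_ltree t" by blast
    then obtain i where i: "i \<in> S" "i < length (branches x)" "l \<in> set_ltree (branches x ! i)"
      unfolding nths by blast
    then have "0 < l" using branch_labels_pos[OF nth_mem[OF i(2)]] by blast
    with i show "l \<in> Suc ` ?U"
      by (intro image_eqI[of _ _ "l - 1"]) (auto simp: branch_positions_def)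
  next
    fix l assume "l \<in> Suc ` ?U"
    then obtain j where j: "j \<in> ?U" "l = Suc j" by blast
    then obtain i where "i \<in> S" "i < length (branches x)" "l \<in> set_ltree (branches x ! i)"
      unfolding branch_positions_def by blast
    then show "l \<in> (\<Union>t\<in>set (nths (branches x) S). set_ltree t)" using nths by blast
  qed
  then have T: "set_ltree ?T = insert 0 (Suc ` ?U)" by simp
  \<comment> \<open>The root is counted below every other label. This extra 1 makes up for the
    offset between the label \<open>Suc j\<close> and the position \<open>j\<close>.\<close>
  have h: "?h l = rank ?U l" if "l \<in> set_ltree ?T" for l
  proof (cases "l = 0")
    case False
    with that obtain j where j: "j \<in> ?U" "l = Suc j" unfolding T by auto
    have "{m \<in> insert 0 (Suc ` ?U). m < Suc j} = insert 0 (Suc ` {i \<in> ?U. i < j})" by auto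
    then have "?h l = Suc (rank ?U j)"
      unfolding T using j(2) fin by (simp add: card_image rank_def)
    then show ?thesis using rank_Suc[OF fin j(1)] j(2) by simp
  qed simp
  have e: "edges ?T = (\<lambda>j. (?w ! j, Suc j)) ` ?U"
  proof -
    have F: "(a, c) \<in> edges ?T \<longleftrightarrow> (a, c) \<in> edges (tree_of x) \<and> c \<in> Suc ` ?U" for a c
    proof -
      have "(a, c) \<in> edges ?T \<longleftrightarrow> (\<exists>t\<in>set (nths (branches x) S). (a, c) \<in> edges (tree_of x) \<and> c \<in> set_ltree t)"
        unfolding edges_Node UN_iff
        by (rule bex_cong[OF refl], rule edge_branch_iff, erule in_set_nthsD)
      also have "\<dots> \<longleftrightarrow> (a, c) \<in> edges (tree_of x) \<and> c \<in> (\<Union>t\<in>set (nths (branches x) S). set_ltree t)"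
        by blast
      finally show ?thesis unfolding N .
    qed
    then have "edges ?T = {(a, c). (a, c) \<in> edges (tree_of x) \<and> c \<in> Suc ` ?U}"
      by (intro set_eqI) (simp only: split_paired_all F mem_Collect_eq case_prod_conv)
    also have "\<dots> = (\<lambda>j. (?w ! j, Suc j)) ` ?U"
      unfolding edges_tree_of word_edges_image using U by auto
    finally show ?thesis .
  qed
  have par: "?w ! j \<in> set_ltree ?T \<and> Suc j \<in> set_ltree ?T" if "j \<in> ?U" for j
    using edges_subset[of ?T] that unfolding e by blast
  have "edges (tree_of (restrict_branches x S)) = map_prod ?h ?h ` edges ?T"
    by (simp only: tree_of_restrict_branches standardize_def edges_map)
  also have "\<dots> = (\<lambda>j. (?h (?w ! j), ?h (Suc j))) ` ?U"
    unfolding e image_image by simp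
  also have "\<dots> = (\<lambda>j. (subword ?w ?U ! rank ?U j, Suc (rank ?U j))) ` ?U"
  proof (rule image_cong[OF refl])
    fix j assume j: "j \<in> ?U"
    have "?h (?w ! j) = subword ?w ?U ! rank ?U j" "?h (Suc j) = Suc (rank ?U j)"
      using h par[OF j] nth_subword[OF _ j U] j U rank_Suc[OF fin j] by auto
    then show "(?h (?w ! j), ?h (Suc j)) = (subword ?w ?U ! rank ?U j, Suc (rank ?U j))" by simp
  qed
  also have "\<dots> = (\<lambda>k. (subword ?w ?U ! k, Suc k)) ` rank ?U ` ?U"
    by (simp add: image_image)
  also have "\<dots> = word_edges (subword ?w ?U)"
    by (simp only: rank_image[OF fin] word_edges_image length_subword[OF U])
  finally show "edges (tree_of (restrict_branches x S)) = word_edges (subword ?w ?U)" .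
qed

text \<open>A tree is connected, so a property that does not change along edges is decided at the
  root. Applied to a branch, it shows that a closed set contains all of its nodes or none.\<close>

lemma edge_invariant:
  "(\<And>a c. (a, c) \<in> edges t \<Longrightarrow> P a \<longleftrightarrow> P c) \<Longrightarrow> l \<in> set_ltree t \<Longrightarrow> P l \<longleftrightarrow> P (label t)"
proof (induction t)
  case (Node a ts)
  show ?case
  proof (cases "l = a")
    case False
    then obtain t where t: "t \<in> set ts" "l \<in> set_ltree t" using Node.prems(2) by auto
    have "P l \<longleftrightarrow> P (label t)"
      using t Node.prems(1) by (intro Node.IH) auto
    also have "P (label t) \<longleftrightarrow> P a" using Node.prems(1)[of a "label t"] t(1) by auto
    finally show ?thesis by simp
  qed simp
qed

text \<open>Closed sets of positions are exactly the node sets of selections of branches; the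
  selection is recovered by testing the root of each branch.\<close>

lemma sum_restrict_branches:
  "(\<Sum>S\<in>Pow {..<length (branches x)}.
      G (word_of (restrict_branches x S)) (word_of (restrict_branches x ({..<length (branches x)} - S)))) =
   (\<Sum>U | closed_in (word_of x) U. G (subword (word_of x) U) (subword (word_of x) ({..<length (word_of x)} - U)))"
proof (rule sum.reindex_bij_witness[where j = "branch_positions x"
      and i = "\<lambda>U. {i. i < length (branches x) \<and> label (branches x ! i) - 1 \<in> U}"])
  let ?k = "length (branches x)" and ?l = "\<lambda>i. label (branches x ! i)"
  have l: "Suc (?l i - 1) = ?l i" if "i < ?k" for i
    using branch_labels_pos[OF nth_mem[OF that] label_in] by simp
  fix S assume "S \<in> Pow {..<?k}"
  then have S: "S \<subseteq> {..<?k}" by simp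
  have "?l i - 1 \<in> branch_positions x S \<longleftrightarrow> i \<in> S" if "i < ?k" for i
    by (rule branch_positions_iff[OF that]) (simp only: l[OF that] label_in)
  then show "{i. i < ?k \<and> ?l i - 1 \<in> branch_positions x S} = S" using S by auto
  show "branch_positions x S \<in> {U. closed_in (word_of x) U}"
    using closed_in_branch_positions by simp
  show "G (subword (word_of x) (branch_positions x S)) (subword (word_of x) ({..<length (word_of x)} - branch_positions x S)) =
      G (word_of (restrict_branches x S)) (word_of (restrict_branches x ({..<?k} - S)))"
    by (simp only: word_of_restrict_branches branch_positions_Diff)
next
  let ?k = "length (branches x)" and ?l = "\<lambda>i. label (branches x ! i)"
  have l: "Suc (?l i - 1) = ?l i" if "i < ?k" for i
    using branch_labels_pos[OF nth_mem[OF that] label_in] by simp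
  fix U assume "U \<in> {U. closed_in (word_of x) U}"
  then have U: "closed_in (word_of x) U" "U \<subseteq> {..<length (word_of x)}" by (auto simp: closed_in_def)
  show "{i. i < ?k \<and> ?l i - 1 \<in> U} \<in> Pow {..<?k}" by auto
  have inv: "l - 1 \<in> U \<longleftrightarrow> ?l i - 1 \<in> U" if "i < ?k" "l \<in> set_ltree (branches x ! i)" for i l
  proof (rule edge_invariant[of "branches x ! i" "\<lambda>l. l - 1 \<in> U", OF _ that(2)])
    fix a c assume ac: "(a, c) \<in> edges (branches x ! i)"
    have t: "branches x ! i \<in> set (branches x)" using that by simp
    have "a \<noteq> 0" by (rule branch_edge_nonroot[OF t ac])
    moreover have "(a, c) \<in> edges (tree_of x)" using edge_branch_iff[OF t] ac by blast
    ultimately show "a - 1 \<in> U \<longleftrightarrow> c - 1 \<in> U"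
      using U(1) by (auto simp: edges_tree_of word_edges_def closed_in_def)
  qed
  show "branch_positions x {i. i < ?k \<and> ?l i - 1 \<in> U} = U"
  proof (intro equalityI subsetI)
    fix j assume "j \<in> branch_positions x {i. i < ?k \<and> ?l i - 1 \<in> U}"
    then show "j \<in> U" using inv[of _ "Suc j"] by (auto simp: branch_positions_def)
  next
    fix j assume j: "j \<in> U"
    then obtain i where "i < ?k" "Suc j \<in> set_ltree (branches x ! i)"
      using U(2) branch_exists[of j x] by blast
    with j inv[of i "Suc j"] show "j \<in> branch_positions x {i. i < ?k \<and> ?l i - 1 \<in> U}"
      by (auto simp: branch_positions_def)
  qed
qed

section \<open>Irreducible trees\<close>

lemma one_node_iff: "x = one_node \<longleftrightarrow> word_of x = []"
  by (metis word_of_inject word_of_one_node)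

text \<open>A cut other than 0 gives a factorization with both factors nontrivial, and a
  factorization puts a nonzero cut at the length of its right factor.\<close>

lemma tree_irreducible_iff: "tree_irreducible x \<longleftrightarrow> cuts (word_of x) = {0}"
proof
  assume *: "tree_irreducible x"
  then have ne: "word_of x \<noteq> []" by (simp add: tree_irreducible_def one_node_iff)
  have "q = 0" if q: "q \<in> cuts (word_of x)" for q
  proof (rule ccontr)
    assume "q \<noteq> 0"
    obtain v where v: "parent_word v" "word_of x = take q (word_of x) @ shift_word q v"
      using split_at_cut[OF q] parent_word_word_of[of x] by auto
    have ql: "q < length (word_of x)" using q by (simp add: cuts_def)
    have u: "parent_word (take q (word_of x))"
      using parent_word_word_of[of x] by (auto simp: parent_word_def)
    have "x = backslash (of_word v) (of_word (take q (word_of x)))"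
      unfolding word_of_inject[symmetric] word_of_backslash word_of_of_word[OF v(1)] word_of_of_word[OF u]
      using v(2) ql by simp
    moreover have "v \<noteq> []" using arg_cong[OF v(2), of length] ql by auto
    then have "of_word v \<noteq> one_node" "of_word (take q (word_of x)) \<noteq> one_node"
      unfolding one_node_iff word_of_of_word[OF v(1)] word_of_of_word[OF u]
      using ne \<open>q \<noteq> 0\<close> by auto
    ultimately show False using * by (auto simp: tree_irreducible_def)
  qed
  with cuts_nonempty[OF ne] show "cuts (word_of x) = {0}" by blast
next
  assume c: "cuts (word_of x) = {0}"
  show "tree_irreducible x"
    unfolding tree_irreducible_def
  proof (intro conjI notI)
    assume "x = one_node"
    then show False using c by (simp add: one_node_iff cuts_def)
  next
    assume "\<exists>u v. u \<noteq> one_node \<and> v \<noteq> one_node \<and> x = backslash u v"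
    then obtain u v where uv: "word_of u \<noteq> []" "word_of v \<noteq> []" "x = backslash u v"
      by (auto simp: one_node_iff)
    have "length (word_of v) \<in> cuts (word_of x)"
      unfolding uv(3) word_of_backslash cuts_append_shift
      using cuts_nonempty[OF uv(1)] by (intro UnI2 image_eqI[of _ _ 0]) simp_all
    then have "length (word_of v) = 0" unfolding c by (rule singletonD)
    then show False using uv(2) by (simp only: length_0_conv)
  qed
qed

section \<open>Heap-ordered trees and permutations\<close>

definition perm_of :: "hotree \<Rightarrow> nat list" where
  "perm_of x = concat (map preorder (branches x))"

text \<open>The inverse of the preorder traversal: the roots of a forest are the left-to-right minima.\<close>

function forest :: "nat list \<Rightarrow> nat ltree list" where
  "forest [] = []"
| "forest (a # w) = Node a (forest (takeWhile ((<) a) w)) # forest (dropWhile ((<) a) w)"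
  by pat_completeness auto
termination
  by (relation "Wellfounded.measure length")
     (auto simp: less_Suc_eq_le length_takeWhile_le length_dropWhile_le)

lemma preorder_forest: "concat (map preorder (forest w)) = w"
  by (induction w rule: forest.induct) simp_all

lemma heap_labelled_ge: "heap_labelled t \<Longrightarrow> l \<in> set_ltree t \<Longrightarrow> label t \<le> l"
proof (induction t)
  case (Node a ts)
  then show ?case by (fastforce simp: list_all_iff)
qed

lemma label_forest_subset: "label ` set (forest w) \<subseteq> set w"
proof -
  have "label t \<in> set (concat (map preorder (forest w)))" if "t \<in> set (forest w)" for t
    using that label_in[of t] by (auto simp: set_preorder)
  then show ?thesis by (auto simp: preorder_forest)
qed

lemma heap_labelled_forest:
  "distinct w \<Longrightarrow> sorted_wrt (>) (map label (forest w)) \<and> list_all heap_labelled (forest w)"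
proof (induction w rule: forest.induct)
  case (2 a w)
  let ?u = "takeWhile ((<) a) w" and ?v = "dropWhile ((<) a) w"
  have d: "distinct ?u" "distinct ?v" using 2(3) by auto
  have u: "\<forall>t\<in>set (forest ?u). a < label t"
    using label_forest_subset[of ?u] by (auto dest: set_takeWhileD)
  have "\<forall>t\<in>set (forest ?v). label t < a"
  proof (cases ?v)
    case Nil
    show ?thesis unfolding Nil by simp
  next
    case (Cons b v)
    \<comment> \<open>\<open>b\<close> is the letter at which the first tree ends, so it is not
      above \<open>a\<close>. As the later roots are at most \<open>b\<close> by induction, they are
      all below \<open>a\<close>.\<close>
    have "\<not> a < b" using hd_dropWhile[of "(<) a" w] Cons by simp
    moreover have "b \<in> set w" using Cons by (metis list.set_intros(1) set_dropWhileD)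
    moreover from this have "b \<noteq> a" using 2(3) by auto
    ultimately have "b < a" by simp
    moreover have "label t \<le> b" if "t \<in> set (forest ?v)" for t
      using 2(2)[OF d(2)] that unfolding Cons by auto
    ultimately show ?thesis by fastforce
  qed
  then show ?case using 2(1)[OF d(1)] 2(2)[OF d(2)] u by auto
qed simp

text \<open>All labels below a root \<open>a\<close> exceed \<open>a\<close>, whereas the next root
  to the right is smaller. The prefix of letters greater than \<open>a\<close> is thus exactly the
  traversal of the subtrees of \<open>a\<close>.\<close>

lemma forest_preorder:
  "sorted_wrt (>) (map label ts) \<Longrightarrow> list_all heap_labelled ts \<Longrightarrow> forest (concat (map preorder ts)) = ts"
proof (induction "length (concat (map preorder ts))" arbitrary: ts rule: less_induct)
  case less
  show ?case
  proof (cases ts)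
    case (Cons t ts')
    obtain a ss where t: "t = Node a ss" by (cases t)
    let ?u = "concat (map preorder ss)" and ?v = "concat (map preorder ts')"
    have u: "\<forall>l\<in>set ?u. a < l"
    proof
      fix l assume "l \<in> set ?u"
      then obtain s where "s \<in> set ss" "l \<in> set_ltree s" by (auto simp: set_preorder)
      then show "a < l"
        using less.prems(2) heap_labelled_ge[of s l] by (fastforce simp: Cons t list_all_iff)
    qed
    have v: "?v = [] \<or> \<not> a < hd ?v"
    proof (cases ts')
      case (Cons s ss')
      obtain b us where "s = Node b us" by (cases s)
      then show ?thesis using less.prems(1) \<open>ts = t # ts'\<close> by (simp add: Cons t)
    qed simp
    have "takeWhile P (xs @ ys) = xs \<and> dropWhile P (xs @ ys) = ys"
      if "\<forall>l\<in>set xs. P l" "ys = [] \<or> \<not> P (hd ys)" for P and xs ys :: "nat list"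
      using that by (induction xs) (cases ys, auto)
    from this[OF u v] have "takeWhile ((<) a) (?u @ ?v) = ?u" "dropWhile ((<) a) (?u @ ?v) = ?v" by simp_all
    moreover have "forest ?u = ss"
      using less.prems by (intro less.hyps) (auto simp: Cons t)
    moreover have "forest ?v = ts'"
      using less.prems by (intro less.hyps) (auto simp: Cons t)
    ultimately show ?thesis by (simp add: Cons t)
  qed simp
qed

lemma forest_perm_of: "forest (perm_of x) = branches x"
  unfolding perm_of_def using labels_branches(4,5) by (rule forest_preorder)

lemma perm_of_inject: "perm_of x = perm_of y \<longleftrightarrow> x = y"
proof
  assume "perm_of x = perm_of y"
  then have "branches x = branches y" using forest_perm_of by metis
  then have "tree_of x = tree_of y" using tree_of_branches by metis
  then show "x = y" by (simp add: tree_of_inject)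
qed simp

lemma length_perm_of: "length (perm_of x) = nodes x - 1"
  unfolding perm_of_def by (rule labels_branches(3))

lemma perm_of_permutation: "nodes x = n + 1 \<Longrightarrow> perm_of x \<in> permutations_of_set {1..n}"
proof (rule permutations_of_setI)
  assume n: "nodes x = n + 1"
  have "set (perm_of x) = {0<..<nodes x}" unfolding perm_of_def by (rule labels_branches(2))
  also have "\<dots> = {1..n}" using n by auto
  finally show "set (perm_of x) = {1..n}" .
  show "distinct (perm_of x)" unfolding perm_of_def by (rule labels_branches(1))
qed

lemma perm_of_surj:
  assumes "w \<in> permutations_of_set {1..n}"
  obtains x where "perm_of x = w" "nodes x = n + 1"
proof -
  have w: "distinct w" "set w = {1..n}" using assms by (auto simp: permutations_of_set_def)
  then have len: "length w = n" using distinct_card[of w] by simp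
  let ?t = "Node 0 (forest w)"
  have p: "preorder ?t = 0 # w" by (simp add: preorder_forest)
  have "set_ltree ?t = {..<Suc n}"
    unfolding set_preorder[symmetric] p using w(2) by auto
  moreover have "\<forall>t\<in>set (forest w). 0 < label t"
    using label_forest_subset[of w] w(2) by fastforce
  ultimately have "is_heap_ordered ?t"
    using heap_labelled_forest[OF w(1)] w len
    unfolding is_heap_ordered_def num_nodes_def p by simp
  then have t: "tree_of (Abs_hotree ?t) = ?t" by (simp add: Abs_hotree_inverse)
  show thesis
  proof (rule that)
    show "perm_of (Abs_hotree ?t) = w"
      by (simp add: perm_of_def branches_def t preorder_forest)
    show "nodes (Abs_hotree ?t) = n + 1"
      unfolding nodes_def t num_nodes_def p by (simp add: len)
  qed
qed

lemma perm_of_backslash: "perm_of (backslash x y) = perm_backslash (perm_of x) (perm_of y)"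
proof -
  have "perm_of (backslash x y) = concat (map preorder (shifted_branches y x)) @ perm_of y"
    by (simp add: perm_of_def branches_def[of "backslash x y"] tree_of_backslash)
  also have "concat (map preorder (shifted_branches y x)) = map (\<lambda>i. i + length (perm_of y)) (perm_of x)"
    by (simp add: perm_of_def[of x] shifted_branches_def preorder_map map_concat comp_def Max_Nod length_perm_of)
  finally show ?thesis by (simp add: perm_backslash_def)
qed

lemma perm_of_Nil_iff: "perm_of x = [] \<longleftrightarrow> x = one_node"
proof -
  have "perm_of one_node = []" by (simp add: perm_of_def branches_def tree_of_one_node)
  then show ?thesis by (metis perm_of_inject)
qed

text \<open>Every permutation is \<open>perm_of\<close> some tree, so each factorization of the
  permutation lifts to one of the tree.\<close>

lemma perm_irreducible_iff:
  assumes "nodes x = n + 1"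
  shows "perm_irreducible n (perm_of x) \<longleftrightarrow> tree_irreducible x"
proof -
  have "n \<ge> 1 \<longleftrightarrow> x \<noteq> one_node"
    using assms length_perm_of[of x] perm_of_Nil_iff[of x] by (cases "perm_of x") auto
  moreover have "(\<exists>p q u v. u \<in> permutations_of_set {1..p} \<and> v \<in> permutations_of_set {1..q} \<and>
      u \<noteq> [] \<and> v \<noteq> [] \<and> perm_of x = perm_backslash u v) \<longleftrightarrow>
    (\<exists>y z. y \<noteq> one_node \<and> z \<noteq> one_node \<and> x = backslash y z)" (is "?L \<longleftrightarrow> ?R")
  proof
    assume ?L
    then obtain p q u v where uv: "u \<in> permutations_of_set {1..p}" "v \<in> permutations_of_set {1..q}"
      "u \<noteq> []" "v \<noteq> []" "perm_of x = perm_backslash u v" by blast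
    obtain y where y: "perm_of y = u" using uv(1) by (rule perm_of_surj)
    obtain z where z: "perm_of z = v" using uv(2) by (rule perm_of_surj)
    have "x = backslash y z"
      unfolding perm_of_inject[symmetric] perm_of_backslash y z by (rule uv(5))
    moreover have "y \<noteq> one_node" "z \<noteq> one_node"
      using uv(3,4) y z by (auto simp flip: perm_of_Nil_iff)
    ultimately show ?R by blast
  next
    assume ?R
    then obtain y z where yz: "y \<noteq> one_node" "z \<noteq> one_node" "x = backslash y z" by blast
    have "perm_of t \<in> permutations_of_set {1..nodes t - 1}" for t
      using nodes_pos'[of t] by (intro perm_of_permutation) simp
    with yz show ?L by (metis perm_of_Nil_iff perm_of_backslash)
  qed
  ultimately show ?thesis
    unfolding perm_irreducible_def tree_irreducible_def
    using perm_of_permutation[OF assms] by simp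
qed

lemma card_irreducible:
  "card {x. tree_irreducible x \<and> nodes x = n + 1} = card {w. perm_irreducible n w}"
proof (rule bij_betw_same_card[of perm_of], rule bij_betw_imageI)
  show "inj_on perm_of {x. tree_irreducible x \<and> nodes x = n + 1}"
    by (simp add: inj_on_def perm_of_inject)
  show "perm_of ` {x. tree_irreducible x \<and> nodes x = n + 1} = {w. perm_irreducible n w}"
  proof (intro equalityI subsetI)
    fix w assume "w \<in> {w. perm_irreducible n w}"
    then have w: "perm_irreducible n w" by simp
    then have "w \<in> permutations_of_set {1..n}" by (simp add: perm_irreducible_def)
    then obtain x where "perm_of x = w" "nodes x = n + 1" by (rule perm_of_surj)
    with w show "w \<in> perm_of ` {x. tree_irreducible x \<and> nodes x = n + 1}"
      using perm_irreducible_iff[of x n] by auto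
  qed (auto simp: perm_irreducible_iff)
qed

section \<open>Linear and bilinear maps on free vector spaces\<close>

abbreviation flinear :: "(('a \<Rightarrow>\<^sub>0 'k::field) \<Rightarrow> ('b \<Rightarrow>\<^sub>0 'k)) \<Rightarrow> bool" where
  "flinear \<equiv> Vector_Spaces.linear scale scale"

definition fbilinear :: "(('a \<Rightarrow>\<^sub>0 'k::field) \<Rightarrow> ('b \<Rightarrow>\<^sub>0 'k) \<Rightarrow> ('c \<Rightarrow>\<^sub>0 'k)) \<Rightarrow> bool" where
  "fbilinear m \<longleftrightarrow> (\<forall>q. flinear (\<lambda>p. m p q)) \<and> (\<forall>p. flinear (m p))"

lemma flinear_iff:
  "flinear f \<longleftrightarrow> (\<forall>p q. f (p + q) = f p + f q) \<and> (\<forall>c p. f (scale c p) = scale c (f p))"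
  by (simp add: Vector_Spaces.linear_iff fvs.vector_space_axioms)

lemma
  assumes "flinear f"
  shows flinear_add: "f (p + q) = f p + f q"
    and flinear_scale: "f (scale c p) = scale c (f p)"
    and flinear_diff: "f (p - q) = f p - f q"
    and flinear_zero: "f 0 = 0"
    and flinear_sum: "f (sum g A) = (\<Sum>a\<in>A. f (g a))"
proof -
  interpret Vector_Spaces.linear scale scale f by fact
  show "f (p + q) = f p + f q" "f (scale c p) = scale c (f p)" "f (p - q) = f p - f q" "f 0 = 0"
    "f (sum g A) = (\<Sum>a\<in>A. f (g a))"
    by (rule add scale diff zero sum)+
qed

lemma flinear_eq_lin_ext: "flinear f \<Longrightarrow> f p = lin_ext (\<lambda>x. f (basis_vec x)) p"
  by (rule linear_eqI) (auto intro: lin_ext_linear)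

lemma fbilinear_left: "fbilinear m \<Longrightarrow> flinear (\<lambda>p. m p q)"
  and fbilinear_right: "fbilinear m \<Longrightarrow> flinear (m p)"
  by (auto simp: fbilinear_def)

lemma fbilinear_bilin_ext: "fbilinear (bilin_ext f)"
  by (simp add: fbilinear_def linear_bilin_ext_left linear_bilin_ext_right)

lemma fbilinear_eqI:
  assumes "fbilinear m" "fbilinear m'" "\<And>x y. m (basis_vec x) (basis_vec y) = m' (basis_vec x) (basis_vec y)"
  shows "m p q = m' p q"
proof -
  have "m (basis_vec x) q = m' (basis_vec x) q" for x
    by (rule linear_eqI[OF fbilinear_right[OF assms(1)] fbilinear_right[OF assms(2)] assms(3)])
  then show ?thesis
    by (rule linear_eqI[OF fbilinear_left[OF assms(1)] fbilinear_left[OF assms(2)]])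
qed

lemma fbilinear_comp_left: "fbilinear m \<Longrightarrow> flinear f \<Longrightarrow> flinear (\<lambda>p. m (f p) q)"
  using linear_comp[OF fbilinear_left] .

lemma fbilinear_comp_right: "fbilinear m \<Longrightarrow> flinear f \<Longrightarrow> flinear (\<lambda>p. m q (f p))"
  using linear_comp[OF fbilinear_right] .

lemma fbilinear_compose:
  "fbilinear m \<Longrightarrow> flinear f \<Longrightarrow> flinear g \<Longrightarrow> fbilinear (\<lambda>p q. m (f p) (g q))"
  by (simp add: fbilinear_def fbilinear_comp_left fbilinear_comp_right)

lemma flinear_fbilinear: "flinear f \<Longrightarrow> fbilinear m \<Longrightarrow> fbilinear (\<lambda>p q. f (m p q))"
proof -
  assume f: "flinear f" and m: "fbilinear m"
  show ?thesis
    unfolding fbilinear_def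
    using linear_comp[OF f fbilinear_left[OF m]] linear_comp[OF f fbilinear_right[OF m]] by blast
qed

lemma fbilinear_tensor: "fbilinear tensor"
  unfolding tensor_def by (rule fbilinear_bilin_ext)

lemma tensor_basis [simp]: "tensor (basis_vec a) (basis_vec b) = basis_vec (a, b)"
  by (simp add: tensor_def)

text \<open>Known for basis vectors; bilinearity extends it to the right pair of arguments and then
  to the left pair.\<close>

lemma tensor_square_mult_tensor:
  assumes m: "fbilinear m"
  shows "tensor_square_mult m (tensor a b) (tensor c d) = tensor (m a c) (m b d)"
proof -
  let ?M = "tensor_square_mult m"
  have M: "fbilinear ?M" unfolding tensor_square_mult_def by (rule fbilinear_bilin_ext)
  have 1: "?M (tensor (basis_vec a) (basis_vec b)) (tensor (basis_vec c) (basis_vec d)) =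
      tensor (m (basis_vec a) (basis_vec c)) (m (basis_vec b) (basis_vec d))" for a b c d
    by (simp add: tensor_square_mult_def)
  have 2: "?M (tensor (basis_vec a) (basis_vec b)) (tensor c d) = tensor (m (basis_vec a) c) (m (basis_vec b) d)" for a b c d
    by (rule fbilinear_eqI[OF flinear_fbilinear[OF fbilinear_right[OF M] fbilinear_tensor]
          fbilinear_compose[OF fbilinear_tensor fbilinear_right[OF m] fbilinear_right[OF m]] 1])
  show ?thesis
    by (rule fbilinear_eqI[OF flinear_fbilinear[OF fbilinear_left[OF M] fbilinear_tensor]
          fbilinear_compose[OF fbilinear_tensor fbilinear_left[OF m] fbilinear_left[OF m]] 2])
qed

lemma flinear_tensor_map: "flinear (tensor_map f g)"
  unfolding tensor_map_def by (rule lin_ext_linear)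

lemma tensor_map_tensor:
  assumes "flinear f" "flinear g"
  shows "tensor_map f g (tensor a b) = tensor (f a) (g b)"
  by (rule fbilinear_eqI[OF flinear_fbilinear[OF flinear_tensor_map fbilinear_tensor]
        fbilinear_compose[OF fbilinear_tensor assms]])
     (simp add: tensor_map_def)

lemma tensor_map_tensor_map:
  assumes "flinear f" "flinear g" "flinear f'" "flinear g'"
  shows "tensor_map f' g' (tensor_map f g t) = tensor_map (\<lambda>p. f' (f p)) (\<lambda>p. g' (g p)) t"
proof (rule linear_eqI[where f = "\<lambda>t. tensor_map f' g' (tensor_map f g t)" and p = t])
  fix x
  show "tensor_map f' g' (tensor_map f g (basis_vec x)) =
      tensor_map (\<lambda>p. f' (f p)) (\<lambda>p. g' (g p)) (basis_vec x)"
    using tensor_map_tensor[OF assms(3,4)] by (cases x) (simp add: tensor_map_def)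
qed (rule linear_comp[OF flinear_tensor_map flinear_tensor_map], rule flinear_tensor_map)

lemma tensor_map_id: "(\<And>p. f p = p) \<Longrightarrow> (\<And>p. g p = p) \<Longrightarrow> tensor_map f g t = t"
proof (rule linear_eqI[where g = "\<lambda>t. t" and p = t])
  fix x
  assume "\<And>p. f p = p" "\<And>p. g p = p"
  then show "tensor_map f g (basis_vec x) = basis_vec x"
    by (cases x) (simp add: tensor_map_def)
qed (auto intro: flinear_tensor_map simp: fvs.linear_ident)

section \<open>Supports and triangular maps\<close>

lemma keys_scale_subset: "Poly_Mapping.keys (scale c p) \<subseteq> Poly_Mapping.keys p"
  by (auto simp: in_keys_iff)

lemma keys_sum_subset: "Poly_Mapping.keys (sum f A) \<subseteq> (\<Union>a\<in>A. Poly_Mapping.keys (f a))"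
proof (cases "finite A")
  case True
  then show ?thesis
  proof (induction A rule: finite_induct)
    case (insert a A)
    then show ?case using keys_add[of "f a" "sum f A"] by auto
  qed simp
qed simp

lemma keys_lin_ext: "Poly_Mapping.keys (lin_ext f p) \<subseteq> (\<Union>x\<in>Poly_Mapping.keys p. Poly_Mapping.keys (f x))"
proof -
  have "Poly_Mapping.keys (lin_ext f p) \<subseteq>
      (\<Union>x\<in>Poly_Mapping.keys p. Poly_Mapping.keys (scale (Poly_Mapping.lookup p x) (f x)))"
    unfolding lin_ext_def by (rule keys_sum_subset)
  also have "\<dots> \<subseteq> (\<Union>x\<in>Poly_Mapping.keys p. Poly_Mapping.keys (f x))"
    by (rule UN_mono[OF subset_refl keys_scale_subset])
  finally show ?thesis .
qed

lemma keys_linear: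
  "flinear f \<Longrightarrow> Poly_Mapping.keys (f p) \<subseteq> (\<Union>x\<in>Poly_Mapping.keys p. Poly_Mapping.keys (f (basis_vec x)))"
  by (subst flinear_eq_lin_ext) (auto dest: subsetD[OF keys_lin_ext])

lemma keys_bilinear:
  assumes "fbilinear m"
  shows "Poly_Mapping.keys (m p q) \<subseteq>
    (\<Union>x\<in>Poly_Mapping.keys p. \<Union>y\<in>Poly_Mapping.keys q. Poly_Mapping.keys (m (basis_vec x) (basis_vec y)))"
  using keys_linear[OF fbilinear_left[OF assms]]
  by (rule order_trans) (rule UN_mono[OF subset_refl keys_linear[OF fbilinear_right[OF assms]]])

lemma span_basis_vec: "fvs.span (basis_vec ` A) = {p :: 'a \<Rightarrow>\<^sub>0 'k::field. Poly_Mapping.keys p \<subseteq> A}"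
proof (intro equalityI subsetI)
  fix p :: "'a \<Rightarrow>\<^sub>0 'k" assume p: "p \<in> {p. Poly_Mapping.keys p \<subseteq> A}"
  have "p = lin_ext basis_vec p"
    by (rule linear_eqI[where f = "\<lambda>p. p"]) (auto simp: fvs.linear_ident lin_ext_linear)
  also have "\<dots> \<in> fvs.span (basis_vec ` A)"
    unfolding lin_ext_def using p
    by (intro fvs.span_sum fvs.span_scale fvs.span_base) auto
  finally show "p \<in> fvs.span (basis_vec ` A)" .
next
  have "fvs.span (basis_vec ` A) \<subseteq> {p :: 'a \<Rightarrow>\<^sub>0 'k. Poly_Mapping.keys p \<subseteq> A}"
  proof (rule fvs.span_minimal)
    show "fvs.subspace {p :: 'a \<Rightarrow>\<^sub>0 'k. Poly_Mapping.keys p \<subseteq> A}"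
      unfolding fvs.subspace_def
    proof (intro conjI ballI allI)
      fix c and p q :: "'a \<Rightarrow>\<^sub>0 'k"
      assume "p \<in> {p. Poly_Mapping.keys p \<subseteq> A}"
      then show "scale c p \<in> {p. Poly_Mapping.keys p \<subseteq> A}" using keys_scale_subset[of c p] by auto
      assume "q \<in> {p. Poly_Mapping.keys p \<subseteq> A}"
      with \<open>p \<in> _\<close> show "p + q \<in> {p. Poly_Mapping.keys p \<subseteq> A}" using keys_add[of p q] by auto
    qed simp
  qed auto
  then show "\<And>p :: 'a \<Rightarrow>\<^sub>0 'k. p \<in> fvs.span (basis_vec ` A) \<Longrightarrow> p \<in> {p. Poly_Mapping.keys p \<subseteq> A}" by blast
qed

text \<open>Well-foundedness of the ranks replaces finiteness of the bases. In a nonzero combination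
  a term of maximal rank has a coefficient that no other term can cancel, hence the kernel vanishes.
  Basis vectors are reached by induction on the rank, the remainder being spanned by vectors of
  smaller rank.\<close>

lemma bij_triangular:
  fixes F :: "('a \<Rightarrow>\<^sub>0 'k::field) \<Rightarrow> ('b \<Rightarrow>\<^sub>0 'k)" and r :: "'b \<Rightarrow> nat"
  assumes F: "flinear F" and m: "bij m"
    and tri: "\<And>a. Poly_Mapping.keys (F (basis_vec a) - basis_vec (m a)) \<subseteq> {b. r b < r (m a)}"
  shows "bij F"
proof (rule bijI)
  have F': "Poly_Mapping.lookup (F p) b = (\<Sum>a\<in>Poly_Mapping.keys p. Poly_Mapping.lookup p a * Poly_Mapping.lookup (F (basis_vec a)) b)" for p b
    by (subst flinear_eq_lin_ext[OF F]) (simp add: lin_ext_def lookup_sum)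
  have ker: "p = 0" if "F p = 0" for p
  proof (rule ccontr)
    assume "p \<noteq> 0"
    then have ne: "Poly_Mapping.keys p \<noteq> {}" by simp
    let ?R = "(\<lambda>a. r (m a)) ` Poly_Mapping.keys p"
    have "Max ?R \<in> ?R" using ne by (intro Max_in) auto
    then obtain a where a: "a \<in> Poly_Mapping.keys p" "Max ?R = r (m a)" by blast
    have le: "r (m b) \<le> r (m a)" if "b \<in> Poly_Mapping.keys p" for b
      unfolding a(2)[symmetric] using that by (intro Max_ge) auto
    have "Poly_Mapping.lookup (F (basis_vec b)) (m a) = (if b = a then 1 else 0)" if "b \<in> Poly_Mapping.keys p" for b
    proof -
      have "m a \<notin> Poly_Mapping.keys (F (basis_vec b) - basis_vec (m b))"
        using tri[of b] le[OF that] by auto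
      then have "Poly_Mapping.lookup (F (basis_vec b)) (m a) = Poly_Mapping.lookup (basis_vec (m b)) (m a)"
        by (simp add: in_keys_iff lookup_minus)
      also have "\<dots> = (if b = a then 1 else 0)"
        using bij_is_inj[OF m] by (simp add: lookup_single when_def inj_eq)
      finally show ?thesis .
    qed
    then have "Poly_Mapping.lookup (F p) (m a) = Poly_Mapping.lookup p a"
      unfolding F'[of p] using a(1) by (simp add: if_distrib[of "(*) _"] cong: if_cong)
    with that a show False by (simp add: in_keys_iff)
  qed
  show "inj F"
  proof (rule injI)
    fix p q assume "F p = F q"
    then have "F (p - q) = 0" by (simp add: flinear_diff[OF F])
    then have "p - q = 0" by (rule ker)
    then show "p = q" by simp
  qed
  have sub: "fvs.subspace (range F)"
    unfolding fvs.subspace_def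
  proof (intro conjI ballI allI)
    show "0 \<in> range F" using flinear_zero[OF F] rangeI[of F 0] by simp
    fix c x y assume "x \<in> range F"
    then obtain p where x: "x = F p" by blast
    show "scale c x \<in> range F" unfolding x flinear_scale[OF F, symmetric] by (rule rangeI)
    assume "y \<in> range F"
    then obtain q where y: "y = F q" by blast
    show "x + y \<in> range F" unfolding x y flinear_add[OF F, symmetric] by (rule rangeI)
  qed
  have "basis_vec b \<in> range F" for b
  proof (induction "r b" arbitrary: b rule: less_induct)
    case less
    obtain a where a: "b = m a" using bij_is_surj[OF m] by (rule surjE)
    let ?d = "F (basis_vec a) - basis_vec b"
    have "?d \<in> fvs.span (basis_vec ` {c. r c < r b})"
      unfolding span_basis_vec using tri[of a] by (simp add: a)
    also have "\<dots> \<subseteq> range F"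
      by (rule fvs.span_minimal[OF _ sub]) (use less in auto)
    finally have "?d \<in> range F" .
    from fvs.subspace_diff[OF sub rangeI[of F "basis_vec a"] this] show ?case by simp
  qed
  then have "fvs.span (range basis_vec) \<subseteq> range F"
    by (intro fvs.span_minimal[OF _ sub]) auto
  then show "surj F" by (auto simp: span_basis_vec)
qed

section \<open>Primitive elements from a coproduct over subsets\<close>

locale unital_bialgebra =
  fixes m :: "('a \<Rightarrow>\<^sub>0 'k::field) \<Rightarrow> ('a \<Rightarrow>\<^sub>0 'k) \<Rightarrow> ('a \<Rightarrow>\<^sub>0 'k)"
    and u :: "'a \<Rightarrow>\<^sub>0 'k" and \<Delta> :: "('a \<Rightarrow>\<^sub>0 'k) \<Rightarrow> ('a \<times> 'a \<Rightarrow>\<^sub>0 'k)"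
  assumes bilinear: "fbilinear m"
    and unit_left: "m u p = p" and unit_right: "m p u = p"
    and comult_linear: "flinear \<Delta>"
    and comult_mult: "\<Delta> (m p q) = tensor_square_mult m (\<Delta> p) (\<Delta> q)"
    and comult_unit: "\<Delta> u = tensor u u"
begin

lemma comult_mult_tensor:
  "tensor_square_mult m (tensor a b) (tensor c d) = tensor (m a c) (m b d)"
  by (rule tensor_square_mult_tensor[OF bilinear])

lemma fbilinear_tensor_square: "fbilinear (tensor_square_mult m)"
  unfolding tensor_square_mult_def by (rule fbilinear_bilin_ext)

text \<open>
  Apply \<open>\<Delta>\<close> to the convolution equation \<open>X * D = wt \<cdot> X\<close>: as \<open>wt\<close> is additive,
  \<open>D \<otimes> 1 + 1 \<otimes> D\<close> satisfies the resulting equation for \<open>\<Delta> \<circ> D\<close>, whose solution is unique.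
\<close>

lemma primitive_of_subsets:
  fixes C :: "'i set \<Rightarrow> bool" and X D :: "'i set \<Rightarrow> ('a \<Rightarrow>\<^sub>0 'k)" and wt :: "'i set \<Rightarrow> 'k"
  assumes fin: "\<And>U. C U \<Longrightarrow> finite U" and C_empty: "C {}" and C_Diff: "\<And>U V. C U \<Longrightarrow> C V \<Longrightarrow> C (U - V)"
    and C_Un: "\<And>U V. C U \<Longrightarrow> C V \<Longrightarrow> C (U \<union> V)"
    and X_empty: "X {} = u"
    and X_comult: "\<And>U. C U \<Longrightarrow> \<Delta> (X U) = (\<Sum>A | C A \<and> A \<subseteq> U. tensor (X A) (X (U - A)))"
    and wt: "\<And>U A. C U \<Longrightarrow> C A \<Longrightarrow> A \<subseteq> U \<Longrightarrow> wt A + wt (U - A) = wt U"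
    and D: "\<And>U. C U \<Longrightarrow> (\<Sum>A | C A \<and> A \<subseteq> U. m (X A) (D (U - A))) = scale (wt U) (X U)"
    and U: "C U"
  shows "\<Delta> (D U) = tensor (D U) u + tensor u (D U)"
  using U
proof (induction "card U" arbitrary: U rule: less_induct)
  case less
  let ?S = "\<lambda>U. {A. C A \<and> A \<subseteq> U}" and ?M = "tensor_square_mult m"
  let ?P = "\<lambda>V. tensor (D V) u + tensor u (D V)"
  note U = \<open>C U\<close>
  have finS: "finite (?S V)" if "C V" for V
    using fin[OF that] by (intro finite_subset[of "?S V" "Pow V"]) auto
  have M_add: "?M p (q + r) = ?M p q + ?M p r" for p q r
    by (rule flinear_add[OF fbilinear_right[OF fbilinear_tensor_square]])
  have M_sum: "?M (\<Sum>i\<in>A. f i) q = (\<Sum>i\<in>A. ?M (f i) q)" for A q and f :: "'i set \<Rightarrow> _"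
    by (rule flinear_sum[OF fbilinear_left[OF fbilinear_tensor_square]])
  have t_sum1: "tensor (\<Sum>i\<in>A. f i) q = (\<Sum>i\<in>A. tensor (f i) q)"
    for A and q :: "'a \<Rightarrow>\<^sub>0 'k" and f :: "'i set \<Rightarrow> 'a \<Rightarrow>\<^sub>0 'k"
    by (rule flinear_sum[OF fbilinear_left[OF fbilinear_tensor]])
  have t_sum2: "tensor q (\<Sum>i\<in>A. f i) = (\<Sum>i\<in>A. tensor q (f i))"
    for A and q :: "'a \<Rightarrow>\<^sub>0 'k" and f :: "'i set \<Rightarrow> 'a \<Rightarrow>\<^sub>0 'k"
    by (rule flinear_sum[OF fbilinear_right[OF fbilinear_tensor]])
  have t_scale1: "tensor (scale c p) q = scale c (tensor p q)" for c and p q :: "'a \<Rightarrow>\<^sub>0 'k"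
    by (rule flinear_scale[OF fbilinear_left[OF fbilinear_tensor]])
  have t_scale2: "tensor p (scale c q) = scale c (tensor p q)" for c and p q :: "'a \<Rightarrow>\<^sub>0 'k"
    by (rule flinear_scale[OF fbilinear_right[OF fbilinear_tensor]])
  \<comment> \<open>The candidate \<open>?P\<close> is inserted for the coproduct of
    \<open>D\<close>. The two summands of \<open>?P\<close> give two double sums, in each of which
    \<open>D\<close> is multiplied into one tensor factor.\<close>
  have "(\<Sum>A\<in>?S U. ?M (\<Delta> (X A)) (?P (U - A))) =
      (\<Sum>A\<in>?S U. \<Sum>B\<in>?S A. tensor (m (X B) (D (U - A))) (X (A - B))) +
      (\<Sum>A\<in>?S U. \<Sum>B\<in>?S A. tensor (X B) (m (X (A - B)) (D (U - A))))"
    by (simp add: M_sum M_add comult_mult_tensor unit_right X_comult sum.distrib)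
  \<comment> \<open>Reindexed by \<open>E = A - B\<close>, the part of \<open>A\<close> that goes to
    the factor without \<open>D\<close>. For fixed \<open>E\<close> the inner sum is then the
    defining equation of \<open>D\<close> on \<open>U - E\<close>.\<close>
  also have "(\<Sum>A\<in>?S U. \<Sum>B\<in>?S A. tensor (m (X B) (D (U - A))) (X (A - B))) =
      (\<Sum>E\<in>?S U. \<Sum>B\<in>?S (U - E). tensor (m (X B) (D (U - E - B))) (X E))"
  proof -
    have "(\<Sum>A\<in>?S U. \<Sum>B\<in>?S A. tensor (m (X B) (D (U - A))) (X (A - B))) =
        (\<Sum>(A, B)\<in>Sigma (?S U) ?S. tensor (m (X B) (D (U - A))) (X (A - B)))"
      by (rule sum.Sigma) (use finS U in auto)
    also have "\<dots> = (\<Sum>(E, B)\<in>Sigma (?S U) (\<lambda>E. ?S (U - E)). tensor (m (X B) (D (U - E - B))) (X E))"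
    proof (rule sum.reindex_bij_witness[where j = "\<lambda>(A, B). (A - B, B)" and i = "\<lambda>(E, B). (E \<union> B, B)"])
      fix a assume "a \<in> Sigma (?S U) ?S"
      then obtain A B where a: "a = (A, B)" "C A" "A \<subseteq> U" "C B" "B \<subseteq> A" by auto
      then have "U - (A - B) - B = U - A" "A - B \<union> B = A" "B \<subseteq> U - (A - B)" by auto
      then show "(case case a of (A, B) \<Rightarrow> (A - B, B) of (E, B) \<Rightarrow> (E \<union> B, B)) = a"
        "(case a of (A, B) \<Rightarrow> (A - B, B)) \<in> Sigma (?S U) (\<lambda>E. ?S (U - E))"
        "(case (case a of (A, B) \<Rightarrow> (A - B, B)) of (E, B) \<Rightarrow> tensor (m (X B) (D (U - E - B))) (X E)) =
          (case a of (A, B) \<Rightarrow> tensor (m (X B) (D (U - A))) (X (A - B)))"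
        using a C_Diff[of A B] by (auto simp del: Diff_iff)
    next
      fix a assume "a \<in> Sigma (?S U) (\<lambda>E. ?S (U - E))"
      then obtain E B where a: "a = (E, B)" "C E" "E \<subseteq> U" "C B" "B \<subseteq> U - E" by auto
      then have "E \<union> B - B = E" by auto
      then show "(case case a of (E, B) \<Rightarrow> (E \<union> B, B) of (A, B) \<Rightarrow> (A - B, B)) = a"
        "(case a of (E, B) \<Rightarrow> (E \<union> B, B)) \<in> Sigma (?S U) ?S"
        using a C_Un[of E B] by auto
    qed
    also have "\<dots> = (\<Sum>E\<in>?S U. \<Sum>B\<in>?S (U - E). tensor (m (X B) (D (U - E - B))) (X E))"
      by (rule sum.Sigma[symmetric]) (use finS U C_Diff in auto)
    finally show ?thesis .
  qed
  also have "\<dots> = (\<Sum>E\<in>?S U. scale (wt (U - E)) (tensor (X (U - E)) (X E)))"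
    using U by (intro sum.cong refl) (simp add: t_sum1[symmetric] D C_Diff t_scale1)
  also have "\<dots> = (\<Sum>B\<in>?S U. scale (wt B) (tensor (X B) (X (U - B))))"
    by (rule sum.reindex_bij_witness[where i = "\<lambda>E. U - E" and j = "\<lambda>E. U - E"])
       (use U C_Diff in \<open>auto simp: double_diff\<close>)
  also have "(\<Sum>A\<in>?S U. \<Sum>B\<in>?S A. tensor (X B) (m (X (A - B)) (D (U - A)))) =
      (\<Sum>B\<in>?S U. \<Sum>E\<in>?S (U - B). tensor (X B) (m (X E) (D (U - B - E))))"
  proof -
    have "(\<Sum>A\<in>?S U. \<Sum>B\<in>?S A. tensor (X B) (m (X (A - B)) (D (U - A)))) =
        (\<Sum>(A, B)\<in>Sigma (?S U) ?S. tensor (X B) (m (X (A - B)) (D (U - A))))"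
      by (rule sum.Sigma) (use finS U in auto)
    also have "\<dots> = (\<Sum>(B, E)\<in>Sigma (?S U) (\<lambda>B. ?S (U - B)). tensor (X B) (m (X E) (D (U - B - E))))"
    proof (rule sum.reindex_bij_witness[where j = "\<lambda>(A, B). (B, A - B)" and i = "\<lambda>(B, E). (B \<union> E, B)"])
      fix a assume "a \<in> Sigma (?S U) ?S"
      then obtain A B where a: "a = (A, B)" "C A" "A \<subseteq> U" "C B" "B \<subseteq> A" by auto
      then have "U - B - (A - B) = U - A" "B \<union> (A - B) = A" "A - B \<subseteq> U - B" "B \<subseteq> U" by auto
      then show "(case case a of (A, B) \<Rightarrow> (B, A - B) of (B, E) \<Rightarrow> (B \<union> E, B)) = a"
        "(case a of (A, B) \<Rightarrow> (B, A - B)) \<in> Sigma (?S U) (\<lambda>B. ?S (U - B))"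
        "(case (case a of (A, B) \<Rightarrow> (B, A - B)) of (B, E) \<Rightarrow> tensor (X B) (m (X E) (D (U - B - E)))) =
          (case a of (A, B) \<Rightarrow> tensor (X B) (m (X (A - B)) (D (U - A))))"
        using a C_Diff[of A B] by (auto simp del: Diff_iff)
    next
      fix a assume "a \<in> Sigma (?S U) (\<lambda>B. ?S (U - B))"
      then obtain B E where a: "a = (B, E)" "C B" "B \<subseteq> U" "C E" "E \<subseteq> U - B" by auto
      then have "B \<union> E - B = E" by auto
      then show "(case case a of (B, E) \<Rightarrow> (B \<union> E, B) of (A, B) \<Rightarrow> (B, A - B)) = a"
        "(case a of (B, E) \<Rightarrow> (B \<union> E, B)) \<in> Sigma (?S U) ?S"
        using a C_Un[of B E] by auto
    qed
    also have "\<dots> = (\<Sum>B\<in>?S U. \<Sum>E\<in>?S (U - B). tensor (X B) (m (X E) (D (U - B - E))))"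
      by (rule sum.Sigma[symmetric]) (use finS U C_Diff in auto)
    finally show ?thesis .
  qed
  also have "\<dots> = (\<Sum>B\<in>?S U. scale (wt (U - B)) (tensor (X B) (X (U - B))))"
    using U by (intro sum.cong refl) (simp add: t_sum2[symmetric] D C_Diff t_scale2)
  also have "(\<Sum>B\<in>?S U. scale (wt B) (tensor (X B) (X (U - B)))) + \<dots> =
      (\<Sum>B\<in>?S U. scale (wt U) (tensor (X B) (X (U - B))))"
    unfolding sum.distrib[symmetric] using U wt
    by (intro sum.cong refl) (simp add: fvs.scale_left_distrib[symmetric])
  also have "\<dots> = scale (wt U) (\<Delta> (X U))"
    using U by (simp add: X_comult fvs.scale_sum_right)
  also have "\<dots> = \<Delta> (\<Sum>A\<in>?S U. m (X A) (D (U - A)))"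
    using D[OF U] by (simp add: flinear_scale[OF comult_linear])
  also have "\<dots> = (\<Sum>A\<in>?S U. ?M (\<Delta> (X A)) (\<Delta> (D (U - A))))"
    by (simp add: flinear_sum[OF comult_linear] comult_mult)
  finally have eq: "(\<Sum>A\<in>?S U. ?M (\<Delta> (X A)) (?P (U - A))) = (\<Sum>A\<in>?S U. ?M (\<Delta> (X A)) (\<Delta> (D (U - A))))" .
  \<comment> \<open>By induction the summands of both equations agree for nonempty \<open>A\<close>.
    What remains is the one with \<open>A = {}\<close>, where \<open>X {}\<close> is the unit and
    can be cancelled.\<close>
  have "(\<Sum>A\<in>?S U - {{}}. ?M (\<Delta> (X A)) (?P (U - A))) = (\<Sum>A\<in>?S U - {{}}. ?M (\<Delta> (X A)) (\<Delta> (D (U - A))))"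
  proof (rule sum.cong[OF refl])
    fix A assume A: "A \<in> ?S U - {{}}"
    then have "card (U - A) < card U"
      using fin[OF U] by (intro psubset_card_mono) auto
    then show "?M (\<Delta> (X A)) (?P (U - A)) = ?M (\<Delta> (X A)) (\<Delta> (D (U - A)))"
      using less(1)[of "U - A"] A U C_Diff by simp
  qed
  moreover have "{} \<in> ?S U" using C_empty by simp
  ultimately have "?M (\<Delta> (X {})) (?P U) = ?M (\<Delta> (X {})) (\<Delta> (D U))"
    using eq finS[OF U] by (simp add: sum.remove[of "?S U" "{}"])
  moreover have "?M (tensor u u) t = t" for t
  proof (rule linear_eqI[where g = "\<lambda>t. t" and p = t])
    show "flinear (?M (tensor u u))" by (rule fbilinear_right[OF fbilinear_tensor_square])
    show "?M (tensor u u) (basis_vec x) = basis_vec x" for x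
      using comult_mult_tensor[of u u "basis_vec (fst x)" "basis_vec (snd x)"] by (simp add: unit_left)
  qed (simp add: fvs.linear_ident)
  ultimately show ?case by (simp add: X_empty comult_unit)
qed

end

section \<open>The Hopf algebra in terms of parent words\<close>

lemma HHO_mult_basis:
  "hmult HHO (basis_vec x) (basis_vec y) =
    (\<Sum>w\<in>word_substs (length (word_of y)) (word_of x). basis_vec (of_word (word_of y @ w)) :: _ \<Rightarrow>\<^sub>0 'k::field)"
  using sum_graft[where G = "\<lambda>w. basis_vec (of_word w) :: _ \<Rightarrow>\<^sub>0 'k" and x = x and y = y]
  by (simp add: HHO_def)

lemma HHO_comult_basis:
  "hcomult HHO (basis_vec x) = (\<Sum>U | closed_in (word_of x) U.
     basis_vec (of_word (subword (word_of x) U), of_word (subword (word_of x) ({..<length (word_of x)} - U)))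
       :: _ \<Rightarrow>\<^sub>0 'k::field)"
  using sum_restrict_branches[where G = "\<lambda>u v. basis_vec (of_word u, of_word v) :: _ \<Rightarrow>\<^sub>0 'k" and x = x]
  by (simp add: HHO_def)

lemma HHO_unit: "hunit HHO = basis_vec one_node"
  by (simp add: HHO_def)

lemma fbilinear_HHO: "fbilinear (hmult HHO)"
  by (simp add: HHO_def fbilinear_bilin_ext)

lemma flinear_HHO_comult: "flinear (hcomult HHO)"
  by (simp add: HHO_def lin_ext_linear)

lemma rank_mono: "finite U \<Longrightarrow> i \<le> j \<Longrightarrow> rank U i \<le> rank U j"
  unfolding rank_def by (rule card_mono) auto

lemma parent_word_subword:
  assumes "parent_word w" "U \<subseteq> {..<length w}"
  shows "parent_word (subword w U)"
  unfolding parent_word_def length_subword[OF assms(2)]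
proof (intro allI impI)
  fix k assume "k < card U"
  have fin: "finite U" using assms(2) by (rule finite_subset) simp
  from \<open>k < card U\<close> obtain i where i: "i \<in> U" "k = rank U i"
    using rank_image[OF fin] by (metis imageE lessThan_iff)
  then have "w ! i \<le> i" "i < length w" using assms by (auto simp: parent_word_def)
  then show "subword w U ! k \<le> k"
    using i nth_subword[OF _ i(1) assms(2)] rank_mono[OF fin] by simp
qed

text \<open>In a closed set a parent other than the root is itself in the set and gets positive
  rank, so standardization creates no new zeros.\<close>

lemma zeros_subword:
  assumes "closed_in w U"
  shows "zeros (subword w U) = card {i \<in> U. w ! i = 0}"
proof -
  have U: "U \<subseteq> {..<length w}" using assms by (simp add: closed_in_def)
  then have fin: "finite U" by (rule finite_subset) simp
  have z: "rank U (w ! i) = 0 \<longleftrightarrow> w ! i = 0" if "i \<in> U" for i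
  proof (cases "w ! i = 0")
    case False
    then have "w ! i - 1 \<in> U" using assms that U by (auto simp: closed_in_def)
    from rank_Suc[OF fin this] False show ?thesis by simp
  qed simp
  have "{k. k < card U \<and> 0 = subword w U ! k} = {k \<in> rank U ` U. subword w U ! k = 0}"
    by (auto simp: rank_image[OF fin])
  also have "\<dots> = rank U ` {i \<in> U. w ! i = 0}"
    using z nth_subword[OF _ _ U] U by (auto intro!: imageI)
  also have "card \<dots> = card {i \<in> U. w ! i = 0}"
    by (rule card_image, rule inj_on_subset[OF inj_on_rank[OF fin]]) auto
  finally show ?thesis by (simp add: zeros_def length_filter_conv_card length_subword[OF U])
qed

lemma subword_full: "parent_word w \<Longrightarrow> subword w {..<length w} = w"
proof -
  assume w: "parent_word w"
  have "nths w {..<length w} = w" by (rule nths_all) simp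
  moreover have "rank {..<length w} v = v" if v: "v \<in> set w" for v
  proof -
    obtain i where "i < length w" "v = w ! i" using v by (metis in_set_conv_nth)
    then have "v \<le> length w" using w by (force simp: parent_word_def)
    then have "{i. i < length w \<and> i < v} = {..<v}" by auto
    then show ?thesis by (simp add: rank_def)
  qed
  ultimately show ?thesis by (simp add: subword_def map_idI)
qed

lemma subword_empty [simp]: "subword w {} = []"
  by (simp add: subword_def)

lemma word_substs_Nil [simp]: "word_substs q [] = {[]}"
  by (simp add: word_substs_def)

lemma word_substs_0: "word_substs 0 x = {x}"
proof -
  have "w \<in> word_substs 0 x \<longleftrightarrow> w = x" for w
    unfolding in_word_substs_iff by (auto simp: list_eq_iff_nth_eq split: if_splits)
  then show ?thesis by blast
qed

lemma of_word_Nil [simp]: "of_word [] = one_node"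
  by (metis of_word_word_of word_of_one_node)

text \<open>On the left side the letters of \<open>x\<close> are substituted twice, for
  \<open>y\<close> and then for \<open>z\<close>; on the right side once, for a product of length
  \<open>length z + length y\<close>. The two agree letter by letter.\<close>

lemma HHO_mult_assoc:
  fixes p q r :: "hotree \<Rightarrow>\<^sub>0 'k::field"
  shows "hmult HHO (hmult HHO p q) r = hmult HHO p (hmult HHO q r)"
proof -
  let ?m = "hmult HHO :: (hotree \<Rightarrow>\<^sub>0 'k) \<Rightarrow> _"
  note m = fbilinear_HHO
  have 1: "?m (?m (basis_vec x) (basis_vec y)) (basis_vec z) = ?m (basis_vec x) (?m (basis_vec y) (basis_vec z))" for x y z
  proof -
    let ?x = "word_of x" and ?y = "word_of y" and ?z = "word_of z"
    let ?S = word_substs and ?b = "\<lambda>w. basis_vec (of_word w) :: hotree \<Rightarrow>\<^sub>0 'k"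
    have l: "?m (\<Sum>i\<in>A. f i) p = (\<Sum>i\<in>A. ?m (f i) p)" for f :: "nat list \<Rightarrow> _" and A p
      by (rule flinear_sum[OF fbilinear_left[OF m]])
    have r: "?m p (\<Sum>i\<in>A. f i) = (\<Sum>i\<in>A. ?m p (f i))" for f :: "nat list \<Rightarrow> _" and A p
      by (rule flinear_sum[OF fbilinear_right[OF m]])
    have pw: "word_of (of_word (word_of t @ w)) = word_of t @ w" if "w \<in> ?S (length (word_of t)) (word_of s)" for s t w
      by (rule word_of_of_word, rule parent_word_append_substs[OF _ _ that]) (rule parent_word_word_of)+
    have "?m (?m (basis_vec x) (basis_vec y)) (basis_vec z) =
       (\<Sum>w\<in>?S (length ?y) ?x. \<Sum>v\<in>?S (length ?z) (?y @ w). ?b (?z @ v))"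
      unfolding HHO_mult_basis l by (rule sum.cong[OF refl]) (simp only: HHO_mult_basis pw)
    also have "\<dots> = (\<Sum>w\<in>?S (length ?y) ?x. \<Sum>v\<in>?S (length ?z) ?y. \<Sum>v'\<in>?S (length ?z) w. ?b (?z @ v @ v'))"
      by (simp only: sum_word_substs_append)
    also have "\<dots> = (\<Sum>v\<in>?S (length ?z) ?y. \<Sum>w\<in>?S (length ?y) ?x. \<Sum>v'\<in>?S (length ?z) w. ?b (?z @ v @ v'))"
      by (rule sum.swap)
    also have "\<dots> = (\<Sum>v\<in>?S (length ?z) ?y. \<Sum>v'\<in>?S (length ?z + length ?y) ?x. ?b (?z @ v @ v'))"
      by (simp only: sum_word_substs_trans)
    also have "\<dots> = (\<Sum>v\<in>?S (length ?z) ?y. ?m (basis_vec x) (?b (?z @ v)))"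
    proof (rule sum.cong[OF refl])
      fix v assume v: "v \<in> ?S (length ?z) ?y"
      then have "length (?z @ v) = length ?z + length ?y" by (simp add: in_word_substs_iff)
      then show "(\<Sum>v'\<in>?S (length ?z + length ?y) ?x. ?b (?z @ v @ v')) = ?m (basis_vec x) (?b (?z @ v))"
        by (simp only: HHO_mult_basis pw[OF v] append_assoc)
    qed
    also have "\<dots> = ?m (basis_vec x) (?m (basis_vec y) (basis_vec z))"
      by (simp only: HHO_mult_basis[of y z] r)
    finally show ?thesis .
  qed
  have 2: "?m (?m (basis_vec x) q) r = ?m (basis_vec x) (?m q r)" for x q r
    by (rule fbilinear_eqI[OF _ flinear_fbilinear[OF fbilinear_right[OF m] m] 1])
       (rule fbilinear_compose[OF m fbilinear_right[OF m] fvs.linear_ident])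
  show ?thesis
    by (rule linear_eqI[OF fbilinear_comp_left[OF m fbilinear_left[OF m]] fbilinear_left[OF m] 2])
qed

lemma HHO_unital_bialgebra:
  "unital_bialgebra (hmult HHO :: (hotree \<Rightarrow>\<^sub>0 'k::field) \<Rightarrow> _) (hunit HHO) (hcomult HHO)"
proof (rule unital_bialgebra.intro)
  let ?m = "hmult HHO :: (hotree \<Rightarrow>\<^sub>0 'k) \<Rightarrow> _" and ?D = "hcomult HHO :: (hotree \<Rightarrow>\<^sub>0 'k) \<Rightarrow> _"
  let ?M = "tensor_square_mult ?m"
  note m = fbilinear_HHO
  show "fbilinear ?m" by (rule m)
  show "flinear ?D" by (rule flinear_HHO_comult)
  show "?m (hunit HHO) p = p" for p
  proof (rule linear_eqI[where g = "\<lambda>p. p" and p = p])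
    show "?m (hunit HHO) (basis_vec y) = basis_vec y" for y
      by (simp add: HHO_unit HHO_mult_basis word_of_one_node del: length_word_of)
  qed (rule fbilinear_right[OF m], rule fvs.linear_ident)
  show "?m p (hunit HHO) = p" for p
  proof (rule linear_eqI[where g = "\<lambda>p. p" and p = p])
    show "?m (basis_vec y) (hunit HHO) = basis_vec y" for y
      unfolding HHO_unit HHO_mult_basis word_of_one_node by (simp add: word_substs_0)
  qed (rule fbilinear_left[OF m], rule fvs.linear_ident)
  have "closed_in [] U \<longleftrightarrow> U = {}" for U by (auto simp: closed_in_def)
  then show "?D (hunit HHO) = tensor (hunit HHO) (hunit HHO)"
    by (simp add: HHO_unit HHO_comult_basis word_of_one_node del: length_word_of)
  fix p q :: "hotree \<Rightarrow>\<^sub>0 'k"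
  show "?D (?m p q) = ?M (?D p) (?D q)"
  proof (rule fbilinear_eqI[where m = "\<lambda>p q. ?D (?m p q)" and m' = "\<lambda>p q. ?M (?D p) (?D q)"])
    have M: "fbilinear ?M" unfolding tensor_square_mult_def by (rule fbilinear_bilin_ext)
    show "fbilinear (\<lambda>p q. ?D (?m p q))" by (rule flinear_fbilinear[OF flinear_HHO_comult m])
    show "fbilinear (\<lambda>p q. ?M (?D p) (?D q))"
      by (rule fbilinear_compose[OF M flinear_HHO_comult flinear_HHO_comult])
    fix x y
    let ?x = "word_of x" and ?y = "word_of y"
    let ?b = "\<lambda>u v. basis_vec (of_word u, of_word v) :: hotree \<times> hotree \<Rightarrow>\<^sub>0 'k"
    let ?X = "\<lambda>U. subword ?x U" and ?X' = "\<lambda>U. subword ?x ({..<length ?x} - U)"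
    let ?Y = "\<lambda>V. subword ?y V" and ?Y' = "\<lambda>V. subword ?y ({..<length ?y} - V)"
    have pw: "word_of (of_word (subword (word_of t) U)) = subword (word_of t) U" if "U \<subseteq> {..<length (word_of t)}" for t U
      by (rule word_of_of_word[OF parent_word_subword[OF parent_word_word_of that]])
    have "?D (?m (basis_vec x) (basis_vec y)) = (\<Sum>w\<in>word_substs (length ?y) ?x. ?D (basis_vec (of_word (?y @ w))))"
      unfolding HHO_mult_basis by (rule flinear_sum[OF flinear_HHO_comult])
    also have "\<dots> = (\<Sum>w\<in>word_substs (length ?y) ?x. \<Sum>U | closed_in (?y @ w) U.
        ?b (subword (?y @ w) U) (subword (?y @ w) ({..<length (?y @ w)} - U)))"
    proof (rule sum.cong[OF refl])
      fix w assume w: "w \<in> word_substs (length ?y) ?x"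
      have "word_of (of_word (?y @ w)) = ?y @ w"
        by (rule word_of_of_word, rule parent_word_append_substs[OF _ _ w]) (rule parent_word_word_of)+
      then show "?D (basis_vec (of_word (?y @ w))) = (\<Sum>U | closed_in (?y @ w) U.
          ?b (subword (?y @ w) U) (subword (?y @ w) ({..<length (?y @ w)} - U)))"
        by (simp only: HHO_comult_basis)
    qed
    also have "\<dots> = (\<Sum>V | closed_in ?y V. \<Sum>U | closed_in ?x U.
        \<Sum>u\<in>word_substs (length (?Y V)) (?X U). \<Sum>v\<in>word_substs (length (?Y' V)) (?X' U). ?b (?Y V @ u) (?Y' V @ v))"
      by (rule sum_substs_closed_in[OF parent_word_word_of parent_word_word_of])
    also have "\<dots> = (\<Sum>V | closed_in ?y V. \<Sum>U | closed_in ?x U. ?M (?b (?X U) (?X' U)) (?b (?Y V) (?Y' V)))"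
    proof (rule sum.cong[OF refl], rule sum.cong[OF refl])
      fix V U assume "V \<in> {V. closed_in ?y V}" "U \<in> {U. closed_in ?x U}"
      then have V: "V \<subseteq> {..<length ?y}" and U: "U \<subseteq> {..<length ?x}" by (auto simp: closed_in_def)
      have ts: "tensor (\<Sum>i\<in>A. f i) (\<Sum>j\<in>B. g j) = (\<Sum>i\<in>A. \<Sum>j\<in>B. tensor (f i) (g j))"
        for A B and f g :: "nat list \<Rightarrow> hotree \<Rightarrow>\<^sub>0 'k"
        by (subst flinear_sum[OF fbilinear_left[OF fbilinear_tensor]])
           (simp only: flinear_sum[OF fbilinear_right[OF fbilinear_tensor]])
      have "?M (?b (?X U) (?X' U)) (?b (?Y V) (?Y' V)) =
          tensor (?m (basis_vec (of_word (?X U))) (basis_vec (of_word (?Y V))))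
            (?m (basis_vec (of_word (?X' U))) (basis_vec (of_word (?Y' V))))"
        by (simp only: tensor_basis[symmetric] tensor_square_mult_tensor[OF m])
      also have "\<dots> = (\<Sum>u\<in>word_substs (length (?Y V)) (?X U). \<Sum>v\<in>word_substs (length (?Y' V)) (?X' U). ?b (?Y V @ u) (?Y' V @ v))"
        by (simp only: HHO_mult_basis ts tensor_basis pw[OF U] pw[OF V] pw[OF Diff_subset])
      finally show "(\<Sum>u\<in>word_substs (length (?Y V)) (?X U). \<Sum>v\<in>word_substs (length (?Y' V)) (?X' U). ?b (?Y V @ u) (?Y' V @ v)) =
          ?M (?b (?X U) (?X' U)) (?b (?Y V) (?Y' V))" by (rule sym)
    qed
    also have "\<dots> = ?M (?D (basis_vec x)) (?D (basis_vec y))"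
      by (simp only: HHO_comult_basis flinear_sum[OF fbilinear_left[OF M]] flinear_sum[OF fbilinear_right[OF M]])
    finally show "?D (?m (basis_vec x) (basis_vec y)) = ?M (?D (basis_vec x)) (?D (basis_vec y))" .
  qed
qed

interpretation HHO: unital_bialgebra "hmult HHO" "hunit HHO" "hcomult HHO"
  by (rule HHO_unital_bialgebra)

section \<open>Primitive generators\<close>

text \<open>
  The solution \<open>D\<close> of \<open>X * D = Y\<close> for the convolution product over subsets, obtained by isolating
  the summand \<open>A = {}\<close>, where \<open>X {}\<close> is the unit.  (On infinite sets the value is junk.)
\<close>

function conv_solve :: "('v \<Rightarrow> 'v \<Rightarrow> 'v) \<Rightarrow> ('i set \<Rightarrow> bool) \<Rightarrow> ('i set \<Rightarrow> 'v) \<Rightarrow> ('i set \<Rightarrow> 'v) \<Rightarrow> 'i set \<Rightarrow> 'v::ab_group_add" where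
  "conv_solve m C X Y U = (if finite U
     then Y U - (\<Sum>A | C A \<and> A \<subseteq> U \<and> A \<noteq> {}. m (X A) (conv_solve m C X Y (U - A))) else 0)"
  by pat_completeness auto
termination
proof (relation "Wellfounded.measure (\<lambda>(m, C, X, Y, U). card U)")
  fix C :: "'i set \<Rightarrow> bool" and U A :: "'i set" and m and X Y :: "'i set \<Rightarrow> 'v"
  assume "finite U" "A \<in> {A. C A \<and> A \<subseteq> U \<and> A \<noteq> {}}"
  then show "((m, C, X, Y, U - A), m, C, X, Y, U) \<in> Wellfounded.measure (\<lambda>(m, C, X, Y, U). card U)"
    by (auto intro!: psubset_card_mono)
qed simp

declare conv_solve.simps [simp del]

lemma sum_conv_solve:
  assumes "finite U" "C {}" "\<And>p. m (X {}) p = p"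
  shows "(\<Sum>A | C A \<and> A \<subseteq> U. m (X A) (conv_solve m C X Y (U - A))) = Y U"
proof -
  have fin: "finite {A. C A \<and> A \<subseteq> U}"
    by (rule finite_subset[of _ "Pow U"]) (use assms(1) in auto)
  have "{A. C A \<and> A \<subseteq> U} - {{}} = {A. C A \<and> A \<subseteq> U \<and> A \<noteq> {}}" by auto
  then have "(\<Sum>A | C A \<and> A \<subseteq> U. m (X A) (conv_solve m C X Y (U - A))) =
      conv_solve m C X Y U + (\<Sum>A | C A \<and> A \<subseteq> U \<and> A \<noteq> {}. m (X A) (conv_solve m C X Y (U - A)))"
    using assms(2,3) by (subst sum.remove[OF fin, of "{}"]) auto
  then show ?thesis
    by (simp add: conv_solve.simps[of m C X Y U] assms(1))
qed

text \<open>The restricted tree of the overview as a vector; it may have any number of planted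
  components.\<close>

definition component :: "nat list \<Rightarrow> nat set \<Rightarrow> (hotree \<Rightarrow>\<^sub>0 'k::field)" where
  "component w U = basis_vec (of_word (subword w U))"

text \<open>
  The additive weight is the indicator of the component of node 1 (position 0), so that the whole
  tree has weight 1 and occurs in its generator with coefficient 1.
\<close>

definition primitive_part :: "nat list \<Rightarrow> nat set \<Rightarrow> (hotree \<Rightarrow>\<^sub>0 'k::field)" where
  "primitive_part w = conv_solve (hmult HHO) (closed_in w) (component w) (\<lambda>U. if 0 \<in> U then component w U else 0)"

definition generator :: "hotree \<Rightarrow> (hotree \<Rightarrow>\<^sub>0 'k::field)" where
  "generator x = primitive_part (word_of x) {..<length (word_of x)}"

lemma generator_primitive:
  "hcomult HHO (generator x) = tensor (generator x) (hunit HHO) + tensor (hunit HHO) (generator x :: _ \<Rightarrow>\<^sub>0 'k::field)"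
  unfolding generator_def
proof (rule HHO.primitive_of_subsets[where C = "closed_in (word_of x)" and X = "component (word_of x)"
      and wt = "\<lambda>U. if 0 \<in> U then 1 else 0"])
  let ?w = "word_of x" and ?X = "component (word_of x) :: _ \<Rightarrow> _ \<Rightarrow>\<^sub>0 'k"
  show fin: "finite U" if "closed_in ?w U" for U
    using that by (auto simp: closed_in_def intro: finite_subset)
  show "closed_in ?w {}" by (rule closed_in_empty)
  show "closed_in ?w (U - V)" if "closed_in ?w U" "closed_in ?w V" for U V
    using that by (rule closed_in_Diff)
  show "closed_in ?w (U \<union> V)" if "closed_in ?w U" "closed_in ?w V" for U V
    using that by (rule closed_in_Un)
  show X0: "?X {} = hunit HHO" by (simp add: component_def HHO_unit)
  show "(if 0 \<in> A then 1 else 0) + (if 0 \<in> U - A then 1 else 0) = (if 0 \<in> U then 1 else 0 :: 'k)"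
    if "A \<subseteq> U" for U A :: "nat set"
    using that by auto
  show "closed_in ?w {..<length ?w}" by (rule closed_in_full[OF parent_word_word_of])
  show "hcomult HHO (?X U) = (\<Sum>A | closed_in ?w A \<and> A \<subseteq> U. tensor (?X A) (?X (U - A)))"
    if U: "closed_in ?w U" for U
  proof -
    have U': "U \<subseteq> {..<length ?w}" using U by (simp add: closed_in_def)
    have "word_of (of_word (subword ?w U)) = subword ?w U"
      by (rule word_of_of_word[OF parent_word_subword[OF parent_word_word_of U']])
    then have "hcomult HHO (?X U) = (\<Sum>V | closed_in (subword ?w U) V.
        basis_vec (of_word (subword (subword ?w U) V), of_word (subword (subword ?w U) ({..<card U} - V))))"
      by (simp only: component_def HHO_comult_basis length_subword[OF U'])
    also have "\<dots> = (\<Sum>A | closed_in ?w A \<and> A \<subseteq> U. basis_vec (of_word (subword ?w A), of_word (subword ?w (U - A))))"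
      by (rule sum_closed_in_subword[OF U])
    finally show ?thesis by (simp add: component_def)
  qed
  show "(\<Sum>A | closed_in ?w A \<and> A \<subseteq> U. hmult HHO (?X A) (primitive_part ?w (U - A))) =
      scale (if 0 \<in> U then 1 else 0) (?X U)" if U: "closed_in ?w U" for U
  proof -
    have "(\<Sum>A | closed_in ?w A \<and> A \<subseteq> U. hmult HHO (?X A) (primitive_part ?w (U - A))) =
        (if 0 \<in> U then ?X U else 0)"
      unfolding primitive_part_def
      by (rule sum_conv_solve[where C = "closed_in ?w" and X = ?X, OF fin[OF U] closed_in_empty])
         (simp only: X0 HHO.unit_left)
    then show ?thesis by simp
  qed
qed

section \<open>Leading terms\<close>

declare length_word_of [simp del]

lemma HHO_mult_basis_leading:
  "Poly_Mapping.keys (hmult HHO (basis_vec x) (basis_vec y) - (basis_vec (backslash x y) :: _ \<Rightarrow>\<^sub>0 'k::field)) \<subseteq>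
    {t. length (word_of t) = length (word_of x) + length (word_of y) \<and>
        zeros (word_of t) < zeros (word_of x) + zeros (word_of y)}" (is "_ \<subseteq> ?R")
proof -
  let ?S = "word_substs (length (word_of y)) (word_of x)" and ?s = "shift_word (length (word_of y)) (word_of x)"
  have "of_word (word_of y @ ?s) = backslash x y"
    by (metis of_word_word_of word_of_backslash)
  then have "hmult HHO (basis_vec x) (basis_vec y) - (basis_vec (backslash x y) :: _ \<Rightarrow>\<^sub>0 'k) =
      (\<Sum>w\<in>?S - {?s}. basis_vec (of_word (word_of y @ w)))"
    unfolding HHO_mult_basis
    by (subst sum.remove[OF finite_word_substs shift_word_in_substs]) simp
  moreover have "of_word (word_of y @ w) \<in> ?R" if w: "w \<in> ?S - {?s}" for w
  proof -
    have "word_of (of_word (word_of y @ w)) = word_of y @ w"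
      by (rule word_of_of_word, rule parent_word_append_substs[OF parent_word_word_of parent_word_word_of[of x]])
         (use w in simp)
    moreover have "zeros w < zeros (word_of x)"
      using w zeros_le[of w] zeros_eq_imp[of w] by (force simp: less_le)
    moreover have "length w = length (word_of x)" using w by (simp add: in_word_substs_iff)
    ultimately show ?thesis by (simp add: zeros_append)
  qed
  moreover have "Poly_Mapping.keys (\<Sum>w\<in>?S - {?s}. basis_vec (of_word (word_of y @ w)) :: _ \<Rightarrow>\<^sub>0 'k)
      \<subseteq> (\<Union>w\<in>?S - {?s}. Poly_Mapping.keys (basis_vec (of_word (word_of y @ w)) :: _ \<Rightarrow>\<^sub>0 'k))"
    by (rule keys_sum_subset)
  ultimately show ?thesis by (simp only: keys_single) (auto split: if_splits)
qed

text \<open>Reduces a bound on the support of a product to a condition on trees: each tree that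
  occurs is the grafting at the root or has strictly fewer components than its factors
  together.\<close>

lemma keys_HHO_mult:
  fixes p q :: "hotree \<Rightarrow>\<^sub>0 'k::field"
  assumes "Poly_Mapping.keys p \<subseteq> P" "Poly_Mapping.keys q \<subseteq> Q"
    and R: "\<And>x y t. x \<in> P \<Longrightarrow> y \<in> Q \<Longrightarrow> length (word_of t) = length (word_of x) + length (word_of y) \<Longrightarrow>
        zeros (word_of t) < zeros (word_of x) + zeros (word_of y) \<or> t = backslash x y \<Longrightarrow> t \<in> R"
  shows "Poly_Mapping.keys (hmult HHO p q) \<subseteq> R"
proof
  fix t assume "t \<in> Poly_Mapping.keys (hmult HHO p q)"
  then obtain x y where xy: "x \<in> P" "y \<in> Q"
    and t: "t \<in> Poly_Mapping.keys (hmult HHO (basis_vec x) (basis_vec y) :: _ \<Rightarrow>\<^sub>0 'k)"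
    using keys_bilinear[OF fbilinear_HHO, of p q] assms(1,2) by blast
  let ?p = "hmult HHO (basis_vec x) (basis_vec y) :: _ \<Rightarrow>\<^sub>0 'k"
  show "t \<in> R"
  proof (cases "t = backslash x y")
    case True
    then show ?thesis using xy by (intro R[of x y]) (simp_all add: word_of_backslash)
  next
    case False
    then have "t \<in> Poly_Mapping.keys (?p - basis_vec (backslash x y))"
      using t by (simp add: in_keys_iff lookup_minus lookup_single)
    then show ?thesis using HHO_mult_basis_leading[of x y] xy by (intro R[of x y]) blast+
  qed
qed

text \<open>Requiring equal length is what later yields homogeneity from the same estimate.\<close>

definition lower :: "hotree \<Rightarrow> hotree set" where
  "lower x = {t. length (word_of t) = length (word_of x) \<and> (zeros (word_of t) < zeros (word_of x) \<or>
     zeros (word_of t) = zeros (word_of x) \<and> card (cuts (word_of x)) < card (cuts (word_of t)))}"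

definition leads :: "hotree \<Rightarrow> (hotree \<Rightarrow>\<^sub>0 'k::field) \<Rightarrow> bool" where
  "leads x p \<longleftrightarrow> Poly_Mapping.keys (p - basis_vec x) \<subseteq> lower x"

lemma zeros_backslash: "zeros (word_of (backslash x y)) = zeros (word_of x) + zeros (word_of y)"
  by (simp add: word_of_backslash zeros_append zeros_shift_word)

lemma card_cuts_backslash: "card (cuts (word_of (backslash x y))) = card (cuts (word_of x)) + card (cuts (word_of y))"
  by (simp only: word_of_backslash card_cuts_append_shift add.commute)

lemma length_backslash: "length (word_of (backslash x y)) = length (word_of x) + length (word_of y)"
  by (simp add: word_of_backslash)

text \<open>Components and factors both add up under \<open>backslash\<close>, so lowering one
  factor lowers the product. The difference telescopes into a remainder from \<open>p\<close>, one
  from \<open>q\<close>, and the graftings of \<open>x\<close> on \<open>y\<close> that are not at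
  the root.\<close>

lemma leads_mult:
  fixes p q :: "hotree \<Rightarrow>\<^sub>0 'k::field"
  assumes "leads x p" "leads y q"
  shows "leads (backslash x y) (hmult HHO p q)"
proof -
  let ?m = "hmult HHO :: (hotree \<Rightarrow>\<^sub>0 'k) \<Rightarrow> _" and ?z = "backslash x y"
  have "?m p q - basis_vec ?z =
      ?m (p - basis_vec x) q + (?m (basis_vec x) (q - basis_vec y) + (?m (basis_vec x) (basis_vec y) - basis_vec ?z))"
    by (simp add: flinear_diff[OF fbilinear_left[OF fbilinear_HHO]] flinear_diff[OF fbilinear_right[OF fbilinear_HHO]])
  moreover have q: "Poly_Mapping.keys q \<subseteq> insert y (lower y)"
    using keys_add[of "q - basis_vec y" "basis_vec y"] assms(2) by (auto simp: leads_def)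
  have "Poly_Mapping.keys (?m (p - basis_vec x) q) \<subseteq> lower ?z"
    by (rule keys_HHO_mult[OF assms(1)[unfolded leads_def] q])
       (auto simp: lower_def length_backslash zeros_backslash card_cuts_backslash)
  moreover have "Poly_Mapping.keys (?m (basis_vec x) (q - basis_vec y)) \<subseteq> lower ?z"
    by (rule keys_HHO_mult[OF _ assms(2)[unfolded leads_def], of _ "{x}"])
       (auto simp: lower_def length_backslash zeros_backslash card_cuts_backslash)
  moreover have "Poly_Mapping.keys (?m (basis_vec x) (basis_vec y) - basis_vec ?z) \<subseteq> lower ?z"
    using HHO_mult_basis_leading[of x y] by (rule order_trans) (auto simp: lower_def length_backslash zeros_backslash)
  moreover have "Poly_Mapping.keys (a + (b + c)) \<subseteq> L"
    if "Poly_Mapping.keys a \<subseteq> L" "Poly_Mapping.keys b \<subseteq> L" "Poly_Mapping.keys c \<subseteq> L"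
    for a b c :: "hotree \<Rightarrow>\<^sub>0 'k" and L
    using keys_add[of a "b + c"] keys_add[of b c] that by blast
  ultimately show ?thesis
    unfolding leads_def by (simp only:)
qed

lemma keys_component: "Poly_Mapping.keys (component w U :: _ \<Rightarrow>\<^sub>0 'k::field) = {of_word (subword w U)}"
  by (simp add: component_def)

text \<open>The recursion subtracts products of the restriction to a nonempty \<open>A\<close> with
  \<open>D(U - A)\<close>. If \<open>U - A\<close> is nonempty too, such a product either loses a
  component or is a \<open>backslash\<close> of two nontrivial trees and so has at least two
  cuts.\<close>

lemma keys_primitive_part:
  fixes w :: "nat list"
  assumes w: "parent_word w" and U: "closed_in w U"
  shows "Poly_Mapping.keys (primitive_part w U - (if 0 \<in> U then component w U else 0 :: _ \<Rightarrow>\<^sub>0 'k::field)) \<subseteq>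
    {t. length (word_of t) = card U \<and> (zeros (word_of t) < card {i \<in> U. w ! i = 0} \<or>
        zeros (word_of t) = card {i \<in> U. w ! i = 0} \<and> 1 < card (cuts (word_of t)))}"
  using U
proof (induction "card U" arbitrary: U rule: less_induct)
  case less
  let ?Z = "\<lambda>U. card {i \<in> U. w ! i = 0}" and ?X = "component w :: _ \<Rightarrow> _ \<Rightarrow>\<^sub>0 'k"
  let ?Y = "\<lambda>U. if 0 \<in> U then ?X U else 0" and ?P = "primitive_part w :: _ \<Rightarrow> _ \<Rightarrow>\<^sub>0 'k"
  let ?L = "\<lambda>U. {t. length (word_of t) = card U \<and> (zeros (word_of t) < ?Z U \<or>
        zeros (word_of t) = ?Z U \<and> 1 < card (cuts (word_of t)))}"
  have fin: "finite V" if "closed_in w V" for V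
    using that by (auto simp: closed_in_def intro: finite_subset)
  have sub: "word_of (of_word (subword w V)) = subword w V" "length (subword w V) = card V"
    if "closed_in w V" for V
    using that by (auto simp: closed_in_def length_subword intro!: word_of_of_word parent_word_subword w)
  have "?P U - ?Y U = 0 - (\<Sum>A | closed_in w A \<and> A \<subseteq> U \<and> A \<noteq> {}. hmult HHO (?X A) (?P (U - A)))"
    unfolding primitive_part_def by (subst conv_solve.simps) (simp add: fin[OF less.prems])
  then have "Poly_Mapping.keys (?P U - ?Y U) \<subseteq>
      (\<Union>A\<in>{A. closed_in w A \<and> A \<subseteq> U \<and> A \<noteq> {}}. Poly_Mapping.keys (hmult HHO (?X A) (?P (U - A))))"
    using keys_sum_subset[of "\<lambda>A. hmult HHO (?X A) (?P (U - A))" "{A. closed_in w A \<and> A \<subseteq> U \<and> A \<noteq> {}}"] by simp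
  also have "\<dots> \<subseteq> ?L U"
  proof (rule UN_least)
    fix A assume "A \<in> {A. closed_in w A \<and> A \<subseteq> U \<and> A \<noteq> {}}"
    then have A: "closed_in w A" "A \<subseteq> U" "A \<noteq> {}" by auto
    define V where "V = U - A"
    have V: "closed_in w V" unfolding V_def by (rule closed_in_Diff[OF less.prems A(1)])
    show "Poly_Mapping.keys (hmult HHO (?X A) (?P (U - A))) \<subseteq> ?L U"
    proof (cases "V = {}")
      case True
      \<comment> \<open>The empty set has weight 0, so the summand for \<open>A = U\<close>, which
        would reproduce the leading tree, vanishes.\<close>
      have "?P {} = 0" unfolding primitive_part_def by (subst conv_solve.simps) simp
      moreover have "U - A = {}" using True by (simp add: V_def)
      ultimately show ?thesis
        by (simp only: flinear_zero[OF fbilinear_right[OF fbilinear_HHO]] keys_zero empty_subsetI)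
    next
      case False
      have card: "card U = card A + card V" "?Z U = ?Z A + ?Z V" "card A > 0" "card V > 0"
      proof -
        have U: "U = A \<union> V" "A \<inter> V = {}" "finite A" "finite V"
          using A fin[OF less.prems] by (auto simp: V_def intro: finite_subset)
        then show "card U = card A + card V" by (simp add: card_Un_disjoint)
        have "{i \<in> U. w ! i = 0} = {i \<in> A. w ! i = 0} \<union> {i \<in> V. w ! i = 0}" using U(1) by auto
        moreover have "{i \<in> A. w ! i = 0} \<inter> {i \<in> V. w ! i = 0} = {}" using U(2) by auto
        ultimately show "?Z U = ?Z A + ?Z V" using U(3,4) by (simp add: card_Un_disjoint)
        show "card A > 0" "card V > 0" using U(3,4) A(3) False by (simp_all add: card_gt_0_iff)
      qed
      have "Poly_Mapping.keys (?P V) \<subseteq> {t. length (word_of t) = card V \<and> zeros (word_of t) \<le> ?Z V}"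
      proof -
        have 1: "Poly_Mapping.keys (?P V - ?Y V) \<subseteq> ?L V"
          using card by (intro less.hyps V) simp
        have 2: "Poly_Mapping.keys (?Y V) \<subseteq> {t. length (word_of t) = card V \<and> zeros (word_of t) = ?Z V}"
          using sub[OF V] zeros_subword[OF V] by (simp add: keys_component)
        have "?P V = (?P V - ?Y V) + ?Y V" by simp
        then have "Poly_Mapping.keys (?P V) \<subseteq> Poly_Mapping.keys (?P V - ?Y V) \<union> Poly_Mapping.keys (?Y V)"
          using keys_add by metis
        also have "\<dots> \<subseteq> {t. length (word_of t) = card V \<and> zeros (word_of t) \<le> ?Z V}"
          using 1 2 by force
        finally show ?thesis .
      qed
      then have "Poly_Mapping.keys (hmult HHO (?X A) (?P V)) \<subseteq> ?L U"
      proof (rule keys_HHO_mult[OF equalityD1[OF keys_component]])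
        fix x y t
        assume x: "x \<in> {of_word (subword w A)}"
          and y: "y \<in> {t. length (word_of t) = card V \<and> zeros (word_of t) \<le> ?Z V}"
          and t: "length (word_of t) = length (word_of x) + length (word_of y)"
            "zeros (word_of t) < zeros (word_of x) + zeros (word_of y) \<or> t = backslash x y"
        have wx: "length (word_of x) = card A" "zeros (word_of x) = ?Z A"
          using x sub[OF A(1)] zeros_subword[OF A(1)] by (simp_all)
        have c: "card (cuts (word_of z)) > 0" if "length (word_of z) > 0" for z
          using cuts_nonempty[of "word_of z"] that by (auto simp: card_gt_0_iff)
        have "length (word_of x) > 0" "length (word_of y) > 0" using wx y card by simp_all
        then have c: "1 < card (cuts (word_of x)) + card (cuts (word_of y))"
          using c[of x] c[of y] by linarith
        have z: "zeros (word_of x) + zeros (word_of y) \<le> ?Z U" and l: "length (word_of t) = card U"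
          using t(1) wx y card by simp_all
        from t(2) have "zeros (word_of t) < ?Z U \<or> zeros (word_of t) = ?Z U \<and> 1 < card (cuts (word_of t))"
        proof
          assume "t = backslash x y"
          then have "zeros (word_of t) \<le> ?Z U" "1 < card (cuts (word_of t))"
            using z c by (simp_all only: zeros_backslash card_cuts_backslash)
          then show ?thesis by linarith
        qed (use z in linarith)
        with l show "t \<in> ?L U" by blast
      qed
      then show ?thesis by (simp add: V_def)
    qed
  qed
  finally show ?case .
qed

text \<open>An irreducible tree contains node 1, so it has weight 1, and it has a single cut, so a
  tree with as many components and more than one cut is strictly lower.\<close>

lemma leads_generator:
  assumes "tree_irreducible x"
  shows "leads x (generator x)"
proof -
  let ?w = "word_of x" and ?U = "{..<length (word_of x)}"
  have c: "cuts ?w = {0}" using assms by (simp add: tree_irreducible_iff)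
  then have ne: "0 \<in> ?U" by (auto simp: cuts_def)
  have closed: "closed_in ?w ?U" by (rule closed_in_full[OF parent_word_word_of])
  have comp: "component ?w ?U = basis_vec x"
    by (simp only: component_def subword_full[OF parent_word_word_of] of_word_word_of)
  have z: "card {i \<in> ?U. ?w ! i = 0} = zeros ?w"
    using zeros_subword[OF closed] by (simp only: subword_full[OF parent_word_word_of])
  show ?thesis
    using keys_primitive_part[OF parent_word_word_of closed]
    unfolding if_P[OF ne] comp z leads_def lower_def generator_def c by simp
qed

lemma leads_unit: "leads one_node (hunit HHO)"
  by (simp add: leads_def HHO_unit)

section \<open>Factorization into irreducible trees\<close>

text \<open>An irreducible left factor contributes only the cut at the length of the right factor.
  That length is therefore the largest cut of the product, which fixes where to split.\<close>

lemma backslash_cancel: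
  assumes "tree_irreducible x" "tree_irreducible x'" "backslash x y = backslash x' y'"
  shows "x = x' \<and> y = y'"
proof -
  have Max: "Max (cuts (word_of (backslash x y))) = length (word_of y)" if "tree_irreducible x" for x y
  proof (rule Max_eqI)
    have c: "cuts (word_of (backslash x y)) = cuts (word_of y) \<union> {length (word_of y)}"
      using that by (simp add: word_of_backslash cuts_append_shift tree_irreducible_iff)
    show "length (word_of y) \<in> cuts (word_of (backslash x y))" by (simp add: c)
    show "q \<le> length (word_of y)" if "q \<in> cuts (word_of (backslash x y))" for q
      using that unfolding c by (auto simp: cuts_def)
  qed simp
  have len: "length (word_of y) = length (word_of y')"
    using Max[OF assms(1), of y] Max[OF assms(2), of y'] assms(3) by simp
  have "word_of y @ shift_word (length (word_of y)) (word_of x) = word_of y' @ shift_word (length (word_of y')) (word_of x')"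
    using assms(3) by (simp only: word_of_backslash[symmetric])
  then show ?thesis
    using len by (simp add: word_of_inject shift_word_inject)
qed

lemma backslash_exists:
  assumes "x \<noteq> one_node"
  obtains y z where "tree_irreducible y" "x = backslash y z" "length (word_of z) < length (word_of x)"
proof -
  let ?w = "word_of x"
  have ne: "?w \<noteq> []" using assms by (simp add: one_node_iff)
  \<comment> \<open>Splitting at the largest cut makes the left factor irreducible: a further cut of
    it would be a larger cut of the whole.\<close>
  define q where "q = Max (cuts ?w)"
  have q: "q \<in> cuts ?w" unfolding q_def using cuts_nonempty[OF ne] by (intro Max_in) auto
  obtain v where v: "parent_word v" "?w = take q ?w @ shift_word q v"
    using split_at_cut[OF q] parent_word_word_of[of x] by auto
  have ql: "q < length ?w" using q by (simp add: cuts_def)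
  have u: "parent_word (take q ?w)" using parent_word_word_of[of x] by (auto simp: parent_word_def)
  have lq: "length (take q ?w) = q" using ql by (simp add: min_def)
  note [simp] = word_of_of_word[OF v(1)] word_of_of_word[OF u]
  show thesis
  proof (rule that)
    show "x = backslash (of_word v) (of_word (take q ?w))"
      unfolding word_of_inject[symmetric] word_of_backslash using v(2) lq by simp
    show "length (word_of (of_word (take q ?w))) < length ?w"
      using lq ql by simp
    have c: "cuts ?w = cuts (take q ?w) \<union> (+) q ` cuts v"
      using cuts_append_shift[of "take q ?w" v] by (simp only: lq v(2)[symmetric])
    have "v \<noteq> []" using arg_cong[OF v(2), of length] lq ql by auto
    then have "0 \<in> cuts v" by (rule cuts_nonempty)
    moreover have "r = 0" if "r \<in> cuts v" for r
    proof -
      have "q + r \<in> cuts ?w" using that c by blast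
      then have "q + r \<le> q" unfolding q_def by (intro Max_ge) auto
      then show ?thesis by simp
    qed
    ultimately show "tree_irreducible (of_word v)"
      by (auto simp: tree_irreducible_iff)
  qed
qed

definition word_tree :: "(nat \<Rightarrow> hotree) \<Rightarrow> nat list \<Rightarrow> hotree" where
  "word_tree g ws = foldr (\<lambda>n. backslash (g n)) ws one_node"

lemma bij_word_tree:
  assumes g: "bij_betw g UNIV {x. tree_irreducible x}"
  shows "bij (word_tree g)"
proof (rule bijI)
  have irr: "tree_irreducible (g n)" for n using g by (auto simp: bij_betw_def)
  have ne: "word_tree g (n # ws) \<noteq> one_node" for n ws
  proof -
    have "word_of (g n) \<noteq> []" using irr[of n] by (simp add: tree_irreducible_def one_node_iff)
    then have "length (word_of (word_tree g (n # ws))) > 0"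
      by (simp add: word_tree_def length_backslash)
    then show ?thesis by (auto simp: one_node_iff)
  qed
  have "us = vs" if "word_tree g us = word_tree g vs" for us vs
    using that
  proof (induction us arbitrary: vs)
    case Nil
    then show ?case using ne[of "hd vs" "tl vs"] by (cases vs) (auto simp: word_tree_def)
  next
    case (Cons n us)
    obtain k vs' where vs: "vs = k # vs'"
      using Cons.prems ne[of n us] by (cases vs) (auto simp: word_tree_def)
    have "g n = g k \<and> word_tree g us = word_tree g vs'"
      using Cons.prems by (intro backslash_cancel irr) (simp add: vs word_tree_def)
    then show ?case using Cons.IH g by (simp add: vs bij_betw_def inj_def)
  qed
  then show "inj (word_tree g)" by (rule injI)
  have "x \<in> range (word_tree g)" for x
  proof (induction "length (word_of x)" arbitrary: x rule: less_induct)
    case less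
    show ?case
    proof (cases "x = one_node")
      case True
      then show ?thesis by (intro image_eqI[of _ _ "[]"]) (simp_all add: word_tree_def)
    next
      case False
      then obtain y z where yz: "tree_irreducible y" "x = backslash y z" "length (word_of z) < length (word_of x)"
        by (rule backslash_exists)
      obtain n where n: "y = g n" using yz(1) g by (auto simp: bij_betw_def)
      obtain ws where "z = word_tree g ws" using less[OF yz(3)] by auto
      then show ?thesis using yz(2) n by (intro image_eqI[of _ _ "n # ws"]) (simp_all add: word_tree_def)
    qed
  qed
  then show "surj (word_tree g)" by auto
qed

text \<open>The generating space has basis \<open>nat\<close>, so the irreducible trees must be
  indexed by all natural numbers. The witnesses have node 1 as the only child of the root and all
  other nodes as children of node 1.\<close>

lemma infinite_irreducible: "infinite {x. tree_irreducible x}"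
proof
  assume fin: "finite {x. tree_irreducible x}"
  let ?w = "\<lambda>n. 0 # replicate n (Suc 0)"
  have p: "parent_word (?w n)" for n by (auto simp: parent_word_def nth_Cons split: nat.split)
  have "cuts (?w n) = {0}" for n
  proof -
    have "q = 0" if "q \<in> cuts (?w n)" for q
    proof (rule ccontr)
      assume "q \<noteq> 0"
      then obtain r where r: "q = Suc r" by (cases q) auto
      with that have "r < n" "?w n ! q = 0 \<or> q < ?w n ! q" by (auto simp: cuts_def)
      then show False using r by simp
    qed
    then show ?thesis using cuts_nonempty[of "?w n"] by auto
  qed
  then have "of_word (?w n) \<in> {x. tree_irreducible x}" for n
    by (simp add: tree_irreducible_iff word_of_of_word[OF p])
  then have "range (\<lambda>n. of_word (?w n)) \<subseteq> {x. tree_irreducible x}" by blast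
  then have "finite (range (\<lambda>n. of_word (?w n)))" using fin by (rule finite_subset)
  moreover have "inj (\<lambda>n. of_word (?w n))"
  proof (rule injI)
    fix n k assume "of_word (?w n) = of_word (?w k)"
    then have "word_of (of_word (?w n)) = word_of (of_word (?w k))" by simp
    then have "length (?w n) = length (?w k)" by (simp only: word_of_of_word[OF p])
    then show "n = k" by simp
  qed
  ultimately show False using finite_imageD by blast
qed

lemma finite_nodes: "finite {x. nodes x = n}"
proof -
  have "word_of ` {x. nodes x = n} \<subseteq> {w. set w \<subseteq> {..n} \<and> length w = n - 1}"
  proof
    fix w assume "w \<in> word_of ` {x. nodes x = n}"
    then obtain x where x: "w = word_of x" "nodes x = n" by auto
    have "a \<le> n" if a: "a \<in> set w" for a
    proof -
      obtain i where i: "i < length w" "a = w ! i" using a by (metis in_set_conv_nth)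
      then have "a \<le> i" using parent_word_word_of[of x] x(1) by (simp add: parent_word_def)
      then show ?thesis using i(1) x by (simp add: length_word_of)
    qed
    then show "w \<in> {w. set w \<subseteq> {..n} \<and> length w = n - 1}" using x by (auto simp: length_word_of)
  qed
  then have "finite (word_of ` {x. nodes x = n})"
    by (rule finite_subset) (simp add: finite_lists_length_eq)
  then show ?thesis
    by (rule finite_imageD) (simp add: inj_on_def word_of_inject)
qed

lemma ex_enumeration: "\<exists>g :: nat \<Rightarrow> hotree. bij_betw g UNIV {x. tree_irreducible x}"
proof -
  have "inj word_of" by (simp add: inj_def word_of_inject)
  then have "countable (UNIV :: hotree set)"
    by (rule countable_image_inj_on[of word_of, rotated]) simp
  then have "countable {x. tree_irreducible x}" by (rule countable_subset[rotated]) simp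
  then show ?thesis using infinite_irreducible by (blast intro: bij_betw_from_nat_into)
qed

section \<open>The isomorphism\<close>

definition word_prod :: "(nat \<Rightarrow> hotree) \<Rightarrow> nat list \<Rightarrow> (hotree \<Rightarrow>\<^sub>0 'k::field)" where
  "word_prod g ws = foldr (\<lambda>n. hmult HHO (generator (g n))) ws (hunit HHO)"

definition free_map :: "(nat \<Rightarrow> hotree) \<Rightarrow> (nat list \<Rightarrow>\<^sub>0 'k::field) \<Rightarrow> (hotree \<Rightarrow>\<^sub>0 'k)" where
  "free_map g = lin_ext (word_prod g)"

lemma word_prod_simps [simp]:
  "word_prod g [] = hunit HHO"
  "word_prod g (n # ws) = hmult HHO (generator (g n)) (word_prod g ws)"
  by (simp_all add: word_prod_def)

lemma flinear_free_map: "flinear (free_map g)"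
  unfolding free_map_def by (rule lin_ext_linear)

lemma free_map_basis [simp]: "free_map g (basis_vec ws) = word_prod g ws"
  by (simp add: free_map_def)

lemma leads_word_prod:
  assumes "\<And>n. tree_irreducible (g n)"
  shows "leads (word_tree g ws) (word_prod g ws)"
proof (induction ws)
  case Nil
  show ?case by (simp add: word_tree_def leads_unit)
next
  case (Cons n ws)
  then show ?case using leads_mult[OF leads_generator[OF assms]] by (simp add: word_tree_def)
qed

lemma bij_free_map:
  assumes g: "bij_betw g UNIV {x. tree_irreducible x}"
  shows "bij (free_map g :: _ \<Rightarrow> _ \<Rightarrow>\<^sub>0 'k::field)"
proof (rule bij_triangular[OF flinear_free_map bij_word_tree[OF g]])
  \<comment> \<open>Encodes the lexicographic order on \<open>lower\<close>, as there are at most as many cuts as zeros.\<close>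
  let ?r = "\<lambda>x. zeros (word_of x) * zeros (word_of x) + zeros (word_of x) - card (cuts (word_of x))"
  have irr: "\<And>n. tree_irreducible (g n)" using g by (auto simp: bij_betw_def)
  have "?r t < ?r x" if t: "t \<in> lower x" for t x
  proof -
    have le: "card (cuts (word_of z)) \<le> zeros (word_of z)" for z
      by (rule card_cuts_le_zeros[OF parent_word_word_of])
    have "a * a + a - c < b * b + b - d" if "c \<le> a" "d \<le> b" "a < b \<or> a = b \<and> d < c" for a b c d :: nat
      using that(3)
    proof
      \<comment> \<open>Then \<open>b * b\<close> is at least \<open>a * a + 2 * a + 1\<close>,
        which exceeds \<open>a * a + a\<close>; adding \<open>b - d\<close> does not decrease it
        because \<open>d\<close> is at most \<open>b\<close>.\<close>
      assume "a < b"
      then have "Suc a * Suc a \<le> b * b" by (intro mult_le_mono) simp_all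
      with that(1,2) show ?thesis by simp
    next
      assume "a = b \<and> d < c"
      with that(1,2) show ?thesis by auto
    qed
    then show ?thesis using le[of t] le[of x] t by (simp add: lower_def)
  qed
  then show "Poly_Mapping.keys (free_map g (basis_vec ws) - (basis_vec (word_tree g ws) :: _ \<Rightarrow>\<^sub>0 'k)) \<subseteq>
      {b. ?r b < ?r (word_tree g ws)}" for ws
    using leads_word_prod[of g ws, OF irr] by (auto simp: leads_def)
qed

lemma free_map_concat_mult:
  "free_map g (concat_mult p q) = (hmult HHO (free_map g p) (free_map g q) :: _ \<Rightarrow>\<^sub>0 'k::field)"
proof (rule fbilinear_eqI[where m = "\<lambda>p q. free_map g (concat_mult p q)" and m' = "\<lambda>p q. hmult HHO (free_map g p) (free_map g q)"])
  show "fbilinear (\<lambda>p q. free_map g (concat_mult p q) :: _ \<Rightarrow>\<^sub>0 'k)"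
    unfolding concat_mult_def by (rule flinear_fbilinear[OF flinear_free_map fbilinear_bilin_ext])
  show "fbilinear (\<lambda>p q. hmult HHO (free_map g p) (free_map g q) :: _ \<Rightarrow>\<^sub>0 'k)"
    by (rule fbilinear_compose[OF fbilinear_HHO flinear_free_map flinear_free_map])
  have "word_prod g (u @ v) = (hmult HHO (word_prod g u) (word_prod g v) :: _ \<Rightarrow>\<^sub>0 'k)" for u v
    by (induction u) (simp_all add: HHO.unit_left HHO_mult_assoc)
  then show "free_map g (concat_mult (basis_vec u) (basis_vec v)) =
      (hmult HHO (free_map g (basis_vec u)) (free_map g (basis_vec v)) :: _ \<Rightarrow>\<^sub>0 'k)" for u v
    by (simp add: concat_mult_def)
qed

text \<open>Both sides are multiplicative in words, and they agree on a letter because its generator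
  is primitive.\<close>

lemma free_map_comult:
  "hcomult HHO (free_map g p) = tensor_map (free_map g) (free_map g) (lin_ext word_comult p :: _ \<Rightarrow>\<^sub>0 'k::field)"
proof (rule linear_eqI[where f = "\<lambda>p. hcomult HHO (free_map g p)" and p = p])
  let ?F = "free_map g :: _ \<Rightarrow> _ \<Rightarrow>\<^sub>0 'k" and ?m = "hmult HHO :: (hotree \<Rightarrow>\<^sub>0 'k) \<Rightarrow> _"
  note F = flinear_free_map
  show "flinear (\<lambda>p. hcomult HHO (?F p))" by (rule linear_comp[OF flinear_HHO_comult F])
  show "flinear (\<lambda>p. tensor_map ?F ?F (lin_ext word_comult p))"
    by (rule linear_comp[OF flinear_tensor_map lin_ext_linear])
  have mult: "tensor_map ?F ?F (tensor_square_mult concat_mult s t) =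
      tensor_square_mult ?m (tensor_map ?F ?F s) (tensor_map ?F ?F t)" for s t
  proof (rule fbilinear_eqI[where m = "\<lambda>s t. tensor_map ?F ?F (tensor_square_mult concat_mult s t)"
        and m' = "\<lambda>s t. tensor_square_mult ?m (tensor_map ?F ?F s) (tensor_map ?F ?F t)"])
    show "fbilinear (\<lambda>s t. tensor_map ?F ?F (tensor_square_mult concat_mult s t))"
      unfolding tensor_square_mult_def by (rule flinear_fbilinear[OF flinear_tensor_map fbilinear_bilin_ext])
    show "fbilinear (\<lambda>s t. tensor_square_mult ?m (tensor_map ?F ?F s) (tensor_map ?F ?F t))"
      by (rule fbilinear_compose[OF HHO.fbilinear_tensor_square flinear_tensor_map flinear_tensor_map])
    fix s t :: "nat list \<times> nat list"
    obtain a b c d where st: "s = (a, b)" "t = (c, d)" by (cases s, cases t)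
    have "tensor_map ?F ?F (tensor_square_mult concat_mult (basis_vec s) (basis_vec t)) =
        tensor (?F (concat_mult (basis_vec a) (basis_vec c))) (?F (concat_mult (basis_vec b) (basis_vec d)))"
    proof -
      have "tensor_square_mult concat_mult (basis_vec s) (basis_vec t) = (basis_vec (a @ c, b @ d) :: _ \<Rightarrow>\<^sub>0 'k)"
        by (simp add: st tensor_square_concat_mult)
      moreover have "concat_mult (basis_vec u) (basis_vec v) = (basis_vec (u @ v) :: _ \<Rightarrow>\<^sub>0 'k)" for u v :: "nat list"
        by (simp add: concat_mult_def)
      ultimately show ?thesis by (simp add: tensor_map_def)
    qed
    also have "\<dots> = tensor_square_mult ?m (tensor (?F (basis_vec a)) (?F (basis_vec b)))
        (tensor (?F (basis_vec c)) (?F (basis_vec d)))"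
      by (simp only: free_map_concat_mult HHO.comult_mult_tensor)
    also have "\<dots> = tensor_square_mult ?m (tensor_map ?F ?F (basis_vec s)) (tensor_map ?F ?F (basis_vec t))"
      by (simp add: st tensor_map_def)
    finally show "tensor_map ?F ?F (tensor_square_mult concat_mult (basis_vec s) (basis_vec t)) =
        tensor_square_mult ?m (tensor_map ?F ?F (basis_vec s)) (tensor_map ?F ?F (basis_vec t))" .
  qed
  have "hcomult HHO (word_prod g ws) = tensor_map ?F ?F (word_comult ws)" for ws
  proof (induction ws)
    case Nil
    show ?case using HHO.comult_unit by (simp add: tensor_map_def)
  next
    case (Cons n ws)
    have "hcomult HHO (word_prod g (n # ws)) =
        tensor_square_mult ?m (tensor (hunit HHO) (generator (g n)) + tensor (generator (g n)) (hunit HHO))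
          (tensor_map ?F ?F (word_comult ws))"
      by (simp add: HHO.comult_mult generator_primitive Cons.IH add.commute)
    also have "tensor (hunit HHO) (generator (g n)) + tensor (generator (g n)) (hunit HHO) =
        tensor_map ?F ?F (basis_vec ([], [n]) + basis_vec ([n], []))"
      by (simp add: flinear_add[OF flinear_tensor_map] tensor_map_def lin_ext_add HHO.unit_right)
    finally show ?case by (simp only: word_comult.simps mult)
  qed
  then show "hcomult HHO (?F (basis_vec ws)) = tensor_map ?F ?F (lin_ext word_comult (basis_vec ws))" for ws
    by simp
qed

text \<open>Freeness produces a map out of the tensor algebra, while the isomorphism wanted starts
  at \<open>HHO\<close>.\<close>

lemma hopf_iso_inv:
  assumes F: "flinear F" "bij F"
    and mult: "\<And>p q. F (hmult B p q) = hmult A (F p) (F q)"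
    and unit: "F (hunit B) = hunit A"
    and comult: "\<And>p. hcomult A (F p) = tensor_map F F (hcomult B p)"
    and counit: "\<And>p. hcounit A (F p) = hcounit B p"
  shows "hopf_iso A B (inv F)"
proof -
  have [simp]: "F (inv F p) = p" "inv F (F q) = q" for p q
    using F(2) by (simp_all add: bij_is_inj bij_is_surj surj_f_inv_f)
  have inj: "F p = F q \<Longrightarrow> p = q" for p q using F(2) by (simp add: bij_is_inj inj_eq)
  have lin: "flinear (inv F)"
    unfolding flinear_iff using F(1) by (auto intro!: inj simp: flinear_add flinear_scale)
  have "hcomult B (inv F p) = tensor_map (inv F) (inv F) (hcomult A p)" for p
  proof -
    have "tensor_map (inv F) (inv F) (hcomult A (F (inv F p))) = hcomult B (inv F p)"
      unfolding comult by (subst tensor_map_tensor_map[OF F(1) F(1) lin lin]) (simp add: tensor_map_id)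
    then show ?thesis by simp
  qed
  moreover have "inv F (hmult A p q) = hmult B (inv F p) (inv F q)" for p q
    by (rule inj) (simp add: mult)
  moreover have "inv F (hunit A) = hunit B" by (rule inj) (simp add: unit)
  moreover have "hcounit B (inv F p) = hcounit A p" for p
    using counit[of "inv F p"] by simp
  ultimately show ?thesis
    unfolding hopf_iso_def using lin F(2) by (simp add: bij_imp_bij_inv)
qed

section \<open>Gradings by degrees of basis vectors\<close>

text \<open>A common form for the gradings of the generating space, of its tensor algebra and of
  \<open>HHO\<close>, each given by degrees of basis vectors.\<close>

definition degree_part :: "('a \<Rightarrow> nat) \<Rightarrow> nat \<Rightarrow> ('a \<Rightarrow>\<^sub>0 'k::field) set" where
  "degree_part d n = {p. Poly_Mapping.keys p \<subseteq> {a. d a = n}}"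

lemma degree_part_span: "degree_part d n = fvs.span (basis_vec ` {a. d a = n})"
  by (simp add: degree_part_def span_basis_vec)

lemma is_grading_degree_part: "is_grading (degree_part d :: nat \<Rightarrow> ('a \<Rightarrow>\<^sub>0 'k::field) set)"
  unfolding is_grading_def
proof (intro conjI allI)
  show "fvs.subspace (degree_part d n :: ('a \<Rightarrow>\<^sub>0 'k) set)" for n
    unfolding degree_part_span by (rule fvs.subspace_span)
  fix v :: "'a \<Rightarrow>\<^sub>0 'k"
  let ?K = "Poly_Mapping.keys v"
  define c :: "nat \<Rightarrow>\<^sub>0 ('a \<Rightarrow>\<^sub>0 'k)" where
    "c = (\<Sum>a\<in>?K. Poly_Mapping.single (d a) (Poly_Mapping.single a (Poly_Mapping.lookup v a)))"
  have c: "Poly_Mapping.lookup (Poly_Mapping.lookup c n) a = (if d a = n then Poly_Mapping.lookup v a else 0)" for n a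
  proof -
    have "Poly_Mapping.lookup (Poly_Mapping.lookup c n) a =
        (\<Sum>b\<in>?K. Poly_Mapping.lookup (Poly_Mapping.lookup
           (Poly_Mapping.single (d b) (Poly_Mapping.single b (Poly_Mapping.lookup v b))) n) a)"
      by (simp only: c_def lookup_sum)
    also have "\<dots> = (\<Sum>b\<in>?K. if b = a then (if d a = n then Poly_Mapping.lookup v a else 0) else 0)"
      by (rule sum.cong[OF refl]) (auto simp: lookup_single when_def)
    also have "\<dots> = (if d a = n then Poly_Mapping.lookup v a else 0)"
      by (simp add: in_keys_iff)
    finally show ?thesis .
  qed
  show "\<exists>!c. (\<forall>n. Poly_Mapping.lookup c n \<in> degree_part d n) \<and>
      v = (\<Sum>n\<in>Poly_Mapping.keys c. Poly_Mapping.lookup c n)"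
  proof (rule ex1I[of _ c], intro conjI allI)
    show "Poly_Mapping.lookup c n \<in> degree_part d n" for n
      by (auto simp: degree_part_def in_keys_iff c split: if_splits)
    show "v = (\<Sum>n\<in>Poly_Mapping.keys c. Poly_Mapping.lookup c n)"
    proof (rule poly_mapping_eqI)
      fix a
      have "Poly_Mapping.lookup (\<Sum>n\<in>Poly_Mapping.keys c. Poly_Mapping.lookup c n) a =
          (if d a \<in> Poly_Mapping.keys c then Poly_Mapping.lookup v a else 0)"
        by (simp add: lookup_sum c)
      also have "\<dots> = Poly_Mapping.lookup v a"
        using c[of "d a" a] by (auto simp: in_keys_iff)
      finally show "Poly_Mapping.lookup v a = Poly_Mapping.lookup (\<Sum>n\<in>Poly_Mapping.keys c. Poly_Mapping.lookup c n) a" by simp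
    qed
  next
    fix e assume e: "(\<forall>n. Poly_Mapping.lookup e n \<in> degree_part d n) \<and>
        v = (\<Sum>n\<in>Poly_Mapping.keys e. Poly_Mapping.lookup e n)"
    have z: "Poly_Mapping.lookup (Poly_Mapping.lookup e n) a = 0" if "d a \<noteq> n" for n a
      using e that by (auto simp: degree_part_def in_keys_iff subset_iff)
    have "Poly_Mapping.lookup (Poly_Mapping.lookup e n) a = Poly_Mapping.lookup (Poly_Mapping.lookup c n) a" for n a
    proof (cases "d a = n")
      case True
      have "Poly_Mapping.lookup v a = (\<Sum>n\<in>Poly_Mapping.keys e. Poly_Mapping.lookup (Poly_Mapping.lookup e n) a)"
        using e by (metis lookup_sum)
      also have "\<dots> = (\<Sum>n\<in>Poly_Mapping.keys e. if n = d a then Poly_Mapping.lookup (Poly_Mapping.lookup e (d a)) a else 0)"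
        by (rule sum.cong[OF refl]) (auto simp: z)
      also have "\<dots> = Poly_Mapping.lookup (Poly_Mapping.lookup e (d a)) a"
        by (simp add: in_keys_iff)
      finally show ?thesis using True by (simp add: c)
    qed (simp add: c z)
    then show "e = c" by (intro poly_mapping_eqI)
  qed
qed

lemma
  assumes "finite {a. d a = n}"
  shows finite_dimensional_degree_part: "finite_dimensional (degree_part d n :: ('a \<Rightarrow>\<^sub>0 'k::field) set)"
    and dim_degree_part: "fvs.dim (degree_part d n :: ('a \<Rightarrow>\<^sub>0 'k::field) set) = card {a. d a = n}"
proof -
  let ?B = "basis_vec ` {a. d a = n} :: ('a \<Rightarrow>\<^sub>0 'k) set"
  show "finite_dimensional (degree_part d n :: ('a \<Rightarrow>\<^sub>0 'k) set)"
    unfolding finite_dimensional_def degree_part_span using assms by blast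
  have inj: "inj (basis_vec :: 'a \<Rightarrow> 'a \<Rightarrow>\<^sub>0 'k)"
    by (rule injI) (metis keys_single singleton_inject zero_neq_one)
  have "\<not> fvs.dependent ?B"
    unfolding fvs.dependent_def
  proof
    assume "\<exists>b\<in>?B. b \<in> fvs.span (?B - {b})"
    then obtain a where a: "(basis_vec a :: 'a \<Rightarrow>\<^sub>0 'k) \<in> fvs.span (?B - {basis_vec a})" by blast
    have "?B - {basis_vec a} = basis_vec ` ({a. d a = n} - {a})"
      using inj by (auto simp: inj_def)
    with a show False by (simp add: span_basis_vec)
  qed
  then have "fvs.dim ?B = card ?B" by (rule fvs.dim_eq_card_independent)
  then show "fvs.dim (degree_part d n :: ('a \<Rightarrow>\<^sub>0 'k) set) = card {a. d a = n}"
    unfolding degree_part_span fvs.dim_span by (simp add: card_image inj_on_subset[OF inj])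
qed

lemma keys_concat_mult:
  "Poly_Mapping.keys (concat_mult p q) \<subseteq> {u @ v | u v. u \<in> Poly_Mapping.keys p \<and> v \<in> Poly_Mapping.keys (q :: _ \<Rightarrow>\<^sub>0 'k::field)}"
proof -
  have "fbilinear (concat_mult :: (_ \<Rightarrow>\<^sub>0 'k) \<Rightarrow> _)"
    unfolding concat_mult_def by (rule fbilinear_bilin_ext)
  from keys_bilinear[OF this, of p q] show ?thesis
    by (auto simp: concat_mult_def subset_iff) blast
qed

lemma tensor_grading_degree_part:
  "tensor_grading (degree_part d) n = (degree_part (\<lambda>ws. sum_list (map d ws)) n :: ('x list \<Rightarrow>\<^sub>0 'k::field) set)"
proof (rule antisym)
  let ?G = "{foldr (\<lambda>w. concat_mult (tensor_incl w)) ws (basis_vec []) | ws ds.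
      list_all2 (\<lambda>w k. w \<in> (degree_part d k :: ('x \<Rightarrow>\<^sub>0 'k) set)) ws ds \<and> sum_list ds = n}"
  have "foldr (\<lambda>w. concat_mult (tensor_incl w)) ws (basis_vec []) \<in>
      (degree_part (\<lambda>ws. sum_list (map d ws)) (sum_list ds) :: ('x list \<Rightarrow>\<^sub>0 'k) set)"
    if "list_all2 (\<lambda>w k. w \<in> degree_part d k) ws ds" for ws ds
    using that
  proof (induction ws ds rule: list_all2_induct)
    case Nil
    then show ?case by (simp add: degree_part_def)
  next
    case (Cons w ws k ds)
    have "Poly_Mapping.keys (tensor_incl w) \<subseteq> {[x] | x. x \<in> Poly_Mapping.keys w}"
      using keys_lin_ext[of "\<lambda>x. basis_vec [x] :: _ \<Rightarrow>\<^sub>0 'k" w] by (auto simp: tensor_incl_def)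
    then have "sum_list (map d u) = k" if "u \<in> Poly_Mapping.keys (tensor_incl w)" for u
      using that Cons.hyps(1) by (fastforce simp: degree_part_def)
    moreover have "sum_list (map d v) = sum_list ds"
      if "v \<in> Poly_Mapping.keys (foldr (\<lambda>w. concat_mult (tensor_incl w)) ws (basis_vec []) :: _ \<Rightarrow>\<^sub>0 'k)" for v
      using that Cons.IH by (auto simp: degree_part_def)
    ultimately show ?case
      using keys_concat_mult[of "tensor_incl w" "foldr (\<lambda>w. concat_mult (tensor_incl w)) ws (basis_vec [])"]
      by (fastforce simp: degree_part_def)
  qed
  then have "?G \<subseteq> degree_part (\<lambda>ws. sum_list (map d ws)) n" by blast
  then show "tensor_grading (degree_part d) n \<subseteq> (degree_part (\<lambda>ws. sum_list (map d ws)) n :: ('x list \<Rightarrow>\<^sub>0 'k) set)"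
    unfolding tensor_grading_def
    by (rule fvs.span_minimal) (simp add: degree_part_span fvs.subspace_span)
  have "basis_vec us \<in> ?G" if us: "sum_list (map d us) = n" for us
  proof -
    have "foldr (\<lambda>w. concat_mult (tensor_incl w)) (map basis_vec us) (basis_vec []) = (basis_vec us :: _ \<Rightarrow>\<^sub>0 'k)"
      by (induction us) (simp_all add: tensor_incl_def concat_mult_def)
    moreover have "list_all2 (\<lambda>w k. w \<in> (degree_part d k :: ('x \<Rightarrow>\<^sub>0 'k) set)) (map basis_vec us) (map d us)"
      by (simp add: list_all2_conv_all_nth degree_part_def)
    ultimately show ?thesis using us by (intro CollectI exI[of _ "map basis_vec us"] exI[of _ "map d us"]) simp
  qed
  then show "(degree_part (\<lambda>ws. sum_list (map d ws)) n :: ('x list \<Rightarrow>\<^sub>0 'k) set) \<subseteq> tensor_grading (degree_part d) n"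
    unfolding degree_part_span tensor_grading_def by (intro fvs.span_mono) auto
qed

lemma HHO_grading_degree_part:
  "HHO_grading n = (degree_part (\<lambda>x. length (word_of x)) n :: (hotree \<Rightarrow>\<^sub>0 'k::field) set)"
proof -
  have "{basis_vec x | x. nodes x = n + 1} = (basis_vec ` {x. length (word_of x) = n} :: (hotree \<Rightarrow>\<^sub>0 'k) set)"
    by (auto simp: nodes_eq_length)
  then show ?thesis by (simp only: HHO_grading_def degree_part_span)
qed

text \<open>\<open>F\<close> commutes with the projections to degree \<open>n\<close>. Any preimage
  of a homogeneous vector can thus be replaced by its part of degree \<open>n\<close>.\<close>

lemma degree_part_image:
  fixes F :: "('a \<Rightarrow>\<^sub>0 'k::field) \<Rightarrow> ('b \<Rightarrow>\<^sub>0 'k)"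
  assumes F: "flinear F" "surj F" and deg: "\<And>a. F (basis_vec a) \<in> degree_part e (d a)"
  shows "F ` degree_part d n = degree_part e n"
proof (intro equalityI subsetI)
  fix q assume "q \<in> F ` degree_part d n"
  then obtain p where p: "q = F p" "Poly_Mapping.keys p \<subseteq> {a. d a = n}" by (auto simp: degree_part_def)
  then show "q \<in> degree_part e n"
    using keys_linear[OF F(1), of p] deg by (fastforce simp: degree_part_def)
next
  let ?\<pi> = "\<lambda>p. lin_ext (\<lambda>a. if d a = n then basis_vec a else 0) p :: 'a \<Rightarrow>\<^sub>0 'k"
  let ?\<rho> = "\<lambda>q. lin_ext (\<lambda>b. if e b = n then basis_vec b else 0) q :: 'b \<Rightarrow>\<^sub>0 'k"
  have \<rho>: "?\<rho> q = (if m = n then q else 0)" if "q \<in> degree_part e m" for q m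
  proof -
    have "?\<rho> q = lin_ext (\<lambda>b. if m = n then basis_vec b else 0) q"
      unfolding lin_ext_def using that by (intro sum.cong) (auto simp: degree_part_def)
    moreover have "lin_ext basis_vec q = q"
      by (rule linear_eqI[where g = "\<lambda>q. q"]) (auto simp: fvs.linear_ident lin_ext_linear)
    moreover have "lin_ext (\<lambda>b. 0) q = (0 :: 'b \<Rightarrow>\<^sub>0 'k)" by (simp add: lin_ext_def)
    ultimately show ?thesis by simp
  qed
  fix q :: "'b \<Rightarrow>\<^sub>0 'k" assume q: "q \<in> degree_part e n"
  obtain p where p: "q = F p" using F(2) by (metis surjD)
  have "F (?\<pi> p) = ?\<rho> (F p)"
  proof (rule linear_eqI[where f = "\<lambda>p. F (?\<pi> p)" and g = "\<lambda>p. ?\<rho> (F p)"])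
    show "flinear (\<lambda>p. F (?\<pi> p))" by (rule linear_comp[OF F(1) lin_ext_linear])
    show "flinear (\<lambda>p. ?\<rho> (F p))" by (rule linear_comp[OF lin_ext_linear F(1)])
    show "F (?\<pi> (basis_vec a)) = ?\<rho> (F (basis_vec a))" for a
      using \<rho>[OF deg, of a] flinear_zero[OF F(1)] by simp
  qed
  then have "q = F (?\<pi> p)" using \<rho>[OF q] p by simp
  moreover have "?\<pi> p \<in> degree_part d n"
    using keys_lin_ext[of "\<lambda>a. if d a = n then basis_vec a else 0 :: 'a \<Rightarrow>\<^sub>0 'k" p]
    by (fastforce simp: degree_part_def split: if_splits)
  ultimately show "q \<in> F ` degree_part d n" by blast
qed

text \<open>Homogeneity follows from the leading-term estimate, since all trees in
  \<open>lower\<close> have the length of the leading tree.\<close>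

lemma word_prod_degree:
  assumes "\<And>n. tree_irreducible (g n)"
  shows "word_prod g ws \<in> degree_part (\<lambda>x. length (word_of x)) (sum_list (map (\<lambda>n. length (word_of (g n))) ws))"
proof -
  have "length (word_of (word_tree g ws)) = sum_list (map (\<lambda>n. length (word_of (g n))) ws)"
    by (induction ws) (simp_all add: word_tree_def word_of_one_node length_backslash)
  moreover have "Poly_Mapping.keys (word_prod g ws) \<subseteq> insert (word_tree g ws) (lower (word_tree g ws))"
    using keys_add[of "word_prod g ws - basis_vec (word_tree g ws)" "basis_vec (word_tree g ws)"]
      leads_word_prod[of g ws, OF assms] by (auto simp: leads_def)
  ultimately show ?thesis by (auto simp: degree_part_def lower_def)
qed

theorem corollary3p6:
  shows "\<exists>(W :: nat \<Rightarrow> (nat \<Rightarrow>\<^sub>0 'k::field_char_0) set)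
          (\<phi> :: (hotree \<Rightarrow>\<^sub>0 'k) \<Rightarrow> (nat list \<Rightarrow>\<^sub>0 'k)).
      is_grading W \<and>
      (\<forall>n. finite_dimensional (W n) \<and>
           fvs.dim (W n) = card {x. tree_irreducible x \<and> nodes x = n + 1} \<and>
           fvs.dim (W n) = card {w. perm_irreducible n w}) \<and>
      hopf_iso HHO tensor_hopf \<phi> \<and>
      (\<forall>n. \<phi> ` HHO_grading n = tensor_grading W n)"
proof -
  obtain g :: "nat \<Rightarrow> hotree" where g: "bij_betw g UNIV {x. tree_irreducible x}"
    using ex_enumeration by blast
  have irr: "\<And>n. tree_irreducible (g n)" using g by (auto simp: bij_betw_def)
  define d where "d n = length (word_of (g n))" for n
  let ?W = "degree_part d :: nat \<Rightarrow> (nat \<Rightarrow>\<^sub>0 'k) set"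
  let ?F = "free_map g :: (nat list \<Rightarrow>\<^sub>0 'k) \<Rightarrow> _"
  have img: "g ` {k. d k = n} = {x. tree_irreducible x \<and> nodes x = n + 1}" for n
    using g by (auto simp: d_def nodes_eq_length bij_betw_def)
  have inj: "inj_on g {k. d k = n}" for n
    using g by (auto simp: bij_betw_def intro: inj_on_subset)
  have fin: "finite {k. d k = n}" for n
    using finite_imageD[OF _ inj] img finite_subset[OF _ finite_nodes[of "n + 1"]] by auto
  have card: "card {k. d k = n} = card {x. tree_irreducible x \<and> nodes x = n + 1}" for n
    using card_image[OF inj] img by metis
  have bij: "bij ?F" by (rule bij_free_map[OF g])
  have F: "?F (basis_vec ws) \<in> degree_part (\<lambda>x. length (word_of x)) (sum_list (map d ws))" for ws
    using word_prod_degree[of g ws, OF irr] by (simp add: d_def[abs_def])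
  have counit: "Poly_Mapping.lookup (?F p) one_node = Poly_Mapping.lookup p []" for p
  proof -
    have "Poly_Mapping.lookup (word_prod g ws) one_node = (if ws = [] then 1 else 0 :: 'k)" for ws
    proof (cases ws)
      case (Cons n us)
      \<comment> \<open>A nonempty word has positive degree, so the one-node tree cannot occur in
        its image.\<close>
      have "d n > 0" using irr[of n] by (auto simp: d_def tree_irreducible_def one_node_iff)
      then have "one_node \<notin> Poly_Mapping.keys (?F (basis_vec ws))"
        using F[of ws] by (auto simp: degree_part_def Cons word_of_one_node)
      then show ?thesis using Cons by (simp add: in_keys_iff)
    qed (simp add: HHO_unit)
    then have "Poly_Mapping.lookup (?F p) one_node =
        (\<Sum>ws\<in>Poly_Mapping.keys p. Poly_Mapping.lookup p ws * (if ws = [] then 1 else 0))"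
      by (simp add: free_map_def lin_ext_def lookup_sum)
    also have "\<dots> = (\<Sum>ws\<in>Poly_Mapping.keys p. if ws = [] then Poly_Mapping.lookup p ws else 0)"
      by (rule sum.cong) simp_all
    finally show ?thesis by (simp add: in_keys_iff)
  qed
  have "hopf_iso HHO tensor_hopf (inv ?F)"
  proof (rule hopf_iso_inv[OF flinear_free_map bij])
    show "?F (hmult tensor_hopf p q) = hmult HHO (?F p) (?F q)" for p q
      by (simp add: tensor_hopf_def free_map_concat_mult)
    show "?F (hunit tensor_hopf) = hunit HHO" by (simp add: tensor_hopf_def)
    show "hcomult HHO (?F p) = tensor_map ?F ?F (hcomult tensor_hopf p)" for p
      by (simp add: tensor_hopf_def free_map_comult)
    show "hcounit HHO (?F p) = hcounit tensor_hopf p" for p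
      using counit by (simp add: tensor_hopf_def HHO_def)
  qed
  moreover have "inv ?F ` HHO_grading n = tensor_grading ?W n" for n
  proof -
    have "?F ` tensor_grading ?W n = HHO_grading n"
      unfolding tensor_grading_degree_part HHO_grading_degree_part
      by (rule degree_part_image[OF flinear_free_map bij_is_surj[OF bij] F])
    then show ?thesis by (metis bij bij_is_inj image_inv_f_f)
  qed
  moreover have "is_grading ?W" by (rule is_grading_degree_part)
  moreover have "finite_dimensional (?W n) \<and>
      fvs.dim (?W n) = card {x. tree_irreducible x \<and> nodes x = n + 1} \<and>
      fvs.dim (?W n) = card {w. perm_irreducible n w}" for n
    using finite_dimensional_degree_part[OF fin] dim_degree_part[OF fin] card[of n] card_irreducible[of n] by metis
  ultimately show ?thesis by blast
qed

end
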